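(* Let $k$ be an algebraically closed field of characteristic $0$, let $A = k[x,y]/(f)$ be an irreducible quasi-homogeneous plane curve over $k$ (i.e. $f$ is an irreducible polynomial), and let $B = \widehat A \cong k[[x,y]]/(f)$ be its completion at the maximal ideal $(x,y)$. Then any gradable finitely generated torsion free $B$-module $N$ admits an integrable connection $\nabla: \mathrm{Der}_k(B)\to\mathrm{End}_k(N)$.
   Context: Quasi-homogeneous plane curve: $k[x,y]$ is graded by positive integer weights $w_x = \deg(x)$, $w_y = \deg(y)$ with $\gcd(w_x,w_y)=1$; $f\in k[x,y]$ is a nonzero homogeneous element of positive weight; $A = k[x,y]/(f)$ is assumed reduced and carries the induced grading. A finitely generated graded ($\mathbf{Z}$-graded) $A$-module $M$ is torsion free if the natural map $M\to M\otimes_A Q(A)$ is injective, where $Q(A)$ is the localization of $A$ at the set of homogeneous non-zero divisors. A finitely generated $B$-module $N$ is torsion free if the natural map from $N$ to $N\otimes_B Q(B)$ is injective, with $Q(B)$ the total ring of fractions of $B$. A torsion free $B$-module $N$ is gradable if $N\cong \widehat M$ (the $(x,y)$-adic completion) for some finitely generated graded torsion free $A$-module $M$. $\mathrm{Der}_k(B)$ is the $B$-module of $k$-linear derivations $B\to B$. A connection on $N$ is a $B$-linear homomorphism $\nabla: \mathrm{Der}_k(B)\to \mathrm{End}_k(N)$ such that $\nabla_P(bn) = b\nabla_P(n)+P(b)n$ for all $P\in \mathrm{Der}_k(B)$, $b\in B$, $n\in N$; it is integrable if it is a homomorphism of Lie algebras. *)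

theory Defs
  imports
    "HOL-Algebra.Algebraic_Closure_Type"
    "HOL-Algebra.Ideal_Product"
    "HOL-Algebra.Free_Abelian_Groups"
begin

section \<open>Commutative algebra\<close>

definition nonzero_divisors :: "('r, 'z) ring_scheme \<Rightarrow> 'r set" where
  "nonzero_divisors R =
     {s \<in> carrier R. \<forall>a\<in>carrier R. s \<otimes>\<^bsub>R\<^esub> a = \<zero>\<^bsub>R\<^esub> \<longrightarrow> a = \<zero>\<^bsub>R\<^esub>}"

definition finitely_generated ::
  "('r, 'z) ring_scheme \<Rightarrow> ('r, 'm, 'y) module_scheme \<Rightarrow> bool" where
  "finitely_generated R M \<longleftrightarrow>
     (\<exists>G. finite G \<and> G \<subseteq> carrier M \<and>
        (\<forall>m\<in>carrier M. \<exists>c\<in>G \<rightarrow> carrier R. m = (\<Oplus>\<^bsub>M\<^esub>g\<in>G. c g \<odot>\<^bsub>M\<^esub> g)))"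

definition module_isomorphic ::
  "('r, 'z) ring_scheme \<Rightarrow> ('r, 'm, 'y) module_scheme \<Rightarrow> ('r, 'n, 'w) module_scheme \<Rightarrow> bool"
  where
  "module_isomorphic R M N \<longleftrightarrow>
     (\<exists>h. bij_betw h (carrier M) (carrier N) \<and>
        (\<forall>m\<in>carrier M. \<forall>m'\<in>carrier M. h (m \<oplus>\<^bsub>M\<^esub> m') = h m \<oplus>\<^bsub>N\<^esub> h m') \<and>
        (\<forall>r\<in>carrier R. \<forall>m\<in>carrier M. h (r \<odot>\<^bsub>M\<^esub> m) = r \<odot>\<^bsub>N\<^esub> h m))"


subsection \<open>Localization, tensor products and torsion freeness\<close>

text \<open>The fraction \<open>a / s\<close> is the class of all pairs \<open>(b, t)\<close> equivalent to \<open>(a, s)\<close>;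
  \<open>S\<close> is meant to be a multiplicatively closed set containing \<open>1\<close>.\<close>

definition fraction ::
  "('r, 'z) ring_scheme \<Rightarrow> 'r set \<Rightarrow> 'r \<Rightarrow> 'r \<Rightarrow> ('r \<times> 'r) set" where
  "fraction R S a s =
     {(b, t). b \<in> carrier R \<and> t \<in> S \<and>
        (\<exists>u\<in>S. u \<otimes>\<^bsub>R\<^esub> (t \<otimes>\<^bsub>R\<^esub> a \<ominus>\<^bsub>R\<^esub> s \<otimes>\<^bsub>R\<^esub> b) = \<zero>\<^bsub>R\<^esub>)}"

definition localization ::
  "('r, 'z) ring_scheme \<Rightarrow> 'r set \<Rightarrow> ('r, ('r \<times> 'r) set) module" where
  "localization R S =
     \<lparr>carrier = {fraction R S a s |a s. a \<in> carrier R \<and> s \<in> S},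
      monoid.mult = (\<lambda>U V. \<Union>(a, s)\<in>U. \<Union>(b, t)\<in>V. fraction R S (a \<otimes>\<^bsub>R\<^esub> b) (s \<otimes>\<^bsub>R\<^esub> t)),
      one = fraction R S \<one>\<^bsub>R\<^esub> \<one>\<^bsub>R\<^esub>,
      ring.zero = fraction R S \<zero>\<^bsub>R\<^esub> \<one>\<^bsub>R\<^esub>,
      add = (\<lambda>U V. \<Union>(a, s)\<in>U. \<Union>(b, t)\<in>V.
               fraction R S (t \<otimes>\<^bsub>R\<^esub> a \<oplus>\<^bsub>R\<^esub> s \<otimes>\<^bsub>R\<^esub> b) (s \<otimes>\<^bsub>R\<^esub> t)),
      Module.module.smult = (\<lambda>r U. \<Union>(a, s)\<in>U. fraction R S (r \<otimes>\<^bsub>R\<^esub> a) s)\<rparr>"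

text \<open>The tensor product of \<open>M\<close> and \<open>N\<close> is the free abelian group on pairs modulo the
  subgroup generated by \<open>tensor_relations\<close>; \<open>pure_tensor R M N m n\<close> is the class of
  \<open>(m, n)\<close> in that quotient.\<close>

definition tensor_relations ::
  "('r, 'z) ring_scheme \<Rightarrow> ('r, 'm, 'y) module_scheme \<Rightarrow> ('r, 'n, 'w) module_scheme
     \<Rightarrow> (('m \<times> 'n) \<Rightarrow>\<^sub>0 int) set" where
  "tensor_relations R M N =
     {frag_of (m \<oplus>\<^bsub>M\<^esub> m', n) - frag_of (m, n) - frag_of (m', n) |m m' n.
        m \<in> carrier M \<and> m' \<in> carrier M \<and> n \<in> carrier N} \<union>
     {frag_of (m, n \<oplus>\<^bsub>N\<^esub> n') - frag_of (m, n) - frag_of (m, n') |m n n'.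
        m \<in> carrier M \<and> n \<in> carrier N \<and> n' \<in> carrier N} \<union>
     {frag_of (r \<odot>\<^bsub>M\<^esub> m, n) - frag_of (m, r \<odot>\<^bsub>N\<^esub> n) |r m n.
        r \<in> carrier R \<and> m \<in> carrier M \<and> n \<in> carrier N}"

definition pure_tensor ::
  "('r, 'z) ring_scheme \<Rightarrow> ('r, 'm, 'y) module_scheme \<Rightarrow> ('r, 'n, 'w) module_scheme
     \<Rightarrow> 'm \<Rightarrow> 'n \<Rightarrow> (('m \<times> 'n) \<Rightarrow>\<^sub>0 int) set" where
  "pure_tensor R M N m n =
     (let F = free_Abelian_group (carrier M \<times> carrier N)
      in generate F (tensor_relations R M N) #>\<^bsub>F\<^esub> frag_of (m, n))"

definition torsion_free ::
  "('r, 'z) ring_scheme \<Rightarrow> 'r set \<Rightarrow> ('r, 'm, 'y) module_scheme \<Rightarrow> bool" where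
  "torsion_free R S M \<longleftrightarrow>
     inj_on (\<lambda>m. pure_tensor R M (localization R S) m \<one>\<^bsub>localization R S\<^esub>) (carrier M)"


subsection \<open>Graded modules\<close>

text \<open>\<open>Rgr d\<close> and \<open>Mgr d\<close> are the homogeneous components of degree \<open>d\<close>.\<close>

definition graded_module ::
  "('r, 'z) ring_scheme \<Rightarrow> (int \<Rightarrow> 'r set) \<Rightarrow> ('r, 'm, 'y) module_scheme \<Rightarrow> (int \<Rightarrow> 'm set) \<Rightarrow> bool"
  where
  "graded_module R Rgr M Mgr \<longleftrightarrow>
     module R M \<and>
     (\<forall>d. subgroup (Mgr d) (add_monoid M)) \<and>
     (\<forall>d e. \<forall>a\<in>Rgr d. \<forall>m\<in>Mgr e. a \<odot>\<^bsub>M\<^esub> m \<in> Mgr (d + e)) \<and>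
     (\<forall>m\<in>carrier M. \<exists>!c. (\<forall>d. c d \<in> Mgr d) \<and> finite {d. c d \<noteq> \<zero>\<^bsub>M\<^esub>} \<and>
        m = (\<Oplus>\<^bsub>M\<^esub>d\<in>{d. c d \<noteq> \<zero>\<^bsub>M\<^esub>}. c d))"


subsection \<open>Adic completion\<close>

text \<open>An element of the inverse limit of quotients \<open>M / H n\<close> along a decreasing chain
  \<open>H\<close> is a sequence of cosets; the coset of \<open>H (Suc n)\<close> is mapped to the
  coset of \<open>H n\<close> exactly if it is contained in it.\<close>

definition coset_limit :: "('m, 'z) ring_scheme \<Rightarrow> (nat \<Rightarrow> 'm set) \<Rightarrow> (nat \<Rightarrow> 'm set) set" where
  "coset_limit M H = {\<phi>. \<forall>n. \<phi> n \<in> a_rcosets\<^bsub>M\<^esub> (H n) \<and> \<phi> (Suc n) \<subseteq> \<phi> n}"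

definition ideal_power :: "('r, 'z) ring_scheme \<Rightarrow> 'r set \<Rightarrow> nat \<Rightarrow> 'r set" where
  "ideal_power R I n = I [^]\<^bsub>ideals_set R\<^esub> n"

definition completion_ring :: "('r, 'z) ring_scheme \<Rightarrow> 'r set \<Rightarrow> (nat \<Rightarrow> 'r set) ring" where
  "completion_ring R I =
     \<lparr>carrier = coset_limit R (ideal_power R I),
      monoid.mult = (\<lambda>\<phi> \<psi> n. \<phi> n \<otimes>\<^bsub>R Quot ideal_power R I n\<^esub> \<psi> n),
      one = (\<lambda>n. \<one>\<^bsub>R Quot ideal_power R I n\<^esub>),
      ring.zero = (\<lambda>n. \<zero>\<^bsub>R Quot ideal_power R I n\<^esub>),
      add = (\<lambda>\<phi> \<psi> n. \<phi> n \<oplus>\<^bsub>R Quot ideal_power R I n\<^esub> \<psi> n)\<rparr>"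

definition to_completion :: "('r, 'z) ring_scheme \<Rightarrow> 'r set \<Rightarrow> 'r \<Rightarrow> nat \<Rightarrow> 'r set" where
  "to_completion R I r = (\<lambda>n. ideal_power R I n +>\<^bsub>R\<^esub> r)"

definition ideal_smult :: "'r set \<Rightarrow> ('r, 'm, 'y) module_scheme \<Rightarrow> 'm set" where
  "ideal_smult I M = generate (add_monoid M) {a \<odot>\<^bsub>M\<^esub> m |a m. a \<in> I \<and> m \<in> carrier M}"

text \<open>The completion of \<open>M\<close> as a module over \<open>completion_ring R I\<close>. The record fields
  \<open>mult\<close> and \<open>one\<close> carry no information for modules.\<close>

definition completion_module ::
  "('r, 'z) ring_scheme \<Rightarrow> 'r set \<Rightarrow> ('r, 'm, 'y) module_scheme
     \<Rightarrow> (nat \<Rightarrow> 'r set, nat \<Rightarrow> 'm set) module" where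
  "completion_module R I M =
     (let H = (\<lambda>n. ideal_smult (ideal_power R I n) M) in
      \<lparr>carrier = coset_limit M H,
       monoid.mult = undefined,
       one = undefined,
       ring.zero = H,
       add = (\<lambda>\<mu> \<nu> n. \<mu> n <+>\<^bsub>M\<^esub> \<nu> n),
       Module.module.smult = (\<lambda>\<phi> \<mu> n. \<Union>a\<in>\<phi> n. \<Union>m\<in>\<mu> n. H n +>\<^bsub>M\<^esub> (a \<odot>\<^bsub>M\<^esub> m))\<rparr>)"


section \<open>Derivations and connections\<close>

text \<open>The \<open>k\<close>-algebra structure of a ring \<open>B\<close> is given by its structure map
  \<open>\<iota> :: 'k \<Rightarrow> 'b\<close>. Derivations and endomorphisms are extensional functions, so that
  maps agreeing on the carrier are equal.\<close>

definition derivations :: "('k \<Rightarrow> 'b) \<Rightarrow> ('b, 'z) ring_scheme \<Rightarrow> ('b \<Rightarrow> 'b) set" where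
  "derivations \<iota> B =
     {P \<in> carrier B \<rightarrow>\<^sub>E carrier B.
        (\<forall>a\<in>carrier B. \<forall>b\<in>carrier B. P (a \<oplus>\<^bsub>B\<^esub> b) = P a \<oplus>\<^bsub>B\<^esub> P b) \<and>
        (\<forall>c. \<forall>a\<in>carrier B. P (\<iota> c \<otimes>\<^bsub>B\<^esub> a) = \<iota> c \<otimes>\<^bsub>B\<^esub> P a) \<and>
        (\<forall>a\<in>carrier B. \<forall>b\<in>carrier B.
           P (a \<otimes>\<^bsub>B\<^esub> b) = (a \<otimes>\<^bsub>B\<^esub> P b) \<oplus>\<^bsub>B\<^esub> (b \<otimes>\<^bsub>B\<^esub> P a))}"

definition derivation_add ::
  "('b, 'z) ring_scheme \<Rightarrow> ('b \<Rightarrow> 'b) \<Rightarrow> ('b \<Rightarrow> 'b) \<Rightarrow> 'b \<Rightarrow> 'b" where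
  "derivation_add B P Q = (\<lambda>a\<in>carrier B. P a \<oplus>\<^bsub>B\<^esub> Q a)"

definition derivation_smult :: "('b, 'z) ring_scheme \<Rightarrow> 'b \<Rightarrow> ('b \<Rightarrow> 'b) \<Rightarrow> 'b \<Rightarrow> 'b" where
  "derivation_smult B b P = (\<lambda>a\<in>carrier B. b \<otimes>\<^bsub>B\<^esub> P a)"

definition derivation_bracket ::
  "('b, 'z) ring_scheme \<Rightarrow> ('b \<Rightarrow> 'b) \<Rightarrow> ('b \<Rightarrow> 'b) \<Rightarrow> 'b \<Rightarrow> 'b" where
  "derivation_bracket B P Q = (\<lambda>a\<in>carrier B. P (Q a) \<ominus>\<^bsub>B\<^esub> Q (P a))"

definition linear_endomorphisms ::
  "('k \<Rightarrow> 'b) \<Rightarrow> ('b, 'n, 'y) module_scheme \<Rightarrow> ('n \<Rightarrow> 'n) set" where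
  "linear_endomorphisms \<iota> N =
     {\<phi> \<in> carrier N \<rightarrow>\<^sub>E carrier N.
        (\<forall>m\<in>carrier N. \<forall>n\<in>carrier N. \<phi> (m \<oplus>\<^bsub>N\<^esub> n) = \<phi> m \<oplus>\<^bsub>N\<^esub> \<phi> n) \<and>
        (\<forall>c. \<forall>n\<in>carrier N. \<phi> (\<iota> c \<odot>\<^bsub>N\<^esub> n) = \<iota> c \<odot>\<^bsub>N\<^esub> \<phi> n)}"

definition is_connection ::
  "('k \<Rightarrow> 'b) \<Rightarrow> ('b, 'z) ring_scheme \<Rightarrow> ('b, 'n, 'y) module_scheme
     \<Rightarrow> (('b \<Rightarrow> 'b) \<Rightarrow> 'n \<Rightarrow> 'n) \<Rightarrow> bool" where
  "is_connection \<iota> B N nabla \<longleftrightarrow>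
     nabla \<in> derivations \<iota> B \<rightarrow> linear_endomorphisms \<iota> N \<and>
     (\<forall>P\<in>derivations \<iota> B. \<forall>Q\<in>derivations \<iota> B. \<forall>n\<in>carrier N.
        nabla (derivation_add B P Q) n = nabla P n \<oplus>\<^bsub>N\<^esub> nabla Q n) \<and>
     (\<forall>b\<in>carrier B. \<forall>P\<in>derivations \<iota> B. \<forall>n\<in>carrier N.
        nabla (derivation_smult B b P) n = b \<odot>\<^bsub>N\<^esub> nabla P n) \<and>
     (\<forall>P\<in>derivations \<iota> B. \<forall>b\<in>carrier B. \<forall>n\<in>carrier N.
        nabla P (b \<odot>\<^bsub>N\<^esub> n) = (b \<odot>\<^bsub>N\<^esub> nabla P n) \<oplus>\<^bsub>N\<^esub> (P b \<odot>\<^bsub>N\<^esub> n))"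

definition is_integrable ::
  "('k \<Rightarrow> 'b) \<Rightarrow> ('b, 'z) ring_scheme \<Rightarrow> ('b, 'n, 'y) module_scheme
     \<Rightarrow> (('b \<Rightarrow> 'b) \<Rightarrow> 'n \<Rightarrow> 'n) \<Rightarrow> bool" where
  "is_integrable \<iota> B N nabla \<longleftrightarrow>
     (\<forall>P\<in>derivations \<iota> B. \<forall>Q\<in>derivations \<iota> B. \<forall>n\<in>carrier N.
        nabla (derivation_bracket B P Q) n = nabla P (nabla Q n) \<ominus>\<^bsub>N\<^esub> nabla Q (nabla P n))"


section \<open>Quasi-homogeneous plane curves\<close>

text \<open>\<open>k[x,y]\<close> is modelled by \<open>'k poly poly\<close>, i.e. by \<open>k[x][y]\<close>: the coefficient of
  \<open>x\<^sup>i y\<^sup>j\<close> in \<open>p\<close> is \<open>coeff (coeff p j) i\<close>.\<close>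

definition poly_homogeneous :: "nat \<Rightarrow> nat \<Rightarrow> int \<Rightarrow> 'k::field poly poly set" where
  "poly_homogeneous wx wy d =
     {p. \<forall>i j. poly.coeff (poly.coeff p j) i \<noteq> 0 \<longrightarrow> int (wx * i + wy * j) = d}"

abbreviation poly_ring_xy :: "'k::field poly poly ring" where
  "poly_ring_xy \<equiv> ring_of_type_algebra"

definition curve_ideal :: "'k::field poly poly \<Rightarrow> 'k poly poly set" where
  "curve_ideal f = PIdl\<^bsub>poly_ring_xy\<^esub> f"

definition curve_ring :: "'k::field poly poly \<Rightarrow> 'k poly poly set ring" where
  "curve_ring f = poly_ring_xy Quot curve_ideal f"

definition curve_proj :: "'k::field poly poly \<Rightarrow> 'k poly poly \<Rightarrow> 'k poly poly set" where
  "curve_proj f p = curve_ideal f +>\<^bsub>poly_ring_xy\<^esub> p"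

definition curve_grading ::
  "nat \<Rightarrow> nat \<Rightarrow> 'k::field poly poly \<Rightarrow> int \<Rightarrow> 'k poly poly set set" where
  "curve_grading wx wy f d = curve_proj f ` poly_homogeneous wx wy d"

definition homogeneous_nonzero_divisors ::
  "nat \<Rightarrow> nat \<Rightarrow> 'k::field poly poly \<Rightarrow> 'k poly poly set set" where
  "homogeneous_nonzero_divisors wx wy f =
     nonzero_divisors (curve_ring f) \<inter> (\<Union>d. curve_grading wx wy f d)"

definition curve_max_ideal :: "'k::field poly poly \<Rightarrow> 'k poly poly set set" where
  "curve_max_ideal f =
     Idl\<^bsub>curve_ring f\<^esub> {curve_proj f [:[:0, 1:]:], curve_proj f [:0, 1:]}"

definition completed_curve_ring ::
  "'k::field poly poly \<Rightarrow> (nat \<Rightarrow> 'k poly poly set set) ring" where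
  "completed_curve_ring f = completion_ring (curve_ring f) (curve_max_ideal f)"

definition completed_curve_scalar ::
  "'k::field poly poly \<Rightarrow> 'k \<Rightarrow> nat \<Rightarrow> 'k poly poly set set" where
  "completed_curve_scalar f c =
     to_completion (curve_ring f) (curve_max_ideal f) (curve_proj f [:[:c:]:])"

text \<open>HOL cannot quantify over types inside a formula, so the carrier type \<open>'m\<close> of the graded
  module is a parameter of the predicate.\<close>

definition gradable ::
  "'m itself \<Rightarrow> nat \<Rightarrow> nat \<Rightarrow> 'k::field poly poly
     \<Rightarrow> (nat \<Rightarrow> 'k poly poly set set, 'n, 'y) module_scheme \<Rightarrow> bool" where
  "gradable TYPE('m) wx wy f N \<longleftrightarrow>
     (\<exists>(M :: ('k poly poly set, 'm) module) Mgr.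
        graded_module (curve_ring f) (curve_grading wx wy f) M Mgr \<and>
        finitely_generated (curve_ring f) M \<and>
        torsion_free (curve_ring f) (homogeneous_nonzero_divisors wx wy f) M \<and>
        module_isomorphic (completed_curve_ring f) N
          (completion_module (curve_ring f) (curve_max_ideal f) M))"

end

theory Submission
  imports Defs "HOL-Library.Function_Algebras"
begin

text \<open>
  Up to a unit, an irreducible quasi-homogeneous \<open>f\<close> is a coordinate or a binomial
  \<open>y^p - \<beta>^p x^q\<close>, where \<open>p\<close> and \<open>q\<close> are the weights (\<open>quasi_homogeneous_parametrization\<close>).
  Hence a substitution \<open>x = \<alpha> t^p\<close>, \<open>y = \<beta> t^q\<close> identifies \<open>A\<close> with the span of the powers \<open>t^s\<close> with \<open>s\<close> in
  a semigroup \<open>S\<close>, and \<open>B\<close> with the power series supported on \<open>S\<close> (\<open>expansion_bij\<close>).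
  If \<open>S\<close> contains all natural numbers, \<open>B\<close> is \<open>k[[t]]\<close>, a torsion free \<open>N\<close> is free, and derivations
  act on coordinates (\<open>integrable_connection_over_power_series\<close>).

  In the singular case \<open>p, q \<ge> 2\<close> let \<open>F = p q - p - q\<close> be the Frobenius number of \<open>S\<close> and \<open>E = t d/dt\<close>
  the Euler derivation. Every derivation of \<open>B\<close> is \<open>g E\<close> with \<open>g\<close> supported on \<open>S \<union> {F}\<close>
  (\<open>derivation_eq_mult_euler\<close>). It suffices to find one operator on \<open>N\<close> that satisfies the Leibniz
  rule over \<open>E\<close> and whose values can be multiplied by \<open>t^F\<close> inside \<open>N\<close>: its multiples by the series
  \<open>g\<close> form a connection, which is flat because all of them are multiples of one operator
  (\<open>conv_cov_bracket\<close>).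

  Let \<open>N\<close> be the completion of a graded torsion free module \<open>M\<close>. By torsion freeness the homogeneous
  components of \<open>M\<close> are subspaces \<open>U n\<close> of one vector space in which multiplication by \<open>t^s\<close> is the
  inclusion of \<open>U n\<close> into \<open>U (n + s)\<close>. The degree operator \<open>v \<mapsto> n v\<close> satisfies the Leibniz rule
  over \<open>E\<close>, but \<open>t^F v\<close> belongs to \<open>M\<close> only if \<open>v\<close> lies in \<open>U (n + F)\<close>. The failure is due to free
  direct summands: if \<open>v\<close> is not in \<open>U (n + F)\<close>, take a functional with value \<open>1\<close> at \<open>v\<close> that
  vanishes on \<open>U (n + F)\<close>. Since \<open>S\<close> is symmetric (\<open>gap_symmetric\<close>), it vanishes on \<open>U l\<close> unless
  \<open>l - n\<close> is in \<open>S\<close>, so it defines an \<open>A\<close>-linear map from \<open>M\<close> to \<open>A\<close>, homogeneous of degree \<open>-n\<close>,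
  that splits off \<open>v\<close>.
  Subtracting \<open>n\<close> times a projection to a complement of \<open>U n \<inter> U (n + F)\<close> in \<open>U n\<close>, for all \<open>n\<close>,
  corrects the degree operator by an \<open>A\<close>-linear map and moves its values into the \<open>U (n + F)\<close>
  (\<open>proj_eq_0\<close>, \<open>degree_minus_defect_in\<close>).
\<close>


section \<open>Numerical semigroups with two generators\<close>

definition two_generated :: "nat \<Rightarrow> nat \<Rightarrow> nat set" where
  "two_generated p q = {p * i + q * j |i j. True}"

lemma two_generatedI: "p * i + q * j \<in> two_generated p q"
  by (auto simp: two_generated_def)

lemma two_generated_zero [simp]: "0 \<in> two_generated p q"
  using two_generatedI[of p 0 q 0] by simp

lemma two_generated_add:
  assumes "m \<in> two_generated p q" "n \<in> two_generated p q"
  shows "m + n \<in> two_generated p q"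
proof -
  obtain i j i' j' where "m = p * i + q * j" "n = p * i' + q * j'"
    using assms by (auto simp: two_generated_def)
  hence "m + n = p * (i + i') + q * (j + j')" by (simp add: algebra_simps)
  thus ?thesis by (metis two_generatedI)
qed

locale coprime_pair =
  fixes p q :: nat
  assumes coprime_pq: "coprime p q" and p_ge_2: "2 \<le> p" and q_ge_2: "2 \<le> q"
begin

abbreviation S :: "nat set" where "S \<equiv> two_generated p q"

definition F :: nat where "F = p * q - p - q"

lemma int_F: "int F = int p * int q - int p - int q"
proof -
  have "2 * q \<le> p * q" "p * 2 \<le> p * q"
    using p_ge_2 q_ge_2 by (auto intro: mult_le_mono)
  hence "p + q \<le> p * q" by linarith
  thus ?thesis unfolding F_def by (simp add: of_nat_diff)
qed

lemma normal_form:
  obtains a b :: int where "int n = a * int p + b * int q" "0 \<le> b" "b < int p"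
proof -
  obtain u v where uv: "u * int p + v * int q = 1"
    using bezout_int[of "int p" "int q"] coprime_pq by auto
  define b where "b = (int n * v) mod int p"
  define e where "e = (int n * v) div int p"
  define a where "a = int n * u + e * int q"
  have b: "b = int n * v - int p * e"
    unfolding b_def e_def by (simp add: minus_mult_div_eq_mod)
  have "a * int p + b * int q = int n * (u * int p + v * int q)"
    unfolding a_def b by (simp add: algebra_simps)
  hence "int n = a * int p + b * int q" using uv by simp
  moreover have "0 \<le> b" "b < int p" unfolding b_def using p_ge_2 by auto
  ultimately show thesis by (rule that)
qed

lemma in_S_if_nonneg:
  assumes "int n = a * int p + b * int q" "0 \<le> a" "0 \<le> b"
  shows "n \<in> S"
proof -
  have "int n = int (p * nat a + q * nat b)" using assms by (simp add: algebra_simps)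
  hence "n = p * nat a + q * nat b" by linarith
  thus ?thesis by (metis two_generatedI)
qed

text \<open>The symmetry of the semigroup, i.e. the Gorenstein property of the curve: in normal
  form \<open>n = a p + b q\<close> with \<open>0 \<le> b < p\<close>, a gap has \<open>a < 0\<close>, and then
  \<open>F - n = (-1 - a) p + (p - 1 - b) q\<close> has nonnegative coefficients.\<close>

lemma gap_symmetric:
  assumes "n \<notin> S"
  obtains m where "m \<in> S" "n + m = F"
proof -
  obtain a b where ab: "int n = a * int p + b * int q" "0 \<le> b" "b < int p"
    by (rule normal_form)
  have "a < 0" using in_S_if_nonneg[OF ab(1)] ab(2) assms by force
  have *: "int F - int n = (- 1 - a) * int p + (int p - 1 - b) * int q"
    unfolding int_F ab(1) by (simp add: algebra_simps)
  have "0 \<le> (- 1 - a) * int p + (int p - 1 - b) * int q"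
    using \<open>a < 0\<close> ab(3) by (intro add_nonneg_nonneg mult_nonneg_nonneg) auto
  hence m: "int (F - n) = (- 1 - a) * int p + (int p - 1 - b) * int q" "n \<le> F"
    using * by auto
  have "F - n \<in> S" by (rule in_S_if_nonneg[OF m(1)]) (use \<open>a < 0\<close> ab(3) in auto)
  thus thesis using m(2) by (intro that[of "F - n"]) auto
qed

lemma above_F_in_S: "F < n \<Longrightarrow> n \<in> S"
  by (metis gap_symmetric le_add1 not_le)

text \<open>Degrees of derivations: multiplication by \<open>t^n\<close> maps both generators of the maximal
  ideal into the ring only if \<open>n\<close> is in the semigroup or is its Frobenius number.\<close>

lemma shift_both_in_S:
  assumes "n + p \<in> S" "n + q \<in> S"
  shows "n \<in> S \<or> n = F"
proof (rule disjCI)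
  assume "n \<noteq> F"
  obtain a b where ab: "int n = a * int p + b * int q" "0 \<le> b" "b < int p"
    by (rule normal_form)
  have uniq: "0 \<le> a'" if "n' \<in> S" "int n' = a' * int p + b' * int q" "b' < int p" for n' a' b'
  proof -
    obtain i j where "n' = p * i + q * j" using \<open>n' \<in> S\<close> unfolding two_generated_def by blast
    hence eq: "(a' - int i) * int p = (int j - b') * int q"
      using that by (simp add: algebra_simps)
    hence "int p dvd (int j - b') * int q" by (metis dvd_triv_right)
    hence "int p dvd int j - b'"
      using coprime_pq by (simp add: coprime_dvd_mult_left_iff)
    then obtain k where k: "int j - b' = int p * k" by (auto simp: dvd_def)
    have "0 \<le> k"
    proof (rule ccontr)
      assume "\<not> 0 \<le> k"
      hence "int p * k \<le> int p * (- 1)" by (intro mult_left_mono) auto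
      thus False using k that(3) by simp
    qed
    have "(a' - int i) * int p = (k * int q) * int p" using eq k by simp
    hence "a' - int i = k * int q" using p_ge_2 by simp
    thus ?thesis using \<open>0 \<le> k\<close> by (metis add_nonneg_nonneg diff_add_cancel mult_nonneg_nonneg of_nat_0_le_iff)
  qed
  have "0 \<le> a + 1"
    by (rule uniq[OF assms(1), of _ b]) (use ab in \<open>auto simp: algebra_simps\<close>)
  moreover have "a \<noteq> - 1"
  proof
    assume a: "a = - 1"
    have "b < int p - 1"
    proof (rule ccontr)
      assume "\<not> b < int p - 1"
      hence "b = int p - 1" using ab(3) by simp
      hence "int n = (- 1) * int p + (int p - 1) * int q" using ab(1) a by simp
      hence "int n = int F" unfolding int_F by (simp add: algebra_simps)
      thus False using \<open>n \<noteq> F\<close> by simp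
    qed
    hence "0 \<le> a"
      by (intro uniq[OF assms(2), of a "b + 1"]) (use ab in \<open>auto simp: algebra_simps\<close>)
    thus False using a by simp
  qed
  ultimately show "n \<in> S" by (intro in_S_if_nonneg[OF ab(1)]) (use ab in auto)
qed

end


section \<open>Power series supported on a semigroup and their derivations\<close>

definition supported :: "nat set \<Rightarrow> 'k::field fps set" where
  "supported A = {g. \<forall>n. n \<notin> A \<longrightarrow> fps_nth g n = 0}"

definition euler :: "'k::field fps \<Rightarrow> 'k fps" where
  "euler g = fps_X * fps_deriv g"

lemma euler_nth [simp]: "fps_nth (euler g) n = of_nat n * fps_nth g n"
  by (cases n) (simp_all add: euler_def)

lemma euler_add [simp]: "euler (a + b) = euler a + euler b"
  by (simp add: euler_def algebra_simps)

lemma euler_mult [simp]: "euler (a * b) = a * euler b + b * euler a"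
  by (simp add: euler_def algebra_simps)

lemma supported_add: "a \<in> supported A \<Longrightarrow> b \<in> supported A \<Longrightarrow> a + b \<in> supported A"
  by (simp add: supported_def)

lemma supported_diff: "a \<in> supported A \<Longrightarrow> b \<in> supported A \<Longrightarrow> a - b \<in> supported A"
  by (simp add: supported_def)

lemma supported_mult:
  assumes "a \<in> supported A" "b \<in> supported C" "\<And>m n. m \<in> A \<Longrightarrow> n \<in> C \<Longrightarrow> m + n \<in> D"
  shows "a * b \<in> supported D"
proof -
  have "n \<in> D" if "fps_nth (a * b) n \<noteq> 0" for n
  proof -
    have "\<exists>i\<in>{0..n}. fps_nth a i * fps_nth b (n - i) \<noteq> 0"
      using that unfolding fps_mult_nth by (rule contrapos_np) (simp add: sum.neutral)
    then obtain i where "i \<le> n" "fps_nth a i * fps_nth b (n - i) \<noteq> 0" by auto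
    hence "i \<in> A" "n - i \<in> C" using assms(1,2) by (auto simp: supported_def)
    thus ?thesis using assms(3)[of i "n - i"] \<open>i \<le> n\<close> by simp
  qed
  thus ?thesis by (auto simp: supported_def)
qed

lemma supported_euler: "a \<in> supported A \<Longrightarrow> euler a \<in> supported A"
  by (auto simp: supported_def)

lemma supported_X_power: "n \<in> A \<Longrightarrow> fps_X ^ n \<in> supported A"
  by (auto simp: supported_def fps_X_power_nth)

lemma supported_const: "0 \<in> A \<Longrightarrow> fps_const c \<in> supported A"
  by (auto simp: supported_def split: if_splits)

context coprime_pair
begin

lemma supported_S_mult: "a \<in> supported S \<Longrightarrow> b \<in> supported S \<Longrightarrow> a * b \<in> supported S"
  by (rule supported_mult[where A=S and C=S]) (auto intro: two_generated_add)

lemma supported_S_power: "a \<in> supported S \<Longrightarrow> a ^ n \<in> supported S"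
  using supported_X_power[of 0 S] by (induction n) (auto intro: supported_S_mult)

lemma p_in_S: "p \<in> S" and q_in_S: "q \<in> S"
  using two_generatedI[of p 1 q 0] two_generatedI[of p 0 q 1] by auto

text \<open>A derivation is determined by the images of \<open>t^p\<close> and \<open>t^q\<close>. Both
  \<open>(t^p)^q = (t^q)^p\<close> and the coprimality of the weights force these images to be
  \<open>p t^p g\<close> and \<open>q t^q g\<close> for a common series \<open>g\<close>. The difference with \<open>g\<close> times the Euler derivation kills all polynomials, and it is
  continuous since a series of high order is divisible by a high power of \<open>t^p\<close> inside
  the ring.\<close>

lemma derivation_eq_mult_euler:
  fixes \<delta> :: "'k::field_char_0 fps \<Rightarrow> 'k fps"
  assumes closed: "\<And>a. a \<in> supported S \<Longrightarrow> \<delta> a \<in> supported S"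
    and add: "\<And>a b. a \<in> supported S \<Longrightarrow> b \<in> supported S \<Longrightarrow> \<delta> (a + b) = \<delta> a + \<delta> b"
    and scale: "\<And>c a. a \<in> supported S \<Longrightarrow> \<delta> (fps_const c * a) = fps_const c * \<delta> a"
    and leibniz: "\<And>a b. a \<in> supported S \<Longrightarrow> b \<in> supported S \<Longrightarrow>
                    \<delta> (a * b) = a * \<delta> b + b * \<delta> a"
  obtains g where "g \<in> supported (insert F S)" "\<And>a. a \<in> supported S \<Longrightarrow> \<delta> a = g * euler a"
proof -
  note X_S = supported_X_power[where A=S]
  have nat_mult_nth: "fps_nth (of_nat n * h) m = of_nat n * fps_nth h m" for n m and h :: "'k fps"
    by (simp flip: fps_of_nat)
  have one: "\<delta> 1 = 0"
    using leibniz[of 1 1] X_S[of 0] by simp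
  have power: "\<delta> (a ^ n) = of_nat n * a ^ (n - 1) * \<delta> a" if "a \<in> supported S" for a n
  proof (induction n)
    case (Suc n)
    have "\<delta> (a ^ Suc n) = a * \<delta> (a ^ n) + a ^ n * \<delta> a"
      using leibniz[OF that supported_S_power[OF that]] by simp
    also have "\<dots> = of_nat n * (a * a ^ (n - 1)) * \<delta> a + a ^ n * \<delta> a"
      using Suc by (simp add: algebra_simps)
    also have "of_nat n * (a * a ^ (n - 1)) = of_nat n * a ^ n"
      by (cases n) auto
    finally show ?case by (simp add: algebra_simps)
  qed (simp add: one)
  define A where "A = \<delta> (fps_X ^ p)"
  define C where "C = \<delta> (fps_X ^ q)"
  have AS: "A \<in> supported S" and CS: "C \<in> supported S"
    unfolding A_def C_def by (auto intro!: closed X_S p_in_S q_in_S)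
  have "of_nat q * fps_X ^ (p * (q - 1)) * A = \<delta> (fps_X ^ (p * q))"
    using power[OF X_S[OF p_in_S], of q] by (simp add: power_mult A_def)
  also have "\<dots> = of_nat p * fps_X ^ (q * (p - 1)) * C"
    using power[OF X_S[OF q_in_S], of p] by (simp add: power_mult C_def mult.commute[of p])
  finally have "fps_X ^ (p + q) * (of_nat q * fps_X ^ (p * (q - 1)) * A)
      = fps_X ^ (p + q) * (of_nat p * fps_X ^ (q * (p - 1)) * C)" by simp
  moreover have "fps_X ^ (p + q) * fps_X ^ (p * (q - 1)) = fps_X ^ (p * q) * (fps_X ^ q :: 'k fps)"
  proof -
    have "p + q + p * (q - 1) = p * q + q"
      using q_ge_2 by (cases q) (auto simp: algebra_simps)
    thus ?thesis by (simp flip: power_add)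
  qed
  moreover have "fps_X ^ (p + q) * fps_X ^ (q * (p - 1)) = fps_X ^ (p * q) * (fps_X ^ p :: 'k fps)"
  proof -
    have "p + q + q * (p - 1) = p * q + p"
      using p_ge_2 by (cases p) (auto simp: algebra_simps)
    thus ?thesis by (simp flip: power_add)
  qed
  ultimately have "fps_X ^ (p * q) * (of_nat q * (fps_X ^ q * A))
      = fps_X ^ (p * q) * (of_nat p * (fps_X ^ p * C))"
    by (metis (no_types, opaque_lifting) mult.left_commute mult.assoc)
  hence AC: "of_nat q * (fps_X ^ q * A) = of_nat p * (fps_X ^ p * C)" by simp

  \<comment> \<open>A term of \<open>A\<close> in degree \<open>j < p\<close> forces \<open>j\<close> and \<open>j + q - p\<close> into the semigroup, which
    the coprimality of \<open>p\<close> and \<open>q\<close> excludes.\<close>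
  have low: "fps_nth A j = 0" if "j < p" for j
  proof (rule ccontr)
    assume nz: "fps_nth A j \<noteq> 0"
    hence "j \<in> S" using AS by (auto simp: supported_def)
    have "of_nat q * fps_nth A j = of_nat p * fps_nth (fps_X ^ p * C) (j + q)"
      using arg_cong[OF AC, of "\<lambda>h. fps_nth h (j + q)"]
      by (simp add: nat_mult_nth fps_X_power_mult_nth)
    hence "fps_nth (fps_X ^ p * C) (j + q) \<noteq> 0" using nz q_ge_2 by auto
    hence ge: "p \<le> j + q" and "j + q - p \<in> S"
      using CS by (auto simp: fps_X_power_mult_nth supported_def split: if_splits)
    obtain i i' where j: "j = p * i + q * i'"
      using \<open>j \<in> S\<close> by (auto simp: two_generated_def)
    have "i = 0"
    proof (rule ccontr)
      assume "i \<noteq> 0"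
      hence "p * 1 \<le> p * i" by (intro mult_le_mono) auto
      thus False using j that by linarith
    qed
    obtain l l' where l: "j + q - p = p * l + q * l'"
      using \<open>j + q - p \<in> S\<close> by (auto simp: two_generated_def)
    have eq: "q * (i' + 1) = p * (l + 1) + q * l'"
      using l ge j \<open>i = 0\<close> by (simp add: algebra_simps)
    have "q * l' < q * (i' + 1)" using eq p_ge_2 by auto
    hence "l' < i' + 1" by (metis mult_less_cancel1)
    have "p * (l + 1) = q * (i' + 1 - l')"
      using eq \<open>l' < i' + 1\<close> by (simp add: diff_mult_distrib2)
    hence "p dvd q * (i' + 1 - l')" by (metis dvd_triv_left)
    hence "p dvd i' + 1 - l'"
      using coprime_pq by (simp add: coprime_dvd_mult_right_iff)
    hence "p \<le> i' + 1" using \<open>l' < i' + 1\<close> by (auto dest: dvd_imp_le)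
    moreover have "2 * i' \<le> q * i'" using q_ge_2 by simp
    hence "2 * i' < p" using j that by linarith
    ultimately show False using p_ge_2 by linarith
  qed
  define g where "g = fps_shift p (fps_const (inverse (of_nat p)) * A)"
  have pg: "of_nat p * (fps_X ^ p * g) = A"
    by (rule fps_ext)
      (use low p_ge_2 in \<open>auto simp: g_def nat_mult_nth fps_X_power_mult_nth\<close>)
  have "of_nat p * (fps_X ^ p * (of_nat q * (fps_X ^ q * g))) = of_nat q * (fps_X ^ q * A)"
    by (simp add: mult_ac flip: pg)
  also have "\<dots> = of_nat p * (fps_X ^ p * C)" by (rule AC)
  finally have qg: "of_nat q * (fps_X ^ q * g) = C"
    using p_ge_2 by (simp add: mult_cancel_left)
  have gS: "g \<in> supported (insert F S)"
  proof -
    have "n \<in> insert F S" if nz: "fps_nth g n \<noteq> 0" for n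
    proof -
      have "fps_nth A (n + p) \<noteq> 0"
        using nz p_ge_2 by (simp add: nat_mult_nth fps_X_power_mult_nth flip: pg)
      moreover have "fps_nth C (n + q) \<noteq> 0"
        using nz q_ge_2 by (simp add: nat_mult_nth fps_X_power_mult_nth flip: qg)
      ultimately show ?thesis
        using shift_both_in_S[of n] AS CS by (auto simp: supported_def)
    qed
    thus ?thesis by (auto simp: supported_def)
  qed

  define D where "D = (\<lambda>a. \<delta> a - g * euler a)"
  have D_add: "D (a + b) = D a + D b" if "a \<in> supported S" "b \<in> supported S" for a b
    using add[OF that] by (simp add: D_def algebra_simps)
  have D_scale: "D (fps_const c * a) = fps_const c * D a" if "a \<in> supported S" for c a
    using scale[OF that] by (simp add: D_def euler_def algebra_simps)
  have D_leibniz: "D (a * b) = a * D b + b * D a" if "a \<in> supported S" "b \<in> supported S" for a b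
    using leibniz[OF that] by (simp add: D_def algebra_simps)
  have euler_X: "euler (fps_X ^ n) = of_nat n * (fps_X ^ n :: 'k fps)" for n
    by (rule fps_ext) (simp add: nat_mult_nth fps_X_power_nth)
  have D1: "D 1 = 0" using one by (simp add: D_def euler_def)
  have D_power: "D (a ^ n) = 0" if "a \<in> supported S" "D a = 0" for a n
  proof (induction n)
    case (Suc n)
    thus ?case using D_leibniz[OF that(1) supported_S_power[OF that(1)]] that(2) by simp
  qed (simp add: D1)
  have D_p: "D (fps_X ^ p) = 0" and D_q: "D (fps_X ^ q) = 0"
    using pg qg by (simp_all add: D_def A_def C_def euler_X mult_ac)
  have D_X: "D (fps_X ^ s) = 0" if s: "s \<in> S" for s
  proof -
    obtain i j where "s = p * i + q * j" using s by (auto simp: two_generated_def)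
    moreover have "D ((fps_X ^ p) ^ i * (fps_X ^ q) ^ j) = 0"
    proof -
      have "(fps_X ^ p) ^ i \<in> supported S" "(fps_X ^ q) ^ j \<in> supported S"
        using two_generatedI[of p i q 0] two_generatedI[of p 0 q j]
        by (auto simp flip: power_mult intro: X_S)
      hence "D ((fps_X ^ p) ^ i * (fps_X ^ q) ^ j)
          = (fps_X ^ p) ^ i * D ((fps_X ^ q) ^ j) + (fps_X ^ q) ^ j * D ((fps_X ^ p) ^ i)"
        by (rule D_leibniz)
      thus ?thesis
        unfolding D_power[OF X_S[OF p_in_S] D_p] D_power[OF X_S[OF q_in_S] D_q] by simp
    qed
    ultimately show ?thesis by (simp add: power_mult power_add)
  qed
  have "D a = 0" if a: "a \<in> supported S" for a
  proof (rule fps_ext)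
    fix n
    define N where "N = p * Suc n + Suc F"
    have poly: "D (\<Sum>i\<in>I. fps_const (fps_nth a i) * fps_X ^ i) = 0 \<and>
        (\<Sum>i\<in>I. fps_const (fps_nth a i) * fps_X ^ i) \<in> supported S" if "finite I" for I
      using that
    proof induction
      case empty
      have "D 0 = 0" using D_scale[of 1 0] X_S[of 0] D1 by simp
      thus ?case by (simp add: supported_def)
    next
      case (insert i I)
      show ?case
      proof (cases "fps_nth a i = 0")
        case True
        thus ?thesis using insert by simp
      next
        case False
        hence "i \<in> S" using a by (auto simp: supported_def)
        have "fps_const (fps_nth a i) * fps_X ^ i \<in> supported S"
          using \<open>i \<in> S\<close> by (auto intro!: supported_S_mult X_S supported_const)
        moreover have "D (fps_const (fps_nth a i) * fps_X ^ i) = 0"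
          using D_scale[OF X_S[OF \<open>i \<in> S\<close>]] D_X[OF \<open>i \<in> S\<close>] by simp
        ultimately show ?thesis
          using insert D_add by (auto intro: supported_add)
      qed
    qed
    define P where "P = (\<Sum>i<N. fps_const (fps_nth a i) * fps_X ^ i)"
    have P_nth: "fps_nth P i = (if i < N then fps_nth a i else 0)" for i
    proof -
      have "fps_nth P i = (\<Sum>j<N. if i = j then fps_nth a j else 0)"
        unfolding P_def fps_sum_nth by (intro sum.cong) (auto simp: fps_X_power_nth)
      thus ?thesis by simp
    qed
    have DP: "D P = 0" and PS: "P \<in> supported S" using poly[of "{..<N}"] by (auto simp: P_def)
    define u where "u = fps_shift (p * Suc n) (a - P)"
    have u: "(fps_X ^ p) ^ Suc n * u = a - P"
      unfolding power_mult[symmetric]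
      by (rule fps_ext) (auto simp: u_def fps_X_power_mult_nth P_nth N_def)
    have "u \<in> supported S"
      by (auto simp: supported_def u_def P_nth N_def split: if_splits intro!: above_F_in_S)
    moreover have "(fps_X ^ p) ^ Suc n \<in> supported S"
      using X_S[of "p * Suc n"] two_generatedI[of p "Suc n" q 0]
      unfolding power_mult[symmetric] by simp
    ultimately have "D ((fps_X ^ p) ^ Suc n * u)
        = (fps_X ^ p) ^ Suc n * D u + u * D ((fps_X ^ p) ^ Suc n)"
      by (intro D_leibniz)
    hence "D (a - P) = (fps_X ^ p) ^ Suc n * D u"
      unfolding u D_power[OF X_S[OF p_in_S] D_p] by simp
    moreover have "a - P \<in> supported S" using a PS by (rule supported_diff)
    hence "D a = D (a - P)" using D_add[OF _ PS, of "a - P"] DP by simp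
    moreover have "1 * Suc n \<le> p * Suc n" using p_ge_2 by (intro mult_le_mono) auto
    hence "n < p * Suc n" by simp
    ultimately show "fps_nth (D a) n = fps_nth 0 n"
      unfolding power_mult[symmetric] by (simp only: fps_X_power_mult_nth fps_zero_nth if_True)
  qed
  hence "\<delta> a = g * euler a" if "a \<in> supported S" for a
    using that by (simp add: D_def)
  with gS show thesis by (rule that)
qed

end


section \<open>The connection on a space filtered by a semigroup\<close>

text \<open>Vectors are reduced modulo \<open>W\<close> within \<open>Y\<close>: a complement of \<open>W\<close> in \<open>W + Y\<close> is
  chosen inside \<open>Y\<close>.\<close>

lemma (in vector_space) projection_along:
  assumes W: "subspace W" and Y: "subspace Y"
  obtains pr where "Vector_Spaces.linear scale scale pr" "\<And>v. v \<in> W \<Longrightarrow> pr v = 0"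
    "\<And>v. pr v \<in> Y" "\<And>v. v \<in> Y \<Longrightarrow> v - pr v \<in> W"
proof -
  interpret pair: vector_space_pair scale scale ..
  obtain B where B: "B \<subseteq> W" "independent B" "W \<subseteq> span B"
    by (rule maximal_independent_subset)
  have spanB: "span B = W"
    using B W by (intro antisym span_minimal)
  obtain C where C: "B \<subseteq> C" "C \<subseteq> B \<union> Y" "independent C" "B \<union> Y \<subseteq> span C"
    by (rule maximal_independent_subset_extend[of B "B \<union> Y"]) (use B(2) in auto)
  define g where "g = (\<lambda>b. if b \<in> B then 0 else b)"
  define pr where "pr = pair.construct C g"
  have lin: "Vector_Spaces.linear scale scale pr"
    unfolding pr_def by (rule pair.linear_construct[OF C(3)])
  interpret L: Vector_Spaces.linear scale scale pr by (rule lin)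
  have basis: "pr b = g b" if "b \<in> C" for b
    unfolding pr_def using C(3) that by (rule pair.construct_basis)
  have kill: "pr v = 0" if "v \<in> W" for v
  proof (rule L.eq_0_on_span)
    show "v \<in> span B" using that spanB by simp
    show "pr b = 0" if "b \<in> B" for b using basis[of b] C(1) that by (auto simp: g_def)
  qed
  have "g ` C \<subseteq> Y"
    using C(2) subspace_0[OF Y] by (auto simp: g_def)
  hence "span (g ` C) \<subseteq> Y" using Y by (rule span_minimal)
  hence range: "pr v \<in> Y" for v
    unfolding pr_def using pair.construct_in_span[OF C(3), of g v] by auto
  have "v - pr v \<in> W" if "v \<in> Y" for v
  proof -
    have "v \<in> span C" using that C(4) by auto
    thus ?thesis
    proof (induction rule: span_induct_alt)
      case base
      show ?case using subspace_0[OF W] by (simp add: L.zero)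
    next
      case (step c b y)
      have "b - pr b \<in> W"
        using basis[OF step(1)] B(1) subspace_0[OF W] by (auto simp: g_def)
      hence "scale c (b - pr b) + (y - pr y) \<in> W"
        using step W by (intro subspace_add subspace_scale)
      thus ?case by (simp add: L.add L.scale algebra_simps)
    qed
  qed
  with lin kill range show thesis by (intro that)
qed

text \<open>The subspaces \<open>U n\<close> stand for the homogeneous components of a graded torsion free module
  after \<open>t\<close> has been inverted and set to \<open>1\<close>.\<close>

locale semigroup_filtration = coprime_pair p q + vector_space scale
  for p q :: nat and scale :: "'k::field_char_0 \<Rightarrow> 'v::ab_group_add \<Rightarrow> 'v" (infixr "*s" 75) +
  fixes U :: "nat \<Rightarrow> 'v set"
  assumes subspace_U: "subspace (U n)"
    and U_shift: "s \<in> S \<Longrightarrow> U n \<subseteq> U (n + s)"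
begin

lemma U_shiftD: "v \<in> U n \<Longrightarrow> s \<in> S \<Longrightarrow> v \<in> U (n + s)"
  using U_shift by blast

text \<open>The ambient space allows \<open>U n\<close> to be compared with \<open>U (n + F)\<close>: among the vectors of
  \<open>U n\<close>, the projection kills exactly those that multiplication by \<open>t^F\<close> keeps inside the filtration.\<close>

definition proj :: "nat \<Rightarrow> 'v \<Rightarrow> 'v" where
  "proj n = (SOME pr. Vector_Spaces.linear scale scale pr \<and> (\<forall>v\<in>U (n + F). pr v = 0) \<and>
      (\<forall>v. pr v \<in> U n) \<and> (\<forall>v\<in>U n. v - pr v \<in> U (n + F)))"

lemma proj:
  shows linear_proj: "Vector_Spaces.linear scale scale (proj n)"
    and proj_kill: "v \<in> U (n + F) \<Longrightarrow> proj n v = 0"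
    and proj_in: "proj n v \<in> U n"
    and proj_id: "v \<in> U n \<Longrightarrow> v - proj n v \<in> U (n + F)"
proof -
  have "\<exists>l. Vector_Spaces.linear scale scale l \<and> (\<forall>v\<in>U (n + F). l v = 0) \<and>
      (\<forall>v. l v \<in> U n) \<and> (\<forall>v\<in>U n. v - l v \<in> U (n + F))"
    by (rule projection_along[OF subspace_U subspace_U]) blast
  hence "Vector_Spaces.linear scale scale (proj n) \<and> (\<forall>v\<in>U (n + F). proj n v = 0) \<and>
      (\<forall>v. proj n v \<in> U n) \<and> (\<forall>v\<in>U n. v - proj n v \<in> U (n + F))"
    unfolding proj_def by (rule someI_ex)
  thus "Vector_Spaces.linear scale scale (proj n)" "v \<in> U (n + F) \<Longrightarrow> proj n v = 0"
    "proj n v \<in> U n" "v \<in> U n \<Longrightarrow> v - proj n v \<in> U (n + F)" by auto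
qed

text \<open>Here the symmetry of the semigroup enters: if \<open>l - n\<close> is not in the semigroup then
  \<open>n + F - l\<close> is, so \<open>U l\<close> lies in the space \<open>U (n + F)\<close> that \<open>proj n\<close> kills.\<close>

lemma proj_eq_0:
  assumes "v \<in> U l" "\<not> (\<exists>s\<in>S. l = n + s)"
  shows "proj n v = 0"
proof -
  have "\<exists>s\<in>S. n + F = l + s"
  proof (cases "n \<le> l")
    case True
    hence "l - n \<notin> S" using assms(2) le_add_diff_inverse by metis
    then obtain m where "m \<in> S" "l - n + m = F" by (rule gap_symmetric)
    thus ?thesis using True by (intro bexI[of _ m]) auto
  next
    case False
    thus ?thesis by (intro bexI[of _ "n + F - l"]) (auto intro: above_F_in_S)
  qed
  hence "v \<in> U (n + F)" using assms(1) U_shiftD by auto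
  thus ?thesis by (rule proj_kill)
qed

text \<open>The image of \<open>proj n\<close> generates a free direct summand in degree \<open>n\<close>, on which the degree
  operator has to be corrected by \<open>n\<close>. The sum \<open>defect\<close> of all corrections is linear over
  the semigroup ring because its value does not depend on the piece \<open>U l\<close> in which a vector
  is considered.\<close>

definition defect :: "'v \<Rightarrow> 'v" where
  "defect v = (\<Sum>n | proj n v \<noteq> 0. of_nat n *s proj n v)"

lemma defect_eq:
  assumes "v \<in> U l"
  shows "defect v = (\<Sum>n\<le>l. of_nat n *s proj n v)"
  unfolding defect_def
proof (rule sum.mono_neutral_left)
  show "{n. proj n v \<noteq> 0} \<subseteq> {..l}" 
  proof
    fix n assume "n \<in> {n. proj n v \<noteq> 0}"
    hence "\<exists>s\<in>S. l = n + s" using proj_eq_0[OF assms, of n] by blast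
    thus "n \<in> {..l}" by auto
  qed
qed auto

lemma defect_in:
  assumes "v \<in> U l"
  shows "defect v \<in> U l"
  unfolding defect_eq[OF assms]
proof (rule subspace_sum[OF subspace_U])
  fix n
  have "proj n v \<in> U l"
  proof (cases "\<exists>s\<in>S. l = n + s")
    case True
    thus ?thesis using U_shiftD proj_in by auto
  next
    case False
    thus ?thesis using proj_eq_0[OF assms] subspace_0[OF subspace_U] by simp
  qed
  thus "of_nat n *s proj n v \<in> U l" by (rule subspace_scale[OF subspace_U])
qed

lemma defect_add:
  assumes "v \<in> U l" "w \<in> U l"
  shows "defect (v + w) = defect v + defect w"
proof -
  have "proj n (v + w) = proj n v + proj n w" for n
  proof -
    interpret Vector_Spaces.linear scale scale "proj n" by (rule linear_proj)
    show ?thesis by (rule add)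
  qed
  thus ?thesis
    using assms defect_eq[of _ l] subspace_add[OF subspace_U assms]
    by (simp add: scale_right_distrib sum.distrib)
qed

lemma defect_scale:
  assumes "v \<in> U l"
  shows "defect (c *s v) = c *s defect v"
proof -
  have "proj n (c *s v) = c *s proj n v" for n
  proof -
    interpret Vector_Spaces.linear scale scale "proj n" by (rule linear_proj)
    show ?thesis by (rule scale)
  qed
  thus ?thesis
    using assms defect_eq[of _ l] subspace_scale[OF subspace_U assms]
    by (simp add: scale_sum_right mult.commute)
qed

lemma defect_sum:
  assumes "\<And>i. i \<in> I \<Longrightarrow> v i \<in> U l"
  shows "defect (\<Sum>i\<in>I. v i) = (\<Sum>i\<in>I. defect (v i))"
  using assms
proof (induction I rule: infinite_finite_induct)
  case (insert i I)
  thus ?case using defect_add[of "v i" l "sum v I"] by (simp add: subspace_sum[OF subspace_U])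
qed (use defect_scale[OF subspace_0[OF subspace_U], where c=0] in auto)

text \<open>In degree \<open>n\<close> the summand \<open>n proj n v\<close> of \<open>defect v\<close> cancels \<open>n v\<close> modulo \<open>U (n + F)\<close>, and
  the summands of index \<open>i < n\<close> lie in \<open>U i\<close>, hence in \<open>U (n + F)\<close> because \<open>n - i + F\<close> exceeds
  the Frobenius number.\<close>

lemma degree_minus_defect_in:
  assumes "v \<in> U n"
  shows "of_nat n *s v - defect v \<in> U (n + F)"
proof -
  have "{..n} = insert n {..<n}" by auto
  hence "defect v = of_nat n *s proj n v + (\<Sum>i<n. of_nat i *s proj i v)"
    unfolding defect_eq[OF assms] by simp
  hence "of_nat n *s v - defect v =
      of_nat n *s (v - proj n v) - (\<Sum>i<n. of_nat i *s proj i v)"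
    by (simp add: scale_right_diff_distrib)
  moreover have "(\<Sum>i<n. of_nat i *s proj i v) \<in> U (n + F)"
  proof (rule subspace_sum[OF subspace_U])
    fix i assume "i \<in> {..<n}"
    hence "n + F - i \<in> S" "n + F = i + (n + F - i)" by (auto intro: above_F_in_S)
    hence "proj i v \<in> U (n + F)" using U_shiftD[OF proj_in[of i], of "n + F - i"] by simp
    thus "of_nat i *s proj i v \<in> U (n + F)" by (rule subspace_scale[OF subspace_U])
  qed
  ultimately show ?thesis
    using subspace_diff[OF subspace_U] subspace_scale[OF subspace_U] proj_id[OF assms] by simp
qed

subsection \<open>Formal families\<close>

text \<open>Families of homogeneous components model a completed module, with convolution as scalar
  multiplication; \<open>cov\<close> is the covariant derivative along the Euler derivation.\<close>

definition families :: "(nat \<Rightarrow> 'v) set" where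
  "families = {h. \<forall>n. h n \<in> U n}"

definition conv :: "'k fps \<Rightarrow> (nat \<Rightarrow> 'v) \<Rightarrow> nat \<Rightarrow> 'v" where
  "conv g h n = (\<Sum>i=0..n. fps_nth g i *s h (n - i))"

definition cov :: "(nat \<Rightarrow> 'v) \<Rightarrow> nat \<Rightarrow> 'v" where
  "cov h n = of_nat n *s h n - defect (h n)"

lemma conv_add_left: "conv (a + b) h = (\<lambda>n. conv a h n + conv b h n)"
  by (rule ext) (simp add: conv_def scale_left_distrib sum.distrib)

lemma conv_diff_left: "conv (a - b) h = (\<lambda>n. conv a h n - conv b h n)"
  by (rule ext) (simp add: conv_def scale_left_diff_distrib sum_subtractf)

lemma conv_add_right: "conv a (\<lambda>n. h n + h' n) = (\<lambda>n. conv a h n + conv a h' n)"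
  by (rule ext) (simp add: conv_def scale_right_distrib sum.distrib)

lemma conv_assoc: "conv (a * b) h = conv a (conv b h)"
proof
  fix n
  have "conv (a * b) h n =
      (\<Sum>j=0..n. \<Sum>i=0..j. (fps_nth a i * fps_nth b (j - i)) *s h (n - j))"
    by (simp add: conv_def fps_mult_nth scale_sum_left)
  also have "\<dots> = (\<Sum>j=0..n. \<Sum>i=0..n - j. (fps_nth a j * fps_nth b i) *s h (n - j - i))"
    by (rule fps_mult_assoc_lemma)
  also have "\<dots> = conv a (conv b h) n"
    by (simp add: conv_def scale_sum_right)
  finally show "conv (a * b) h n = conv a (conv b h) n" .
qed

lemma conv_commute: "conv a (conv b h) = conv b (conv a h)"
  by (simp add: mult.commute flip: conv_assoc)

lemma cov_in_families: "h \<in> families \<Longrightarrow> cov h \<in> families"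
  by (auto simp: families_def cov_def intro!: subspace_diff subspace_scale subspace_U defect_in)

lemma cov_shift_F: "h \<in> families \<Longrightarrow> cov h n \<in> U (n + F)"
  by (auto simp: families_def cov_def intro!: degree_minus_defect_in)

lemma cov_add:
  assumes "h \<in> families" "h' \<in> families"
  shows "cov (\<lambda>n. h n + h' n) = (\<lambda>n. cov h n + cov h' n)"
proof
  fix n
  have "defect (h n + h' n) = defect (h n) + defect (h' n)"
    using assms by (intro defect_add[of _ n]) (auto simp: families_def)
  thus "cov (\<lambda>n. h n + h' n) n = cov h n + cov h' n"
    by (simp add: cov_def scale_right_distrib)
qed

text \<open>The Leibniz rule holds for every convolution whose individual terms stay in the
  filtration; the coefficient \<open>t^F\<close>, which is not in the ring, is admissible in this sense.\<close>

lemma cov_conv: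
  assumes "\<And>i m. fps_nth a i \<noteq> 0 \<Longrightarrow> h m \<in> U (m + i)"
  shows "cov (conv a h) = (\<lambda>n. conv a (cov h) n + conv (euler a) h n)"
proof
  fix n
  have mem: "fps_nth a i *s h (n - i) \<in> U n" if "i \<le> n" for i
    using assms[of i "n - i"] that subspace_0[OF subspace_U]
    by (cases "fps_nth a i = 0") (auto intro: subspace_scale[OF subspace_U])
  have "defect (conv a h n) = (\<Sum>i=0..n. fps_nth a i *s defect (h (n - i)))"
  proof -
    have "defect (conv a h n) = (\<Sum>i=0..n. defect (fps_nth a i *s h (n - i)))"
      unfolding conv_def by (rule defect_sum) (use mem in auto)
    also have "\<dots> = (\<Sum>i=0..n. fps_nth a i *s defect (h (n - i)))"
    proof (rule sum.cong)
      fix i assume "i \<in> {0..n}"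
      show "defect (fps_nth a i *s h (n - i)) = fps_nth a i *s defect (h (n - i))"
      proof (cases "fps_nth a i = 0")
        case True
        thus ?thesis using defect_scale[OF subspace_0[OF subspace_U], where c=0] by simp
      qed (use assms in \<open>auto intro: defect_scale\<close>)
    qed simp
    finally show ?thesis .
  qed
  moreover have "of_nat n *s conv a h n = (\<Sum>i=0..n. (of_nat (n - i) * fps_nth a i) *s h (n - i)) +
      (\<Sum>i=0..n. (of_nat i * fps_nth a i) *s h (n - i))"
    unfolding conv_def scale_sum_right sum.distrib[symmetric]
    by (intro sum.cong refl) (simp add: of_nat_diff flip: scale_left_distrib, simp add: algebra_simps)
  ultimately show "cov (conv a h) n = conv a (cov h) n + conv (euler a) h n"
    by (simp add: cov_def conv_def scale_right_diff_distrib sum_subtractf mult.commute)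
qed

lemma conv_cov_in_families:
  assumes "g \<in> supported (insert F S)" "h \<in> families"
  shows "conv g (cov h) \<in> families"
    and "fps_nth g i \<noteq> 0 \<Longrightarrow> cov h m \<in> U (m + i)"
proof -
  have mem: "cov h m \<in> U (m + i)" if "fps_nth g i \<noteq> 0" for i m
  proof (cases "i = F")
    case True
    thus ?thesis using cov_shift_F[OF assms(2)] by simp
  next
    case False
    hence "i \<in> S" using that assms(1) by (auto simp: supported_def)
    thus ?thesis using U_shiftD[of _ m i] cov_in_families[OF assms(2)] by (auto simp: families_def)
  qed
  show "fps_nth g i \<noteq> 0 \<Longrightarrow> cov h m \<in> U (m + i)" by (rule mem)
  have "fps_nth g i *s cov h (n - i) \<in> U n" if "i \<le> n" for i n
    using mem[of i "n - i"] that subspace_0[OF subspace_U]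
    by (cases "fps_nth g i = 0") (auto intro: subspace_scale[OF subspace_U])
  thus "conv g (cov h) \<in> families"
    unfolding families_def conv_def by (auto intro!: subspace_sum[OF subspace_U])
qed

text \<open>All these covariant derivatives are multiples of the one operator \<open>cov\<close>, so the
  curvature vanishes.\<close>

lemma conv_cov_bracket:
  assumes "a \<in> supported (insert F S)" "b \<in> supported (insert F S)" "h \<in> families"
  shows "conv (a * euler b - b * euler a) (cov h) =
    (\<lambda>n. conv a (cov (conv b (cov h))) n - conv b (cov (conv a (cov h))) n)"
proof -
  have "conv a (cov (conv b (cov h))) =
      (\<lambda>n. conv a (conv b (cov (cov h))) n + conv (a * euler b) (cov h) n)"
    if "b \<in> supported (insert F S)" for a b
    using that assms(3)
    by (subst cov_conv) (auto intro: conv_cov_in_families(2) simp: conv_add_right conv_assoc)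
  from this[of b a] this[of a b] show ?thesis
    using assms(1,2) by (simp add: conv_diff_left conv_commute[of a b])
qed

end


section \<open>Transport of the connection to an abstract module\<close>

context semigroup_filtration
begin

text \<open>Every derivation of \<open>B\<close> is \<open>g\<close> times the Euler derivation for a unique \<open>g\<close> supported on the
  semigroup and its Frobenius number, and \<open>g\<close> times \<open>cov\<close> is its covariant derivative. As \<open>g\<close> is
  unique, sums, multiples and brackets of derivations are recognized by their series.\<close>

lemma integrable_connection_transport:
  fixes B :: "('b, 'z) ring_scheme" (structure) and N :: "('b, 'n, 'y) module_scheme"
    and \<iota> :: "'k \<Rightarrow> 'b" and ex :: "'b \<Rightarrow> 'k fps" and h :: "'n \<Rightarrow> nat \<Rightarrow> 'v"
  assumes modl: "module B N"
    and ex_bij: "bij_betw ex (carrier B) (supported S)"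
    and ex_add: "\<And>a b. a \<in> carrier B \<Longrightarrow> b \<in> carrier B \<Longrightarrow> ex (a \<oplus> b) = ex a + ex b"
    and ex_mult: "\<And>a b. a \<in> carrier B \<Longrightarrow> b \<in> carrier B \<Longrightarrow> ex (a \<otimes> b) = ex a * ex b"
    and \<iota>_in: "\<And>c. \<iota> c \<in> carrier B" and ex_\<iota>: "\<And>c. ex (\<iota> c) = fps_const c"
    and h_bij: "bij_betw h (carrier N) families"
    and h_add: "\<And>m n. m \<in> carrier N \<Longrightarrow> n \<in> carrier N \<Longrightarrow> h (m \<oplus>\<^bsub>N\<^esub> n) = (\<lambda>i. h m i + h n i)"
    and h_smult: "\<And>b n. b \<in> carrier B \<Longrightarrow> n \<in> carrier N \<Longrightarrow> h (b \<odot>\<^bsub>N\<^esub> n) = conv (ex b) (h n)"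
  shows "\<exists>nabla. is_connection \<iota> B N nabla \<and> is_integrable \<iota> B N nabla"
proof -
  interpret N: module B N by (rule modl)
  note ex_inj = inj_onD[OF bij_betw_imp_inj_on[OF ex_bij]]
  note h_inj = inj_onD[OF bij_betw_imp_inj_on[OF h_bij]]
  have ex_in: "ex a \<in> supported S" if "a \<in> carrier B" for a
    using ex_bij that by (auto simp: bij_betw_def)
  have h_in: "h n \<in> families" if "n \<in> carrier N" for n
    using h_bij that by (auto simp: bij_betw_def)
  define exi where "exi = inv_into (carrier B) ex"
  define hi where "hi = inv_into (carrier N) h"
  have exi: "exi a \<in> carrier B" "ex (exi a) = a" if "a \<in> supported S" for a
    using ex_bij that by (auto simp: exi_def bij_betw_def intro: inv_into_into f_inv_into_f)
  have hi: "hi w \<in> carrier N" "h (hi w) = w" if "w \<in> families" for w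
    using h_bij that by (auto simp: hi_def bij_betw_def intro: inv_into_into f_inv_into_f)
  have ex_diff: "ex (a \<ominus> b) = ex a - ex b" if "a \<in> carrier B" "b \<in> carrier B" for a b
  proof -
    have "ex ((a \<ominus> b) \<oplus> b) = ex (a \<ominus> b) + ex b" using that by (intro ex_add) auto
    moreover have "(a \<ominus> b) \<oplus> b = a"
      using that by (simp add: N.R.minus_eq N.R.a_assoc N.R.l_neg)
    ultimately show ?thesis by (simp add: algebra_simps)
  qed
  have h_diff: "h (m \<ominus>\<^bsub>N\<^esub> n) = (\<lambda>i. h m i - h n i)" if "m \<in> carrier N" "n \<in> carrier N" for m n
  proof -
    have "h ((m \<ominus>\<^bsub>N\<^esub> n) \<oplus>\<^bsub>N\<^esub> n) = (\<lambda>i. h (m \<ominus>\<^bsub>N\<^esub> n) i + h n i)"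
      using that by (intro h_add) auto
    moreover have "(m \<ominus>\<^bsub>N\<^esub> n) \<oplus>\<^bsub>N\<^esub> n = m"
      using that by (simp add: N.M.minus_eq N.M.a_assoc N.M.l_neg)
    ultimately show ?thesis by (simp add: fun_eq_iff algebra_simps)
  qed

  define generates where "generates = (\<lambda>P g. g \<in> supported (insert F S) \<and>
      (\<forall>b\<in>carrier B. ex (P b) = g * euler (ex b)))"
  have generates_unique: "g = g'" if "generates P g" "generates P g'" for P g g'
  proof -
    let ?b = "exi (fps_X ^ p)"
    have b: "?b \<in> carrier B" "ex ?b = fps_X ^ p"
      using exi supported_X_power[OF p_in_S] by auto
    hence "g * euler (fps_X ^ p) = g' * euler (fps_X ^ p)"
      using that unfolding generates_def by metis
    moreover have "fps_nth (euler (fps_X ^ p :: 'k fps)) p \<noteq> 0"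
      using p_ge_2 by (simp add: fps_X_power_nth)
    hence "euler (fps_X ^ p :: 'k fps) \<noteq> 0" by (metis fps_zero_nth)
    ultimately show ?thesis by simp
  qed
  have generates_exists: "\<exists>g. generates P g" if P: "P \<in> derivations \<iota> B" for P
  proof -
    have P_in: "P b \<in> carrier B" if "b \<in> carrier B" for b
      using P that by (auto simp: derivations_def)
    define \<delta> where "\<delta> = (\<lambda>a. ex (P (exi a)))"
    have exi_hom: "exi (a + b) = exi a \<oplus> exi b" "exi (a * b) = exi a \<otimes> exi b"
      if "a \<in> supported S" "b \<in> supported S" for a b
      using exi[OF that(1)] exi[OF that(2)] exi[OF supported_add[OF that]]
        exi[OF supported_S_mult[OF that]]
      by (simp_all add: ex_inj ex_add ex_mult)
    have exi_const: "exi (fps_const c) = \<iota> c" for c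
      using exi[of "fps_const c"] \<iota>_in[of c] ex_\<iota>[of c]
      by (intro ex_inj) (simp_all add: supported_const)
    obtain g where g: "g \<in> supported (insert F S)"
      "\<And>a. a \<in> supported S \<Longrightarrow> \<delta> a = g * euler a"
    proof (rule derivation_eq_mult_euler[of \<delta>])
      show "\<delta> a \<in> supported S" if "a \<in> supported S" for a
        using that exi P_in ex_in by (simp add: \<delta>_def)
      show "\<delta> (a + b) = \<delta> a + \<delta> b" if "a \<in> supported S" "b \<in> supported S" for a b
        using that P exi P_in by (simp add: \<delta>_def exi_hom ex_add derivations_def)
      show "\<delta> (a * b) = a * \<delta> b + b * \<delta> a" if "a \<in> supported S" "b \<in> supported S" for a b
        using that P exi P_in by (simp add: \<delta>_def exi_hom ex_add ex_mult derivations_def)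
      show "\<delta> (fps_const c * a) = fps_const c * \<delta> a" if "a \<in> supported S" for c a
      proof -
        have "P (\<iota> c \<otimes> exi a) = \<iota> c \<otimes> P (exi a)"
          using P exi[OF that] unfolding derivations_def by blast
        thus ?thesis
          using that exi P_in \<iota>_in
          by (simp add: \<delta>_def exi_hom exi_const ex_mult ex_\<iota> supported_const)
      qed
    qed blast
    have "ex (P b) = g * euler (ex b)" if "b \<in> carrier B" for b
    proof -
      have "exi (ex b) = b" using that ex_in exi by (auto intro: ex_inj)
      thus ?thesis using g(2)[OF ex_in[OF that]] by (simp add: \<delta>_def)
    qed
    thus ?thesis using g(1) by (auto simp: generates_def)
  qed

  define gen where "gen = (\<lambda>P. THE g. generates P g)"
  have gen_eq: "gen P = g" if "generates P g" for P g
    unfolding gen_def using that generates_unique by blast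
  have gen: "generates P (gen P)" if "P \<in> derivations \<iota> B" for P
    using generates_exists[OF that] gen_eq by blast
  have gen_in: "gen P \<in> supported (insert F S)" if "P \<in> derivations \<iota> B" for P
    using gen[OF that] by (simp add: generates_def)
  have ex_P: "ex (P b) = gen P * euler (ex b)" if "P \<in> derivations \<iota> B" "b \<in> carrier B" for P b
    using gen[OF that(1)] that(2) by (simp add: generates_def)
  have P_in: "P b \<in> carrier B" if "P \<in> derivations \<iota> B" "b \<in> carrier B" for P b
    using that by (auto simp: derivations_def)

  define nabla where "nabla = (\<lambda>P. \<lambda>n\<in>carrier N. hi (conv (gen P) (cov (h n))))"
  have nabla_in: "nabla P n \<in> carrier N" and h_nabla: "h (nabla P n) = conv (gen P) (cov (h n))"
    if "generates P g" "n \<in> carrier N" for P g n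
  proof -
    have "gen P \<in> supported (insert F S)"
      using gen_eq[OF that(1)] that(1) by (simp add: generates_def)
    hence "conv (gen P) (cov (h n)) \<in> families"
      using h_in[OF that(2)] by (rule conv_cov_in_families)
    thus "nabla P n \<in> carrier N" "h (nabla P n) = conv (gen P) (cov (h n))"
      using that(2) hi by (simp_all add: nabla_def)
  qed
  have leibniz: "nabla P (b \<odot>\<^bsub>N\<^esub> n) = (b \<odot>\<^bsub>N\<^esub> nabla P n) \<oplus>\<^bsub>N\<^esub> (P b \<odot>\<^bsub>N\<^esub> n)"
    if P: "P \<in> derivations \<iota> B" and b: "b \<in> carrier B" and n: "n \<in> carrier N" for P b n
  proof (rule h_inj)
    note [simp] = nabla_in[OF gen[OF P]] h_nabla[OF gen[OF P]] P_in[OF P]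
    have "cov (conv (ex b) (h n)) = (\<lambda>i. conv (ex b) (cov (h n)) i + conv (euler (ex b)) (h n) i)"
    proof (rule cov_conv)
      fix i m assume "fps_nth (ex b) i \<noteq> 0"
      hence "i \<in> S" using ex_in[OF b] by (auto simp: supported_def)
      thus "h n m \<in> U (m + i)" using h_in[OF n] U_shiftD by (auto simp: families_def)
    qed
    hence "conv (gen P) (cov (conv (ex b) (h n))) =
        (\<lambda>i. conv (ex b) (conv (gen P) (cov (h n))) i + conv (ex (P b)) (h n) i)"
      by (simp add: conv_add_right ex_P[OF P b] conv_assoc conv_commute[of "ex b"])
    thus "h (nabla P (b \<odot>\<^bsub>N\<^esub> n)) = h (b \<odot>\<^bsub>N\<^esub> nabla P n \<oplus>\<^bsub>N\<^esub> P b \<odot>\<^bsub>N\<^esub> n)"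
      using b n by (simp add: h_add h_smult)
  qed (use that nabla_in[OF gen[OF P]] P_in[OF P] in auto)

  have connection: "is_connection \<iota> B N nabla"
    unfolding is_connection_def
  proof (intro conjI ballI)
    show "nabla \<in> derivations \<iota> B \<rightarrow> linear_endomorphisms \<iota> N"
    proof
      fix P assume P: "P \<in> derivations \<iota> B"
      note [simp] = nabla_in[OF gen[OF P]] h_nabla[OF gen[OF P]]
      have "nabla P (m \<oplus>\<^bsub>N\<^esub> n) = nabla P m \<oplus>\<^bsub>N\<^esub> nabla P n"
        if "m \<in> carrier N" "n \<in> carrier N" for m n
        using that by (intro h_inj) (auto simp: h_add cov_add h_in conv_add_right)
      moreover have "nabla P (\<iota> c \<odot>\<^bsub>N\<^esub> n) = \<iota> c \<odot>\<^bsub>N\<^esub> nabla P n" if "n \<in> carrier N" for c n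
      proof -
        have "ex (P (\<iota> c)) = 0" using ex_P[OF P \<iota>_in] by (simp add: ex_\<iota> euler_def)
        also have "0 = ex \<zero>" using ex_add[of "\<zero>" "\<zero>"] by simp
        finally have "P (\<iota> c) = \<zero>" using P_in[OF P \<iota>_in] by (intro ex_inj) auto
        thus ?thesis using leibniz[OF P \<iota>_in that] that \<iota>_in by simp
      qed
      moreover have "nabla P \<in> carrier N \<rightarrow>\<^sub>E carrier N"
        using nabla_in[OF gen[OF P]] by (auto simp: nabla_def)
      ultimately show "nabla P \<in> linear_endomorphisms \<iota> N"
        by (simp add: linear_endomorphisms_def)
    qed
  next
    fix P Q n assume P: "P \<in> derivations \<iota> B" and Q: "Q \<in> derivations \<iota> B" and n: "n \<in> carrier N"
    have sum: "generates (derivation_add B P Q) (gen P + gen Q)"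
      using P_in[OF P] P_in[OF Q] ex_P[OF P] ex_P[OF Q] supported_add[OF gen_in[OF P] gen_in[OF Q]]
      by (simp add: generates_def derivation_add_def ex_add algebra_simps)
    show "nabla (derivation_add B P Q) n = nabla P n \<oplus>\<^bsub>N\<^esub> nabla Q n"
      using n nabla_in[OF gen[OF P] n] nabla_in[OF gen[OF Q] n] nabla_in[OF sum n]
        h_nabla[OF gen[OF P] n] h_nabla[OF gen[OF Q] n] h_nabla[OF sum n]
      by (intro h_inj) (auto simp: h_add gen_eq[OF sum] conv_add_left)
  next
    fix b P n assume b: "b \<in> carrier B" and P: "P \<in> derivations \<iota> B" and n: "n \<in> carrier N"
    have "ex b * gen P \<in> supported (insert F S)"
    proof (rule supported_mult[OF ex_in[OF b] gen_in[OF P]])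
      fix i j assume "i \<in> S" "j \<in> insert F S"
      thus "i + j \<in> insert F S"
        using two_generated_add[of i p q j] above_F_in_S[of "i + F"] by (cases "i = 0") auto
    qed
    hence prod: "generates (derivation_smult B b P) (ex b * gen P)"
      using b P_in[OF P] ex_P[OF P]
      by (simp add: generates_def derivation_smult_def ex_mult algebra_simps)
    show "nabla (derivation_smult B b P) n = b \<odot>\<^bsub>N\<^esub> nabla P n"
      using b n nabla_in[OF gen[OF P] n] nabla_in[OF prod n] h_nabla[OF gen[OF P] n] h_nabla[OF prod n]
      by (intro h_inj) (auto simp: h_smult gen_eq[OF prod] conv_assoc)
  qed (rule leibniz)

  have "is_integrable \<iota> B N nabla"
    unfolding is_integrable_def
  proof (intro ballI)
    fix P Q n assume P: "P \<in> derivations \<iota> B" and Q: "Q \<in> derivations \<iota> B" and n: "n \<in> carrier N"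
    let ?g = "gen P * euler (gen Q) - gen Q * euler (gen P)"
    have eq: "ex (derivation_bracket B P Q b) = ?g * euler (ex b)" if b: "b \<in> carrier B" for b
      using b P_in[OF P] P_in[OF Q] ex_P[OF P] ex_P[OF Q]
      by (simp add: derivation_bracket_def ex_diff algebra_simps)
    \<comment> \<open>The terms of degree \<open>2 F\<close> cause no harm: they exceed the Frobenius number.\<close>
    have "i + j \<in> insert F S" if "i \<in> insert F S" "j \<in> insert F S" for i j
    proof (cases "i + j > F")
      case False
      hence "i = 0 \<and> j = F \<or> i = F \<and> j = 0 \<or> i \<in> S \<and> j \<in> S" using that by auto
      thus ?thesis using two_generated_add[of i p q j] by auto
    qed (use above_F_in_S in auto)
    hence "?g \<in> supported (insert F S)"
      using gen_in[OF P] gen_in[OF Q] by (intro supported_diff) (auto intro: supported_mult supported_euler)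
    hence br: "generates (derivation_bracket B P Q) ?g" using eq by (simp add: generates_def)
    have nPQ: "nabla P (nabla Q n) \<in> carrier N" "nabla Q (nabla P n) \<in> carrier N"
      using n nabla_in[OF gen[OF P]] nabla_in[OF gen[OF Q]] by auto
    have hPQ: "h (nabla P (nabla Q n)) = conv (gen P) (cov (conv (gen Q) (cov (h n))))"
      "h (nabla Q (nabla P n)) = conv (gen Q) (cov (conv (gen P) (cov (h n))))"
      using n h_nabla[OF gen[OF P]] h_nabla[OF gen[OF Q]] nabla_in[OF gen[OF P]] nabla_in[OF gen[OF Q]]
      by auto
    show "nabla (derivation_bracket B P Q) n = nabla P (nabla Q n) \<ominus>\<^bsub>N\<^esub> nabla Q (nabla P n)"
    proof (rule h_inj)
      have "h (nabla (derivation_bracket B P Q) n) = conv ?g (cov (h n))"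
        using h_nabla[OF br n] gen_eq[OF br] by simp
      also have "\<dots> = h (nabla P (nabla Q n) \<ominus>\<^bsub>N\<^esub> nabla Q (nabla P n))"
        unfolding h_diff[OF nPQ] hPQ by (rule conv_cov_bracket[OF gen_in[OF P] gen_in[OF Q] h_in[OF n]])
      finally show "h (nabla (derivation_bracket B P Q) n) = h (nabla P (nabla Q n) \<ominus>\<^bsub>N\<^esub> nabla Q (nabla P n))" .
    qed (use nPQ nabla_in[OF br n] in auto)
  qed
  with connection show ?thesis by blast
qed

end


section \<open>Torsion free modules\<close>

text \<open>In \<open>M \<otimes> Q\<close> one has \<open>m \<otimes> 1 = m \<otimes> s (1/s) = s m \<otimes> 1/s\<close>, so an element killed by
  a denominator \<open>s\<close> has the same image as \<open>0\<close>.\<close>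

lemma torsion_free_cancel:
  fixes R (structure)
  assumes modl: "module R M" and tf: "torsion_free R T M"
    and T: "T \<subseteq> carrier R" "\<one> \<in> T" "\<And>s t. s \<in> T \<Longrightarrow> t \<in> T \<Longrightarrow> s \<otimes> t \<in> T"
    and s: "s \<in> T" and m: "m \<in> carrier M" and sm: "s \<odot>\<^bsub>M\<^esub> m = \<zero>\<^bsub>M\<^esub>"
  shows "m = \<zero>\<^bsub>M\<^esub>"
proof -
  interpret M: module R M by (rule modl)
  define L where "L = localization R T"
  define x where "x = fraction R T \<one> s"
  have sR: "s \<in> carrier R" using s T by auto
  have eq: "fraction R T (s \<otimes> a) t = fraction R T \<one> \<one>" if at: "(a, t) \<in> x" for a t
  proof -
    obtain u where a: "a \<in> carrier R" and t: "t \<in> T" and u: "u \<in> T"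
      and *: "u \<otimes> (t \<otimes> \<one> \<ominus> s \<otimes> a) = \<zero>"
      using at unfolding x_def fraction_def by blast
    have tR: "t \<in> carrier R" and uR: "u \<in> carrier R" using t u T by auto
    have uta: "u \<otimes> t = u \<otimes> (s \<otimes> a)"
    proof -
      have "u \<otimes> t \<ominus> u \<otimes> (s \<otimes> a) = \<zero>"
        using * a tR uR sR by (simp add: M.R.minus_eq M.R.r_distr M.R.r_minus)
      thus ?thesis using a tR uR sR by simp
    qed
    have iff: "(\<exists>v\<in>T. v \<otimes> (t' \<otimes> (s \<otimes> a) \<ominus> t \<otimes> b) = \<zero>) \<longleftrightarrow>
        (\<exists>v\<in>T. v \<otimes> (t' \<otimes> \<one> \<ominus> \<one> \<otimes> b) = \<zero>)" if b: "b \<in> carrier R" and t': "t' \<in> T" for b t'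
    proof -
      have t'R: "t' \<in> carrier R" using t' T by auto
      have key: "(v \<otimes> u \<otimes> t) \<otimes> (t' \<otimes> \<one> \<ominus> \<one> \<otimes> b) = u \<otimes> (v \<otimes> (t' \<otimes> (s \<otimes> a) \<ominus> t \<otimes> b))"
        if "v \<in> carrier R" for v
      proof -
        have "(v \<otimes> u \<otimes> t) \<otimes> (t' \<otimes> \<one> \<ominus> \<one> \<otimes> b) =
            v \<otimes> t' \<otimes> (u \<otimes> t) \<ominus> v \<otimes> u \<otimes> (t \<otimes> b)"
          using that a b tR t'R uR sR
          by (simp add: M.R.minus_eq M.R.r_distr M.R.r_minus M.R.m_ac)
        also have "\<dots> = v \<otimes> t' \<otimes> (u \<otimes> (s \<otimes> a)) \<ominus> v \<otimes> u \<otimes> (t \<otimes> b)" unfolding uta ..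
        also have "\<dots> = u \<otimes> (v \<otimes> (t' \<otimes> (s \<otimes> a) \<ominus> t \<otimes> b))"
          using that a b tR t'R uR sR
          by (simp add: M.R.minus_eq M.R.r_distr M.R.r_minus M.R.m_ac)
        finally show ?thesis .
      qed
      show ?thesis
      proof
        assume "\<exists>v\<in>T. v \<otimes> (t' \<otimes> (s \<otimes> a) \<ominus> t \<otimes> b) = \<zero>"
        then obtain v where v: "v \<in> T" "v \<otimes> (t' \<otimes> (s \<otimes> a) \<ominus> t \<otimes> b) = \<zero>" by blast
        have "(v \<otimes> u \<otimes> t) \<otimes> (t' \<otimes> \<one> \<ominus> \<one> \<otimes> b) = \<zero>"
          using key[of v] v T uR by auto
        thus "\<exists>v\<in>T. v \<otimes> (t' \<otimes> \<one> \<ominus> \<one> \<otimes> b) = \<zero>" using v t u T(3) by blast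
      next
        assume "\<exists>v\<in>T. v \<otimes> (t' \<otimes> \<one> \<ominus> \<one> \<otimes> b) = \<zero>"
        then obtain v where v: "v \<in> T" "v \<otimes> (t' \<otimes> \<one> \<ominus> \<one> \<otimes> b) = \<zero>" by blast
        have vR: "v \<in> carrier R" using v T by auto
        have "(v \<otimes> u \<otimes> t) \<otimes> (t' \<otimes> \<one> \<ominus> \<one> \<otimes> b) = (u \<otimes> t) \<otimes> (v \<otimes> (t' \<otimes> \<one> \<ominus> \<one> \<otimes> b))"
          using vR b tR t'R uR by (simp add: M.R.m_ac del: M.R.r_one M.R.l_one)
        also have "\<dots> = \<zero>" using v uR tR by simp
        finally have "(u \<otimes> v) \<otimes> (t' \<otimes> (s \<otimes> a) \<ominus> t \<otimes> b) = \<zero>"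
          using key[OF vR] vR a b tR t'R uR sR by (simp add: M.R.m_assoc)
        thus "\<exists>v\<in>T. v \<otimes> (t' \<otimes> (s \<otimes> a) \<ominus> t \<otimes> b) = \<zero>" using v u T(3) by blast
      qed
    qed
    show ?thesis
      unfolding fraction_def mem_Collect_eq prod.case using iff
      by (intro subset_antisym subrelI; unfold mem_Collect_eq prod.case; blast)
  qed
  have "(\<one>, s) \<in> x"
    using s sR T(2) by (auto simp: x_def fraction_def M.R.minus_eq M.R.r_neg intro!: bexI[of _ \<one>])
  have sx: "s \<odot>\<^bsub>L\<^esub> x = \<one>\<^bsub>L\<^esub>"
  proof -
    have "(\<Union>(a, t)\<in>x. fraction R T (s \<otimes> a) t) = (\<Union>y\<in>x. fraction R T \<one> \<one>)"
      by (rule SUP_cong) (auto simp only: eq split: prod.split)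
    moreover have "x \<noteq> {}" using \<open>(\<one>, s) \<in> x\<close> by blast
    ultimately show ?thesis by (simp add: L_def localization_def)
  qed
  have xL: "x \<in> carrier L" and oneL: "\<one>\<^bsub>L\<^esub> \<in> carrier L"
    using s T(2) by (auto simp: L_def localization_def x_def)
  define K where "K = free_Abelian_group (carrier M \<times> carrier L)"
  interpret K: comm_group K unfolding K_def by (rule abelian_free_Abelian_group)
  define H where "H = generate K (tensor_relations R M L)"
  let ?x = "frag_of (\<zero>\<^bsub>M\<^esub>, x)" and ?z = "frag_of (\<zero>\<^bsub>M\<^esub>, \<one>\<^bsub>L\<^esub>)" and ?w = "frag_of (m, \<one>\<^bsub>L\<^esub>)"
  have rel: "?x - frag_of (m', \<one>\<^bsub>L\<^esub>) \<in> H \<and>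
      - (?x - frag_of (m', \<one>\<^bsub>L\<^esub>)) \<in> H"
    if m': "m' \<in> carrier M" "s \<odot>\<^bsub>M\<^esub> m' = \<zero>\<^bsub>M\<^esub>" for m'
  proof -
    let ?r = "?x - frag_of (m', \<one>\<^bsub>L\<^esub>)"
    have "?r = frag_of (s \<odot>\<^bsub>M\<^esub> m', x) - frag_of (m', s \<odot>\<^bsub>L\<^esub> x)"
      using m' sx by simp
    hence r: "?r \<in> tensor_relations R M L"
      using m'(1) sR xL unfolding tensor_relations_def by blast
    have "?r \<in> carrier K"
      using m'(1) xL oneL by (auto simp: K_def intro!: keys_diff[THEN subset_trans])
    hence "inv\<^bsub>K\<^esub> ?r = - ?r" by (simp add: K_def)
    thus ?thesis using generate.incl[OF r, of K] generate.inv[OF r, of K] by (simp add: H_def)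
  qed
  have H_add: "h + h' \<in> H" if "h \<in> H" "h' \<in> H" for h h'
    using generate.eng[of h K _ h'] that by (simp add: H_def K_def)
  define d where "d = ?w - ?z"
  \<comment> \<open>Both \<open>m \<otimes> 1\<close> and \<open>0 \<otimes> 1\<close> are congruent to \<open>0 \<otimes> 1/s\<close>.\<close>
  have "d = (?x - ?z) +
      - (?x - ?w)" by (simp add: d_def)
  hence d1: "d \<in> H" using rel[OF m sm] rel[OF M.M.zero_closed] sR H_add by (metis M.smult_r_null)
  have "- d = (?x - ?w) +
      - (?x - ?z)" by (simp add: d_def)
  hence d2: "- d \<in> H" using rel[OF m sm] rel[OF M.M.zero_closed] sR H_add by (metis M.smult_r_null)
  have "H #>\<^bsub>K\<^esub> ?w = H #>\<^bsub>K\<^esub> ?z"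
  proof -
    have mem: "h + y \<in> H #>\<^bsub>K\<^esub> y" if "h \<in> H" for h y
      using that by (auto simp: r_coset_def K_def)
    have e: "h + ?w = (h + d) + ?z"
      "h + ?z = (h + - d) + ?w" for h
      by (simp_all add: d_def)
    have "h + ?w \<in> H #>\<^bsub>K\<^esub> ?z"
      "h + ?z \<in> H #>\<^bsub>K\<^esub> ?w" if "h \<in> H" for h
      unfolding e(1)[of h] e(2)[of h] using mem H_add[OF that d1] H_add[OF that d2] by blast+
    thus ?thesis unfolding r_coset_def by (auto simp: K_def)
  qed
  hence "pure_tensor R M L m \<one>\<^bsub>L\<^esub> = pure_tensor R M L \<zero>\<^bsub>M\<^esub> \<one>\<^bsub>L\<^esub>"
    by (simp add: pure_tensor_def H_def K_def)
  thus ?thesis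
    using tf m by (auto simp: torsion_free_def L_def[symmetric] dest: inj_onD)
qed

lemma nonzero_divisors_closed:
  fixes R (structure)
  assumes "cring R"
  shows "nonzero_divisors R \<subseteq> carrier R" "\<one> \<in> nonzero_divisors R"
    "s \<in> nonzero_divisors R \<Longrightarrow> t \<in> nonzero_divisors R \<Longrightarrow> s \<otimes> t \<in> nonzero_divisors R"
proof -
  interpret cring R by (rule assms)
  show "nonzero_divisors R \<subseteq> carrier R" "\<one> \<in> nonzero_divisors R"
    by (auto simp: nonzero_divisors_def)
  show "s \<otimes> t \<in> nonzero_divisors R" if s: "s \<in> nonzero_divisors R" and t: "t \<in> nonzero_divisors R"
    unfolding nonzero_divisors_def
  proof (intro CollectI conjI ballI impI)
    have st: "s \<in> carrier R" "t \<in> carrier R" using s t by (auto simp: nonzero_divisors_def)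
    thus "s \<otimes> t \<in> carrier R" by simp
    fix a assume a: "a \<in> carrier R" "s \<otimes> t \<otimes> a = \<zero>"
    hence "s \<otimes> (t \<otimes> a) = \<zero>" using st by (simp add: m_assoc)
    hence "t \<otimes> a = \<zero>" using s st a(1) unfolding nonzero_divisors_def by blast
    thus "a = \<zero>" using t a(1) unfolding nonzero_divisors_def by blast
  qed
qed


section \<open>The smooth case\<close>

text \<open>On a free module a derivation acts on the coordinates; this action preserves brackets.\<close>

lemma integrable_connection_of_coordinates:
  fixes B :: "('b, 'z) ring_scheme" (structure) and N :: "('b, 'n, 'y) module_scheme"
    and coord :: "'n \<Rightarrow> 'g \<Rightarrow> 'b"
  assumes modl: "module B N" and \<iota>_in: "\<And>c. \<iota> c \<in> carrier B"
    and coord_in: "\<And>n g. n \<in> carrier N \<Longrightarrow> g \<in> G \<Longrightarrow> coord n g \<in> carrier B"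
    and coord_inj: "\<And>m n. m \<in> carrier N \<Longrightarrow> n \<in> carrier N \<Longrightarrow>
                      (\<And>g. g \<in> G \<Longrightarrow> coord m g = coord n g) \<Longrightarrow> m = n"
    and coord_surj: "\<And>c. c \<in> G \<rightarrow> carrier B \<Longrightarrow> \<exists>n\<in>carrier N. \<forall>g\<in>G. coord n g = c g"
    and coord_add: "\<And>m n g. m \<in> carrier N \<Longrightarrow> n \<in> carrier N \<Longrightarrow> g \<in> G \<Longrightarrow>
                      coord (m \<oplus>\<^bsub>N\<^esub> n) g = coord m g \<oplus> coord n g"
    and coord_smult: "\<And>b n g. b \<in> carrier B \<Longrightarrow> n \<in> carrier N \<Longrightarrow> g \<in> G \<Longrightarrow>
                      coord (b \<odot>\<^bsub>N\<^esub> n) g = b \<otimes> coord n g"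
  shows "\<exists>nabla. is_connection \<iota> B N nabla \<and> is_integrable \<iota> B N nabla"
proof -
  interpret N: module B N by (rule modl)
  have coord_diff: "coord (m \<ominus>\<^bsub>N\<^esub> n) g = coord m g \<ominus> coord n g"
    if "m \<in> carrier N" "n \<in> carrier N" "g \<in> G" for m n g
  proof -
    have "\<ominus>\<^bsub>N\<^esub> n = (\<ominus> \<one>) \<odot>\<^bsub>N\<^esub> n" using that by (simp add: N.smult_l_minus)
    thus ?thesis
      using that coord_in[of n g]
      by (simp add: N.M.minus_eq N.R.minus_eq coord_add coord_smult N.R.l_minus)
  qed
  define nabla where "nabla = (\<lambda>P. \<lambda>n\<in>carrier N.
      SOME m. m \<in> carrier N \<and> (\<forall>g\<in>G. coord m g = P (coord n g)))"
  have nabla: "nabla P n \<in> carrier N \<and> (\<forall>g\<in>G. coord (nabla P n) g = P (coord n g))"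
    if "\<And>b. b \<in> carrier B \<Longrightarrow> P b \<in> carrier B" "n \<in> carrier N" for P n
  proof -
    have "\<exists>m. m \<in> carrier N \<and> (\<forall>g\<in>G. coord m g = P (coord n g))"
      using coord_surj[of "\<lambda>g. P (coord n g)"] that coord_in by auto
    from someI_ex[OF this] show ?thesis using that(2) by (simp add: nabla_def)
  qed
  have P_in: "P b \<in> carrier B" if "P \<in> derivations \<iota> B" "b \<in> carrier B" for P b
    using that by (auto simp: derivations_def)
  have nablaP: "nabla P n \<in> carrier N \<and> (\<forall>g\<in>G. coord (nabla P n) g = P (coord n g))"
    if "P \<in> derivations \<iota> B" "n \<in> carrier N" for P n
    using nabla[of P n] P_in[OF that(1)] that(2) by blast
  have P_add: "P (a \<oplus> b) = P a \<oplus> P b"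
    and P_mult: "P (a \<otimes> b) = (a \<otimes> P b) \<oplus> (b \<otimes> P a)"
    if "P \<in> derivations \<iota> B" "a \<in> carrier B" "b \<in> carrier B" for P a b
    using that unfolding derivations_def by blast+
  have P_scale: "P (\<iota> c \<otimes> a) = \<iota> c \<otimes> P a" if "P \<in> derivations \<iota> B" "a \<in> carrier B" for P a c
    using that unfolding derivations_def by blast
  have "is_connection \<iota> B N nabla"
    unfolding is_connection_def
  proof (intro conjI ballI)
    show "nabla \<in> derivations \<iota> B \<rightarrow> linear_endomorphisms \<iota> N"
    proof
      fix P assume P: "P \<in> derivations \<iota> B"
      have "nabla P (m \<oplus>\<^bsub>N\<^esub> n) = nabla P m \<oplus>\<^bsub>N\<^esub> nabla P n"
        if "m \<in> carrier N" "n \<in> carrier N" for m n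
        using that nablaP[OF P]
        by (intro coord_inj) (auto simp: coord_add P_add[OF P] coord_in)
      moreover have "nabla P (\<iota> c \<odot>\<^bsub>N\<^esub> n) = \<iota> c \<odot>\<^bsub>N\<^esub> nabla P n" if "n \<in> carrier N" for c n
        using that nablaP[OF P] \<iota>_in
        by (intro coord_inj) (auto simp: coord_smult P_scale[OF P] coord_in)
      moreover have "nabla P \<in> carrier N \<rightarrow>\<^sub>E carrier N"
        using nablaP[OF P] by (auto simp: PiE_iff extensional_def) (simp add: nabla_def)
      ultimately show "nabla P \<in> linear_endomorphisms \<iota> N"
        by (simp add: linear_endomorphisms_def)
    qed
  next
    fix P Q n assume PQ: "P \<in> derivations \<iota> B" "Q \<in> derivations \<iota> B" "n \<in> carrier N"
    have "derivation_add B P Q b \<in> carrier B" if "b \<in> carrier B" for b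
      using that PQ P_in by (simp add: derivation_add_def)
    note s = nabla[of "derivation_add B P Q" n, OF this PQ(3)]
    show "nabla (derivation_add B P Q) n = nabla P n \<oplus>\<^bsub>N\<^esub> nabla Q n"
      using PQ s nablaP
      by (intro coord_inj) (auto simp: coord_add coord_in derivation_add_def)
  next
    fix b P n assume bP: "b \<in> carrier B" "P \<in> derivations \<iota> B" "n \<in> carrier N"
    have "derivation_smult B b P a \<in> carrier B" if "a \<in> carrier B" for a
      using that bP P_in by (simp add: derivation_smult_def)
    note s = nabla[of "derivation_smult B b P" n, OF this bP(3)]
    show "nabla (derivation_smult B b P) n = b \<odot>\<^bsub>N\<^esub> nabla P n"
      using bP s nablaP
      by (intro coord_inj) (auto simp: coord_smult coord_in derivation_smult_def)
  next
    fix P b n assume P: "P \<in> derivations \<iota> B" and b: "b \<in> carrier B" and n: "n \<in> carrier N"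
    show "nabla P (b \<odot>\<^bsub>N\<^esub> n) = (b \<odot>\<^bsub>N\<^esub> nabla P n) \<oplus>\<^bsub>N\<^esub> (P b \<odot>\<^bsub>N\<^esub> n)"
      using b n nablaP[OF P] P_in[OF P]
      by (intro coord_inj)
        (auto simp: coord_add coord_smult coord_in P_mult[OF P] N.R.m_comm[of "P b"])
  qed
  moreover have "is_integrable \<iota> B N nabla"
    unfolding is_integrable_def
  proof (intro ballI)
    fix P Q n assume PQ: "P \<in> derivations \<iota> B" "Q \<in> derivations \<iota> B" "n \<in> carrier N"
    have "derivation_bracket B P Q b \<in> carrier B" if "b \<in> carrier B" for b
      using that PQ P_in by (simp add: derivation_bracket_def)
    note s = nabla[of "derivation_bracket B P Q" n, OF this PQ(3)]
    show "nabla (derivation_bracket B P Q) n = nabla P (nabla Q n) \<ominus>\<^bsub>N\<^esub> nabla Q (nabla P n)"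
      using PQ s nablaP
      by (intro coord_inj) (auto simp: coord_diff coord_in derivation_bracket_def)
  qed
  ultimately show ?thesis by blast
qed

text \<open>Such a module is free, and the coordinates of a basis give the connection: a relation
  among a minimal number of generators can be divided by the smallest power of \<open>t\<close> that
  occurs, and then it expresses one generator by the others.\<close>

lemma integrable_connection_over_power_series:
  fixes B :: "('b, 'z) ring_scheme" (structure) and N :: "('b, 'n, 'y) module_scheme"
    and ex :: "'b \<Rightarrow> 'k::field fps"
  assumes modl: "module B N" and fg: "finitely_generated B N"
    and tf: "torsion_free B (nonzero_divisors B) N"
    and ex_bij: "bij_betw ex (carrier B) UNIV"
    and ex_add: "\<And>a b. a \<in> carrier B \<Longrightarrow> b \<in> carrier B \<Longrightarrow> ex (a \<oplus> b) = ex a + ex b"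
    and ex_mult: "\<And>a b. a \<in> carrier B \<Longrightarrow> b \<in> carrier B \<Longrightarrow> ex (a \<otimes> b) = ex a * ex b"
    and \<iota>_in: "\<And>c. \<iota> c \<in> carrier B"
  shows "\<exists>nabla. is_connection \<iota> B N nabla \<and> is_integrable \<iota> B N nabla"
proof -
  interpret N: module B N by (rule modl)
  note ex_inj = inj_onD[OF bij_betw_imp_inj_on[OF ex_bij]]
  define exi where "exi = inv_into (carrier B) ex"
  have exi: "exi a \<in> carrier B" "ex (exi a) = a" for a
    using ex_bij by (auto simp: exi_def bij_betw_def intro: inv_into_into f_inv_into_f)
  have "ex \<zero> + ex \<zero> = ex \<zero> + 0" using ex_add[of "\<zero>" "\<zero>"] by simp
  hence ex_zero: "ex \<zero> = 0" by (rule add_left_imp_eq)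
  have ex_one: "ex \<one> = 1" using ex_mult[of "exi 1" "\<one>"] exi[of 1] by simp
  have ex_zero_iff: "ex a = 0 \<longleftrightarrow> a = \<zero>" if "a \<in> carrier B" for a
    using that ex_zero ex_inj[of a "\<zero>"] by auto
  define gens where "gens = (\<lambda>G. finite G \<and> G \<subseteq> carrier N \<and>
      (\<forall>m\<in>carrier N. \<exists>c\<in>G \<rightarrow> carrier B. m = (\<Oplus>\<^bsub>N\<^esub>g\<in>G. c g \<odot>\<^bsub>N\<^esub> g)))"
  have "\<exists>G. gens G" using fg by (simp add: finitely_generated_def gens_def)
  then obtain G where G: "gens G" and G_min: "\<And>G'. gens G' \<Longrightarrow> card G \<le> card G'"
    using ex_has_least_nat[of gens _ card] by blast
  have finG: "finite G" and GN: "G \<subseteq> carrier N"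
    and G_gen: "\<And>m. m \<in> carrier N \<Longrightarrow> \<exists>c\<in>G \<rightarrow> carrier B. m = (\<Oplus>\<^bsub>N\<^esub>g\<in>G. c g \<odot>\<^bsub>N\<^esub> g)"
    using G by (auto simp: gens_def)
  define lc where "lc = (\<lambda>c. \<Oplus>\<^bsub>N\<^esub>g\<in>G. c g \<odot>\<^bsub>N\<^esub> g)"
  have lc_in: "lc c \<in> carrier N" if "c \<in> G \<rightarrow> carrier B" for c
    unfolding lc_def using that GN by (intro N.M.finsum_closed) auto
  have lc_cong: "lc c = lc c'" if "c \<in> G \<rightarrow> carrier B" "\<And>g. g \<in> G \<Longrightarrow> c g = c' g" for c c'
    unfolding lc_def by (rule N.M.finsum_cong') (use that GN in \<open>auto simp: Pi_def\<close>)
  have lc_add: "lc (\<lambda>g. c g \<oplus> c' g) = lc c \<oplus>\<^bsub>N\<^esub> lc c'"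
    if "c \<in> G \<rightarrow> carrier B" "c' \<in> G \<rightarrow> carrier B" for c c'
  proof -
    have "lc (\<lambda>g. c g \<oplus> c' g) = (\<Oplus>\<^bsub>N\<^esub>g\<in>G. c g \<odot>\<^bsub>N\<^esub> g \<oplus>\<^bsub>N\<^esub> c' g \<odot>\<^bsub>N\<^esub> g)"
      unfolding lc_def by (rule N.M.finsum_cong') (use that GN in \<open>auto simp: N.smult_l_distr Pi_def subset_iff\<close>)
    also have "\<dots> = lc c \<oplus>\<^bsub>N\<^esub> lc c'"
      unfolding lc_def by (rule N.M.finsum_addf) (use that GN in auto)
    finally show ?thesis .
  qed
  have lc_smult: "lc (\<lambda>g. b \<otimes> c g) = b \<odot>\<^bsub>N\<^esub> lc c"
    if "b \<in> carrier B" "c \<in> G \<rightarrow> carrier B" for b c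
  proof -
    have "b \<odot>\<^bsub>N\<^esub> lc c = (\<Oplus>\<^bsub>N\<^esub>g\<in>G. b \<odot>\<^bsub>N\<^esub> (c g \<odot>\<^bsub>N\<^esub> g))"
      unfolding lc_def using that GN by (intro N.finsum_smult_ldistr[OF finG]) auto
    also have "\<dots> = lc (\<lambda>g. b \<otimes> c g)"
      unfolding lc_def by (rule N.M.finsum_cong') (use that GN in \<open>auto simp: N.smult_assoc1 Pi_def subset_iff\<close>)
    finally show ?thesis by simp
  qed
  have cancel: "n = \<zero>\<^bsub>N\<^esub>" if "n \<in> carrier N" "exi (fps_X ^ v) \<odot>\<^bsub>N\<^esub> n = \<zero>\<^bsub>N\<^esub>" for n v
  proof (rule torsion_free_cancel[OF modl tf _ _ _ _ that])
    show "exi (fps_X ^ v) \<in> nonzero_divisors B"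
      unfolding nonzero_divisors_def
    proof (intro CollectI conjI ballI impI)
      fix a assume a: "a \<in> carrier B" "exi (fps_X ^ v) \<otimes> a = \<zero>"
      hence "ex (exi (fps_X ^ v)) * ex a = ex \<zero>" using ex_mult[OF exi(1)] by metis
      hence "ex a = 0" by (simp add: exi ex_zero)
      thus "a = \<zero>" using ex_zero_iff a by blast
    qed (rule exi)
  qed (use nonzero_divisors_closed[OF N.R.is_cring] in auto)

  have independent: "c g = \<zero>" if c: "c \<in> G \<rightarrow> carrier B" and lc0: "lc c = \<zero>\<^bsub>N\<^esub>" and "g \<in> G" for c g
  proof (rule ccontr)
    assume "c g \<noteq> \<zero>"
    then obtain g0 where g0: "g0 \<in> G" "c g0 \<noteq> \<zero>"
      and g0_min: "\<And>g. g \<in> G \<Longrightarrow> c g \<noteq> \<zero> \<Longrightarrow> subdegree (ex (c g0)) \<le> subdegree (ex (c g))"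
      using ex_has_least_nat[of "\<lambda>g. g \<in> G \<and> c g \<noteq> \<zero>" g "\<lambda>g. subdegree (ex (c g))"] \<open>g \<in> G\<close>
      by blast
    define v where "v = subdegree (ex (c g0))"
    define c' where "c' = (\<lambda>g. exi (fps_shift v (ex (c g))))"
    have c': "c' \<in> G \<rightarrow> carrier B" by (simp add: c'_def exi)
    have c_eq: "c g = exi (fps_X ^ v) \<otimes> c' g" if "g \<in> G" for g
    proof (rule ex_inj)
      have "fps_X ^ v * fps_shift v (ex (c g)) = ex (c g)"
      proof (cases "c g = \<zero>")
        case False
        hence "v \<le> subdegree (ex (c g))" using g0_min that by (simp add: v_def)
        thus ?thesis by (subst mult.commute) (rule fps_shift_times_fps_X_power)
      qed (simp add: ex_zero)
      thus "ex (c g) = ex (exi (fps_X ^ v) \<otimes> c' g)" by (simp add: c'_def exi ex_mult)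
    qed (use that c exi c'_def in auto)
    have "exi (fps_X ^ v) \<odot>\<^bsub>N\<^esub> lc c' = lc c"
      using lc_smult[OF exi(1) c'] lc_cong[OF c c_eq] by simp
    hence lc': "lc c' = \<zero>\<^bsub>N\<^esub>" using cancel lc_in[OF c'] lc0 by metis
    define u where "u = exi (inverse (ex (c' g0)))"
    have "ex (c g0) \<noteq> 0" using ex_zero_iff g0 c by auto
    hence "fps_nth (ex (c' g0)) 0 \<noteq> 0" by (simp add: c'_def exi v_def)
    moreover have c'g0: "c' g0 \<in> carrier B" using c' g0(1) by auto
    ultimately have u: "u \<in> carrier B" "u \<otimes> c' g0 = \<one>"
      using exi by (auto intro!: ex_inj simp: u_def ex_mult ex_one inverse_mult_eq_1)
    have "gens (G - {g0})"
      unfolding gens_def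
    proof (intro conjI ballI)
      fix m assume "m \<in> carrier N"
      then obtain d where d: "d \<in> G \<rightarrow> carrier B" "m = lc d" using G_gen by (auto simp: lc_def)
      \<comment> \<open>The multiple of the relation that cancels the coefficient of \<open>g0\<close>.\<close>
      define e where "e = \<ominus> (d g0 \<otimes> u)"
      have eB: "e \<in> carrier B" using d g0 u by (auto simp: e_def)
      define d' where "d' = (\<lambda>g. d g \<oplus> e \<otimes> c' g)"
      have d': "d' \<in> G \<rightarrow> carrier B" using d eB c' by (auto simp: d'_def)
      have "lc d' = lc d \<oplus>\<^bsub>N\<^esub> e \<odot>\<^bsub>N\<^esub> lc c'"
        unfolding d'_def using lc_add[OF d(1), of "\<lambda>g. e \<otimes> c' g"] lc_smult[OF eB c'] eB c' by auto
      hence m: "m = lc d'" using lc' d eB lc_in[OF d(1)] by simp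
      have "d' g0 = \<zero>"
      proof -
        have dg0: "d g0 \<in> carrier B" using d g0 by auto
        have "e \<otimes> c' g0 = \<ominus> (d g0 \<otimes> (u \<otimes> c' g0))"
          using dg0 u(1) c'g0 unfolding e_def by (simp add: N.R.l_minus N.R.m_assoc)
        thus ?thesis using dg0 u(2) by (simp add: d'_def N.R.r_neg)
      qed
      moreover have "lc d' = d' g0 \<odot>\<^bsub>N\<^esub> g0 \<oplus>\<^bsub>N\<^esub> (\<Oplus>\<^bsub>N\<^esub>g\<in>G - {g0}. d' g \<odot>\<^bsub>N\<^esub> g)"
      proof -
        have "lc d' = (\<Oplus>\<^bsub>N\<^esub>g\<in>insert g0 (G - {g0}). d' g \<odot>\<^bsub>N\<^esub> g)"
          using g0 by (simp add: lc_def insert_absorb)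
        also have "\<dots> = d' g0 \<odot>\<^bsub>N\<^esub> g0 \<oplus>\<^bsub>N\<^esub> (\<Oplus>\<^bsub>N\<^esub>g\<in>G - {g0}. d' g \<odot>\<^bsub>N\<^esub> g)"
          by (rule N.M.finsum_insert) (use finG d' GN g0 in auto)
        finally show ?thesis .
      qed
      moreover have "(\<Oplus>\<^bsub>N\<^esub>g\<in>G - {g0}. d' g \<odot>\<^bsub>N\<^esub> g) \<in> carrier N"
        using d' GN by (intro N.M.finsum_closed) auto
      ultimately have "m = (\<Oplus>\<^bsub>N\<^esub>g\<in>G - {g0}. d' g \<odot>\<^bsub>N\<^esub> g)" using m g0 GN by auto
      thus "\<exists>c\<in>G - {g0} \<rightarrow> carrier B. m = (\<Oplus>\<^bsub>N\<^esub>g\<in>G - {g0}. c g \<odot>\<^bsub>N\<^esub> g)"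
        using d' by (intro bexI[of _ d']) auto
    qed (use finG GN in auto)
    from G_min[OF this] show False using card_Diff1_less[OF finG g0(1)] by simp
  qed
  define coord where "coord = (\<lambda>n. SOME c. c \<in> G \<rightarrow> carrier B \<and> n = lc c)"
  have coord: "coord n \<in> G \<rightarrow> carrier B" "lc (coord n) = n" if "n \<in> carrier N" for n
  proof -
    have "\<exists>c. c \<in> G \<rightarrow> carrier B \<and> n = lc c" using G_gen[OF that] by (auto simp: lc_def)
    from someI_ex[OF this] show "coord n \<in> G \<rightarrow> carrier B" "lc (coord n) = n"
      by (simp_all add: coord_def)
  qed
  have coord_eq: "coord (lc c) g = c g" if c: "c \<in> G \<rightarrow> carrier B" and g: "g \<in> G" for c g
  proof -
    let ?d = "coord (lc c)"
    let ?e = "\<lambda>g. (\<ominus> \<one>) \<otimes> c g"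
    have cg: "c g \<in> carrier B" "?d g \<in> carrier B" using c g coord[OF lc_in[OF c]] by auto
    have d: "?d \<in> G \<rightarrow> carrier B" "lc ?d = lc c" using coord[OF lc_in[OF c]] by auto
    have e: "?e \<in> G \<rightarrow> carrier B" using c by auto
    have "lc (\<lambda>g. ?d g \<oplus> ?e g) = lc c \<oplus>\<^bsub>N\<^esub> (\<ominus> \<one>) \<odot>\<^bsub>N\<^esub> lc c"
      using lc_add[OF d(1) e] lc_smult[OF _ c, of "\<ominus> \<one>"] d(2) by simp
    also have "\<dots> = \<zero>\<^bsub>N\<^esub>" using lc_in[OF c] by (simp add: N.smult_l_minus N.M.r_neg)
    finally have "?d g \<oplus> ?e g = \<zero>"
      by (rule independent[OF _ _ g, rotated]) (use d e in auto)
    hence "?d g \<ominus> c g = \<zero>"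
      using cg by (simp add: N.R.minus_eq N.R.l_minus)
    thus ?thesis using cg by simp
  qed
  show ?thesis
  proof (rule integrable_connection_of_coordinates[OF modl \<iota>_in, where coord = coord and G = G])
    show "coord n g \<in> carrier B" if "n \<in> carrier N" "g \<in> G" for n g
      using coord(1)[OF that(1)] that(2) by auto
    show "m = n" if "m \<in> carrier N" "n \<in> carrier N" "\<And>g. g \<in> G \<Longrightarrow> coord m g = coord n g" for m n
    proof -
      have "lc (coord m) = lc (coord n)" by (rule lc_cong[OF coord(1)[OF that(1)] that(3)])
      thus ?thesis unfolding coord(2)[OF that(1)] coord(2)[OF that(2)] .
    qed
    show "\<exists>n\<in>carrier N. \<forall>g\<in>G. coord n g = c g" if "c \<in> G \<rightarrow> carrier B" for c
      using lc_in[OF that] coord_eq[OF that] by blast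
    show "coord (m \<oplus>\<^bsub>N\<^esub> n) g = coord m g \<oplus> coord n g"
      if mn: "m \<in> carrier N" "n \<in> carrier N" "g \<in> G" for m n g
    proof -
      have "lc (\<lambda>g. coord m g \<oplus> coord n g) = m \<oplus>\<^bsub>N\<^esub> n"
        using lc_add[OF coord(1)[OF mn(1)] coord(1)[OF mn(2)]]
        unfolding coord(2)[OF mn(1)] coord(2)[OF mn(2)] .
      moreover have c: "(\<lambda>g. coord m g \<oplus> coord n g) \<in> G \<rightarrow> carrier B"
        using coord(1)[OF mn(1)] coord(1)[OF mn(2)] by auto
      ultimately show ?thesis using coord_eq[OF c mn(3)] by simp
    qed
    show "coord (b \<odot>\<^bsub>N\<^esub> n) g = b \<otimes> coord n g"
      if b: "b \<in> carrier B" and n: "n \<in> carrier N" and g: "g \<in> G" for b n g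
    proof -
      have "lc (\<lambda>g. b \<otimes> coord n g) = b \<odot>\<^bsub>N\<^esub> n"
        using lc_smult[OF b coord(1)[OF n]] unfolding coord(2)[OF n] .
      moreover have c: "(\<lambda>g. b \<otimes> coord n g) \<in> G \<rightarrow> carrier B"
        using b coord(1)[OF n] by auto
      ultimately show ?thesis using coord_eq[OF c g] by simp
    qed
  qed
qed


section \<open>Coordinates on an adic completion\<close>

text \<open>A coordinate map \<open>J\<close> whose vanishing to high order is equivalent to lying deep in the
  filtration \<open>H\<close> identifies the inverse limit of the quotients by \<open>H\<close> with all families of
  coordinates, i.e. with a product of the homogeneous components.\<close>

locale coset_coordinates = abelian_group M
  for M :: "('m, 'z) ring_scheme" (structure) and H :: "nat \<Rightarrow> 'm set"
    and J :: "'m \<Rightarrow> nat \<Rightarrow> 'u::ab_group_add" and U :: "nat \<Rightarrow> 'u set" and C :: "nat \<Rightarrow> nat" +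
  assumes H_subgroup: "subgroup (H k) (add_monoid M)"
    and H_step: "H (Suc k) \<subseteq> H k"
    and J_add: "m \<in> carrier M \<Longrightarrow> m' \<in> carrier M \<Longrightarrow> J (m \<oplus> m') n = J m n + J m' n"
    and J_in: "m \<in> carrier M \<Longrightarrow> J m n \<in> U n"
    and J_H: "m \<in> H k \<Longrightarrow> n < k \<Longrightarrow> J m n = 0"
    and H_J: "m \<in> carrier M \<Longrightarrow> (\<And>n. n < C k \<Longrightarrow> J m n = 0) \<Longrightarrow> m \<in> H k"
    and J_surj: "(\<And>n. h n \<in> U n) \<Longrightarrow> \<exists>m\<in>carrier M. \<forall>n<k. J m n = h n"
    and C_mono: "mono C" and C_ge: "k \<le> C k"
begin

definition limit_coords :: "(nat \<Rightarrow> 'm set) \<Rightarrow> nat \<Rightarrow> 'u" where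
  "limit_coords \<phi> n = J (SOME m. m \<in> \<phi> (Suc n)) n"

lemma H_carrier: "m \<in> H k \<Longrightarrow> m \<in> carrier M"
  using subgroup.mem_carrier[OF H_subgroup] by simp

lemma J_minus:
  assumes "m \<in> carrier M" "m' \<in> carrier M"
  shows "J (m \<ominus> m') n = J m n - J m' n"
proof -
  have "J ((m \<ominus> m') \<oplus> m') n = J (m \<ominus> m') n + J m' n" using assms by (intro J_add) auto
  moreover have "(m \<ominus> m') \<oplus> m' = m" using assms by (simp add: minus_eq a_assoc l_neg)
  ultimately show ?thesis by simp
qed

lemma coset_mem: "y \<in> H k +> x \<longleftrightarrow> (\<exists>h\<in>H k. y = h \<oplus> x)"
  by (auto simp: a_r_coset_def')

lemma coset_self: "m \<in> carrier M \<Longrightarrow> m \<in> H k +> m"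
  using subgroup.one_closed[OF H_subgroup[of k]] by (auto simp: coset_mem intro!: bexI[of _ \<zero>])

lemma coset_minus:
  assumes "m \<in> carrier M" "m' \<in> carrier M" "m \<ominus> m' \<in> H k"
  shows "m \<in> H k +> m'"
  using assms by (auto simp: coset_mem minus_eq a_assoc l_neg intro!: bexI[of _ "m \<ominus> m'"])

lemma coset_eq:
  assumes "m \<in> carrier M" "m' \<in> carrier M" "m \<in> H k +> m'"
  shows "H k +> m = H k +> m'"
  using a_repr_independence[OF assms(3,2) H_subgroup] by simp

lemma limit_coset:
  assumes "\<phi> \<in> coset_limit M H" "m \<in> \<phi> k"
  shows "m \<in> carrier M" "\<phi> k = H k +> m"
proof -
  have "\<phi> k \<in> a_rcosets (H k)" using assms(1) by (simp add: coset_limit_def)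
  then obtain x where x: "x \<in> carrier M" "\<phi> k = H k +> x" by (auto simp: A_RCOSETS_def')
  show "m \<in> carrier M" using assms(2) x H_carrier by (auto simp: coset_mem)
  thus "\<phi> k = H k +> m" using coset_eq[of m x k] x assms(2) by simp
qed

lemma limit_nonempty: "\<phi> \<in> coset_limit M H \<Longrightarrow> \<exists>m. m \<in> \<phi> k"
proof -
  assume "\<phi> \<in> coset_limit M H"
  hence "\<phi> k \<in> a_rcosets (H k)" by (simp add: coset_limit_def)
  thus ?thesis using coset_self by (auto simp: A_RCOSETS_def')
qed

lemma limit_antimono: "\<phi> \<in> coset_limit M H \<Longrightarrow> j \<le> k \<Longrightarrow> \<phi> k \<subseteq> \<phi> j"
  by (rule lift_Suc_antimono_le[of \<phi>]) (auto simp: coset_limit_def)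

lemma limit_coords_eq:
  assumes \<phi>: "\<phi> \<in> coset_limit M H" and m: "m \<in> \<phi> k" and "n < k"
  shows "limit_coords \<phi> n = J m n"
proof -
  define m' where "m' = (SOME m. m \<in> \<phi> (Suc n))"
  have m': "m' \<in> \<phi> (Suc n)"
    unfolding m'_def using limit_nonempty[OF \<phi>] by (rule someI_ex)
  have "m \<in> \<phi> (Suc n)" using limit_antimono[OF \<phi>, of "Suc n" k] m \<open>n < k\<close> by auto
  then obtain h where h: "h \<in> H (Suc n)" "m = h \<oplus> m'"
    unfolding limit_coset(2)[OF \<phi> m'] coset_mem by blast
  have "J m n = J h n + J m' n"
    unfolding h(2) using h(1) H_carrier limit_coset(1)[OF \<phi> m'] by (intro J_add)
  also have "J h n = 0" using J_H[OF h(1)] by simp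
  finally show ?thesis by (simp add: limit_coords_def m'_def)
qed

lemma limit_coords_bij: "bij_betw limit_coords (coset_limit M H) {h. \<forall>n. h n \<in> U n}"
  unfolding bij_betw_def
proof (intro conjI inj_onI subset_antisym subsetI)
  fix \<phi> \<psi> assume \<phi>: "\<phi> \<in> coset_limit M H" and \<psi>: "\<psi> \<in> coset_limit M H" and eq: "limit_coords \<phi> = limit_coords \<psi>"
  show "\<phi> = \<psi>"
  proof
    fix k
    obtain m where m: "m \<in> \<phi> (C k)" using limit_nonempty[OF \<phi>] by blast
    obtain m' where m': "m' \<in> \<psi> (C k)" using limit_nonempty[OF \<psi>] by blast
    note mM = limit_coset(1)[OF \<phi> m] and m'M = limit_coset(1)[OF \<psi> m']
    have "J (m \<ominus> m') n = 0" if "n < C k" for n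
      using limit_coords_eq[OF \<phi> m that] limit_coords_eq[OF \<psi> m' that] eq by (simp add: J_minus mM m'M)
    hence "m \<ominus> m' \<in> H k" using mM m'M by (intro H_J) auto
    hence "H k +> m = H k +> m'" using mM m'M coset_minus coset_eq by blast
    moreover have "m \<in> \<phi> k" "m' \<in> \<psi> k"
      using limit_antimono[OF \<phi> C_ge] limit_antimono[OF \<psi> C_ge] m m' by auto
    ultimately show "\<phi> k = \<psi> k" using limit_coset(2)[OF \<phi>] limit_coset(2)[OF \<psi>] by metis
  qed
next
  fix h assume "h \<in> limit_coords ` coset_limit M H"
  then obtain \<phi> where \<phi>: "\<phi> \<in> coset_limit M H" "h = limit_coords \<phi>" by blast
  have "limit_coords \<phi> n \<in> U n" for n
    using limit_nonempty[OF \<phi>(1), of "Suc n"] limit_coords_eq[OF \<phi>(1), of _ "Suc n" n]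
      limit_coset(1)[OF \<phi>(1)] J_in by auto
  thus "h \<in> {h. \<forall>n. h n \<in> U n}" using \<phi> by simp
next
  fix h assume "h \<in> {h. \<forall>n. h n \<in> U n}"
  hence "\<forall>k. \<exists>m. m \<in> carrier M \<and> (\<forall>n<C k. J m n = h n)" using J_surj by blast
  then obtain m where m: "\<And>k. m k \<in> carrier M" "\<And>k n. n < C k \<Longrightarrow> J (m k) n = h n" by metis
  define \<phi> where "\<phi> = (\<lambda>k. H k +> m k)"
  have "\<phi> (Suc k) \<subseteq> \<phi> k" for k
  proof
    fix x assume "x \<in> \<phi> (Suc k)"
    then obtain y where y: "y \<in> H (Suc k)" "x = y \<oplus> m (Suc k)" by (auto simp: \<phi>_def coset_mem)
    have xM: "x \<in> carrier M" using y m H_carrier by simp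
    have yJ: "x \<ominus> m (Suc k) = y"
      using y m H_carrier by (simp add: minus_eq a_assoc r_neg)
    have "x \<in> H k +> m k"
    proof (rule coset_minus[OF xM m(1)])
      have "y \<in> H k"
        using y(1) H_step by auto
      moreover have "m (Suc k) \<ominus> m k \<in> H k"
        using m(1) monoD[OF C_mono, of k "Suc k"] by (intro H_J) (auto simp: J_minus m(2))
      moreover have "x \<ominus> m k = y \<oplus> (m (Suc k) \<ominus> m k)"
        using y m(1) H_carrier by (simp add: minus_eq a_assoc)
      ultimately show "x \<ominus> m k \<in> H k"
        using subgroup.m_closed[OF H_subgroup[of k]] by simp
    qed
    thus "x \<in> \<phi> k" by (simp add: \<phi>_def)
  qed
  hence \<phi>: "\<phi> \<in> coset_limit M H"
    using m(1) by (auto simp: coset_limit_def \<phi>_def A_RCOSETS_def')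
  have "limit_coords \<phi> n = h n" for n
  proof -
    have "m (Suc n) \<in> \<phi> (Suc n)" using coset_self m(1) by (simp add: \<phi>_def)
    from limit_coords_eq[OF \<phi> this, of n] m(2)[of n "Suc n"] C_ge[of "Suc n"] show ?thesis by simp
  qed
  hence "h = limit_coords \<phi>" by auto
  thus "h \<in> limit_coords ` coset_limit M H" using \<phi> by blast
qed

end


section \<open>Parametrized curves\<close>

text \<open>The restriction of the parametrization to \<open>k[x]\<close>, i.e. \<open>c(\<alpha> t^p)\<close>.\<close>

definition weighted_subst :: "nat \<Rightarrow> 'k::field \<Rightarrow> 'k poly \<Rightarrow> 'k fps" where
  "weighted_subst p \<alpha> c = fps_of_poly (pcompose c (monom \<alpha> p))"

text \<open>The substitution \<open>x = \<alpha> t^p\<close>, \<open>y = \<beta> t^q\<close>.\<close>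

definition param :: "nat \<Rightarrow> nat \<Rightarrow> 'k::field \<Rightarrow> 'k \<Rightarrow> 'k poly poly \<Rightarrow> 'k fps" where
  "param p q \<alpha> \<beta> P = poly (map_poly (weighted_subst p \<alpha>) P) (fps_const \<beta> * fps_X ^ q)"

lemma weighted_subst_simps [simp]:
  "weighted_subst p \<alpha> 0 = 0" "weighted_subst p \<alpha> 1 = 1"
  "weighted_subst p \<alpha> (a + b) = weighted_subst p \<alpha> a + weighted_subst p \<alpha> b"
  "weighted_subst p \<alpha> (a * b) = weighted_subst p \<alpha> a * weighted_subst p \<alpha> b"
  "weighted_subst p \<alpha> [:c:] = fps_const c"
  by (simp_all add: weighted_subst_def pcompose_add pcompose_mult fps_of_poly_add fps_of_poly_mult
      pcompose_const fps_of_poly_const pcompose_1)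

lemma weighted_subst_eq:
  "weighted_subst p \<alpha> c = (\<Sum>i\<le>degree c. fps_const (coeff c i * \<alpha> ^ i) * fps_X ^ (p * i))"
proof -
  have m: "fps_of_poly (monom \<alpha> p) = fps_const \<alpha> * fps_X ^ p"
    by (rule fps_ext) (auto simp: fps_X_power_nth)
  have "weighted_subst p \<alpha> c = (\<Sum>i\<le>degree c. fps_const (coeff c i) * (fps_const \<alpha> * fps_X ^ p) ^ i)"
    by (simp add: weighted_subst_def pcompose_altdef poly_altdef fps_of_poly_sum
        fps_of_poly_mult fps_of_poly_power m fps_of_poly_smult degree_map_poly coeff_map_poly)
  thus ?thesis
    by (simp add: power_mult_distrib power_mult fps_const_power mult.assoc fps_const_mult[symmetric]
        del: fps_const_mult)
qed

lemma param_pCons: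
  "param p q \<alpha> \<beta> (pCons c P) = weighted_subst p \<alpha> c + fps_const \<beta> * fps_X ^ q * param p q \<alpha> \<beta> P"
  by (simp add: param_def map_poly_pCons)

lemma param_0 [simp]: "param p q \<alpha> \<beta> 0 = 0"
  by (simp add: param_def)

lemma param_add [simp]: "param p q \<alpha> \<beta> (P + Q) = param p q \<alpha> \<beta> P + param p q \<alpha> \<beta> Q"
  by (induction P Q rule: poly_induct2) (simp_all add: param_pCons algebra_simps)

lemma param_smult [simp]: "param p q \<alpha> \<beta> (smult c Q) = weighted_subst p \<alpha> c * param p q \<alpha> \<beta> Q"
  by (induction Q) (simp_all add: param_pCons algebra_simps)

lemma param_mult [simp]: "param p q \<alpha> \<beta> (P * Q) = param p q \<alpha> \<beta> P * param p q \<alpha> \<beta> Q"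
  by (induction P) (simp_all add: param_pCons algebra_simps)

lemma param_const [simp]: "param p q \<alpha> \<beta> [:[:c:]:] = fps_const c"
  by (simp add: param_pCons)

lemma param_minus [simp]: "param p q \<alpha> \<beta> (P - Q) = param p q \<alpha> \<beta> P - param p q \<alpha> \<beta> Q"
  using param_add[of p q \<alpha> \<beta> "P - Q" Q] by (simp add: algebra_simps)

lemma param_eq:
  "param p q \<alpha> \<beta> P = (\<Sum>j\<le>degree P. \<Sum>i\<le>degree (coeff P j).
     fps_const (coeff (coeff P j) i * \<alpha> ^ i * \<beta> ^ j) * fps_X ^ (p * i + q * j))"
proof -
  have "param p q \<alpha> \<beta> P =
      (\<Sum>j\<le>degree (map_poly (weighted_subst p \<alpha>) P).
         weighted_subst p \<alpha> (coeff P j) * (fps_const \<beta> * fps_X ^ q) ^ j)"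
    by (simp add: param_def poly_altdef coeff_map_poly)
  also have "\<dots> = (\<Sum>j\<le>degree P. weighted_subst p \<alpha> (coeff P j) * (fps_const \<beta> * fps_X ^ q) ^ j)"
  proof (rule sum.mono_neutral_left)
    show "{..degree (map_poly (weighted_subst p \<alpha>) P)} \<subseteq> {..degree P}"
      by (auto intro: order_trans[OF _ map_poly_degree_leq])
    show "\<forall>j\<in>{..degree P} - {..degree (map_poly (weighted_subst p \<alpha>) P)}.
        weighted_subst p \<alpha> (coeff P j) * (fps_const \<beta> * fps_X ^ q) ^ j = 0"
    proof
      fix j assume "j \<in> {..degree P} - {..degree (map_poly (weighted_subst p \<alpha>) P)}"
      hence "coeff (map_poly (weighted_subst p \<alpha>) P) j = 0" by (intro coeff_eq_0) auto
      thus "weighted_subst p \<alpha> (coeff P j) * (fps_const \<beta> * fps_X ^ q) ^ j = 0"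
        by (simp add: coeff_map_poly)
    qed
  qed auto
  also have "\<dots> = (\<Sum>j\<le>degree P. \<Sum>i\<le>degree (coeff P j).
     fps_const (coeff (coeff P j) i * \<alpha> ^ i * \<beta> ^ j) * fps_X ^ (p * i + q * j))"
    unfolding weighted_subst_eq sum_distrib_right
    by (intro sum.cong refl)
      (simp add: power_mult_distrib power_add mult_ac flip: fps_const_mult power_mult)
  finally show ?thesis .
qed

lemma param_nth:
  "fps_nth (param p q \<alpha> \<beta> P) n = (\<Sum>j\<le>degree P. \<Sum>i\<le>degree (coeff P j).
     if n = p * i + q * j then coeff (coeff P j) i * \<alpha> ^ i * \<beta> ^ j else 0)"
  unfolding param_eq fps_sum_nth
  by (intro sum.cong refl) (simp add: fps_X_power_nth)

lemma param_monom: "param p q \<alpha> \<beta> (monom (monom c i) j) = fps_const (c * \<alpha> ^ i * \<beta> ^ j) * fps_X ^ (p * i + q * j)"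
proof (cases "c = 0")
  case False
  hence deg: "degree (monom (monom c i) j) = j" "degree (monom c i) = i"
    by (simp_all add: degree_monom_eq)
  have inner: "(\<Sum>i'\<le>i. fps_const (coeff (monom c i) i' * \<alpha> ^ i' * \<beta> ^ j) * fps_X ^ (p * i' + q * j))
      = fps_const (c * \<alpha> ^ i * \<beta> ^ j) * fps_X ^ (p * i + q * j)"
    by (subst sum.remove[of _ i]) (auto intro!: sum.neutral)
  define g where "g = (\<lambda>j'. \<Sum>i'\<le>degree (coeff (monom (monom c i) j) j').
      fps_const (coeff (coeff (monom (monom c i) j) j') i' * \<alpha> ^ i' * \<beta> ^ j') * fps_X ^ (p * i' + q * j'))"
  have "param p q \<alpha> \<beta> (monom (monom c i) j) = sum g {..j}"
    unfolding param_eq deg g_def ..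
  also have "\<dots> = sum g {j}"
    by (rule sum.mono_neutral_right) (auto simp: g_def)
  also have "\<dots> = fps_const (c * \<alpha> ^ i * \<beta> ^ j) * fps_X ^ (p * i + q * j)"
    using inner by (simp add: g_def deg)
  finally show ?thesis .
qed simp

lemma param_finite: "\<exists>n0. \<forall>n\<ge>n0. fps_nth (param p q \<alpha> \<beta> P) n = 0"
proof -
  define A where "A = {p * i + q * j |i j. j \<le> degree P \<and> i \<le> degree (coeff P j)}"
  have "A = (\<Union>j\<in>{..degree P}. (\<lambda>i. p * i + q * j) ` {..degree (coeff P j)})"
    by (auto simp: A_def)
  hence "finite A" by simp
  then obtain n0 where n0: "\<forall>n\<in>A. n < n0" using finite_nat_set_iff_bounded by blast
  have "fps_nth (param p q \<alpha> \<beta> P) n = 0" if "n \<ge> n0" for n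
    unfolding param_nth
  proof (intro sum.neutral ballI)
    fix j i assume "j \<in> {..degree P}" "i \<in> {..degree (coeff P j)}"
    hence "p * i + q * j \<in> A" by (auto simp: A_def)
    thus "(if n = p * i + q * j then coeff (coeff P j) i * \<alpha> ^ i * \<beta> ^ j else 0) = 0"
      using n0 that by fastforce
  qed
  thus ?thesis by blast
qed

lemma param_homogeneous:
  assumes "P \<in> poly_homogeneous p q d" "int n \<noteq> d"
  shows "fps_nth (param p q \<alpha> \<beta> P) n = 0"
  unfolding param_nth
proof (intro sum.neutral ballI)
  fix j i
  have "coeff (coeff P j) i = 0" if "n = p * i + q * j"
    using assms that unfolding poly_homogeneous_def by blast
  thus "(if n = p * i + q * j then coeff (coeff P j) i * \<alpha> ^ i * \<beta> ^ j else 0) = 0" by simp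
qed

text \<open>One of the parameters \<open>\<alpha>\<close>, \<open>\<beta>\<close> may vanish: the coordinate axes are parametrized as well, and
  then only the powers of the other variable contribute degrees.\<close>

definition param_degrees :: "nat \<Rightarrow> nat \<Rightarrow> 'k::field \<Rightarrow> 'k \<Rightarrow> nat set" where
  "param_degrees p q \<alpha> \<beta> = {p * i + q * j |i j. \<alpha> ^ i * \<beta> ^ j \<noteq> 0}"

lemma param_supported: "param p q \<alpha> \<beta> P \<in> supported (param_degrees p q \<alpha> \<beta>)"
proof -
  have "fps_nth (param p q \<alpha> \<beta> P) n = 0" if "n \<notin> param_degrees p q \<alpha> \<beta>" for n
    unfolding param_nth
  proof (intro sum.neutral ballI)
    fix j i
    show "(if n = p * i + q * j then coeff (coeff P j) i * \<alpha> ^ i * \<beta> ^ j else 0) = 0"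
      using that by (auto simp: param_degrees_def)
  qed
  thus ?thesis by (simp add: supported_def)
qed


subsection \<open>The coordinate ring of a curve\<close>

lemma xy_simps [simp]:
  "carrier poly_ring_xy = UNIV" "P \<oplus>\<^bsub>poly_ring_xy\<^esub> Q = P + Q" "P \<otimes>\<^bsub>poly_ring_xy\<^esub> Q = P * Q"
  "\<one>\<^bsub>poly_ring_xy\<^esub> = 1" "\<zero>\<^bsub>poly_ring_xy\<^esub> = 0"
  by (simp_all add: ring_of_type_algebra_def)

lemma cring_xy: "cring poly_ring_xy"
  by (rule cring_from_type_algebra)

lemma ideal_curve: "ideal (curve_ideal f) poly_ring_xy"
  unfolding curve_ideal_def by (rule cring.cgenideal_ideal[OF cring_xy]) simp

lemma curve_ideal_iff: "P \<in> curve_ideal f \<longleftrightarrow> f dvd P"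
  by (auto simp: curve_ideal_def cgenideal_def dvd_def mult.commute)

lemma curve_proj_iff: "P' \<in> curve_proj f P \<longleftrightarrow> f dvd P' - P"
proof -
  have "P' \<in> curve_proj f P \<longleftrightarrow> (\<exists>h. f dvd h \<and> P' = h + P)"
    by (auto simp: curve_proj_def a_r_coset_def' curve_ideal_iff)
  also have "\<dots> \<longleftrightarrow> f dvd P' - P" by (metis add_diff_cancel diff_add_cancel)
  finally show ?thesis .
qed

lemma curve_proj_eq_iff: "curve_proj f P = curve_proj f Q \<longleftrightarrow> f dvd P - Q"
proof
  assume "curve_proj f P = curve_proj f Q"
  moreover have "P \<in> curve_proj f P" by (simp add: curve_proj_iff)
  ultimately show "f dvd P - Q" by (simp add: curve_proj_iff)
next
  assume *: "f dvd P - Q"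
  have "f dvd R - P \<longleftrightarrow> f dvd R - Q" for R
    using dvd_add_left_iff[OF *, of "R - P"] by simp
  thus "curve_proj f P = curve_proj f Q" by (auto simp: curve_proj_iff)
qed

lemma cring_curve: "cring (curve_ring f)"
  unfolding curve_ring_def by (rule ideal.quotient_is_cring[OF ideal_curve cring_xy])

lemma curve_proj_hom: "curve_proj f \<in> ring_hom poly_ring_xy (curve_ring f)"
  using ideal.rcos_ring_hom[OF ideal_curve[of f]] by (simp add: curve_ring_def curve_proj_def[abs_def])

lemma curve_proj_simps:
  "curve_proj f P \<in> carrier (curve_ring f)"
  "curve_proj f P \<oplus>\<^bsub>curve_ring f\<^esub> curve_proj f Q = curve_proj f (P + Q)"
  "curve_proj f P \<otimes>\<^bsub>curve_ring f\<^esub> curve_proj f Q = curve_proj f (P * Q)"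
  "\<one>\<^bsub>curve_ring f\<^esub> = curve_proj f 1"
  using ring_hom_closed[OF curve_proj_hom, of P f] ring_hom_add[OF curve_proj_hom, of P Q f]
    ring_hom_mult[OF curve_proj_hom, of P Q f] ring_hom_one[OF curve_proj_hom, of f]
  by simp_all

lemma curve_zero: "\<zero>\<^bsub>curve_ring f\<^esub> = curve_proj f 0"
  using ring_hom_zero[OF curve_proj_hom cring.axioms(1)[OF cring_xy] cring.axioms(1)[OF cring_curve], of f]
  by simp

lemma curve_carrierE:
  assumes "a \<in> carrier (curve_ring f)"
  obtains P where "a = curve_proj f P"
  using assms by (auto simp: curve_ring_def FactRing_def A_RCOSETS_def' curve_proj_def)

lemma ideal_power_0 [simp]: "ideal_power R I 0 = carrier R"
  by (simp add: ideal_power_def ideals_set_def nat_pow_def)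

lemma ideal_power_Suc [simp]: "ideal_power R I (Suc n) = ideal_prod R (ideal_power R I n) I"
  by (simp add: ideal_power_def ideals_set_def nat_pow_def)

lemma ideal_ideal_power:
  assumes "ring R" "ideal I R"
  shows "ideal (ideal_power R I n) R"
  by (induction n) (use assms in \<open>auto intro: ring.oneideal ring.ideal_prod_is_ideal\<close>)

lemma ideal_power_antimono:
  assumes "ring R" "ideal I R" "m \<le> n"
  shows "ideal_power R I n \<subseteq> ideal_power R I m"
proof (rule lift_Suc_antimono_le[OF _ assms(3)])
  fix n
  show "ideal_power R I (Suc n) \<subseteq> ideal_power R I n"
    using ring.ideal_prod_inter[OF assms(1) ideal_ideal_power[OF assms(1,2)] assms(2)] by auto
qed


text \<open>When the kernel of the parametrization is \<open>(f)\<close>, the coordinate ring is the span of the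
  powers \<open>t^s\<close> with \<open>s\<close> in \<open>param_degrees\<close>. The sandwich between the maximal-adic filtration and
  the order in \<open>t\<close> then identifies its completion.\<close>

locale parametrized_curve =
  fixes f :: "'k::field poly poly" and p q :: nat and \<alpha> \<beta> :: 'k
  assumes p_pos: "0 < p" and q_pos: "0 < q"
    and param_zero_iff: "param p q \<alpha> \<beta> P = 0 \<longleftrightarrow> f dvd P"
begin

abbreviation A :: "'k poly poly set ring" where "A \<equiv> curve_ring f"
abbreviation mm :: "'k poly poly set set" where "mm \<equiv> curve_max_ideal f"
abbreviation par :: "'k poly poly \<Rightarrow> 'k fps" where "par \<equiv> param p q \<alpha> \<beta>"
abbreviation degs :: "nat set" where "degs \<equiv> param_degrees p q \<alpha> \<beta>"

sublocale A: cring A by (rule cring_curve)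

definition series :: "'k poly poly set \<Rightarrow> 'k fps" where
  "series a = par (SOME P. a = curve_proj f P)"

lemma series_proj [simp]: "series (curve_proj f P) = par P"
proof -
  define Q where "Q = (SOME Q. curve_proj f P = curve_proj f Q)"
  have "curve_proj f P = curve_proj f Q" unfolding Q_def by (rule someI[of _ P]) simp
  hence "par (P - Q) = 0" by (simp only: curve_proj_eq_iff param_zero_iff)
  thus ?thesis by (simp add: series_def Q_def)
qed

lemma series_inj:
  assumes "a \<in> carrier A" "b \<in> carrier A" "series a = series b"
  shows "a = b"
proof -
  obtain P Q where PQ: "a = curve_proj f P" "b = curve_proj f Q"
    using assms curve_carrierE by metis
  hence "par (P - Q) = 0" using assms(3) by simp
  thus ?thesis using PQ by (simp only: curve_proj_eq_iff param_zero_iff)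
qed

lemma series_add:
  assumes "a \<in> carrier A" "b \<in> carrier A"
  shows "series (a \<oplus>\<^bsub>A\<^esub> b) = series a + series b"
proof -
  obtain P Q where "a = curve_proj f P" "b = curve_proj f Q"
    using assms curve_carrierE by metis
  thus ?thesis by (simp add: curve_proj_simps)
qed

lemma series_mult:
  assumes "a \<in> carrier A" "b \<in> carrier A"
  shows "series (a \<otimes>\<^bsub>A\<^esub> b) = series a * series b"
proof -
  obtain P Q where "a = curve_proj f P" "b = curve_proj f Q"
    using assms curve_carrierE by metis
  thus ?thesis by (simp add: curve_proj_simps)
qed

lemma series_zero [simp]: "series \<zero>\<^bsub>A\<^esub> = 0"
  by (simp add: curve_zero)

lemma series_minus:
  assumes "a \<in> carrier A"
  shows "series (\<ominus>\<^bsub>A\<^esub> a) = - series a"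
proof -
  have "series (\<ominus>\<^bsub>A\<^esub> a \<oplus>\<^bsub>A\<^esub> a) = series (\<ominus>\<^bsub>A\<^esub> a) + series a"
    using assms by (intro series_add) auto
  thus ?thesis using assms by (simp add: A.l_neg eq_neg_iff_add_eq_0)
qed

lemma series_supported: "a \<in> carrier A \<Longrightarrow> series a \<in> supported degs"
  using curve_carrierE[of a f] param_supported[of p q \<alpha> \<beta>] by (metis series_proj)

lemma ideal_mm: "ideal mm A"
  unfolding curve_max_ideal_def by (rule A.genideal_ideal) (auto simp: curve_proj_simps)

lemma x_in_mm: "curve_proj f [:[:0, 1:]:] \<in> mm" and y_in_mm: "curve_proj f [:0, 1:] \<in> mm"
  unfolding curve_max_ideal_def
  using A.genideal_self[of "{curve_proj f [:[:0, 1:]:], curve_proj f [:0, 1:]}"]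
  by (auto simp: curve_proj_simps)

abbreviation mpow :: "nat \<Rightarrow> 'k poly poly set set" where
  "mpow \<equiv> ideal_power A mm"

lemma ideal_power_mm: "ideal (mpow k) A"
  by (rule ideal_ideal_power[OF A.ring_axioms ideal_mm])

lemma power_antimono: "m \<le> n \<Longrightarrow> mpow n \<subseteq> mpow m"
  by (rule ideal_power_antimono[OF A.ring_axioms ideal_mm])

lemma monomial_in_power: "curve_proj f (monom (monom c i) j) \<in> mpow (i + j)"
proof (induction j)
  case 0
  show ?case
  proof (induction i)
    case 0
    show ?case by (simp add: curve_proj_simps)
  next
    case (Suc i)
    have "monom (monom c (Suc i)) 0 = monom (monom c i) 0 * [:[:0, 1:]:]"
      by (simp add: monom_0 monom_Suc)
    hence "curve_proj f (monom (monom c (Suc i)) 0) =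
        curve_proj f (monom (monom c i) 0) \<otimes>\<^bsub>A\<^esub> curve_proj f [:[:0, 1:]:]"
      by (simp only: curve_proj_simps)
    thus ?case using ideal_prod.prod[OF Suc x_in_mm] by simp
  qed
next
  case (Suc j)
  have "monom (monom c i) (Suc j) = monom (monom c i) j * [:0, 1:]"
    by (simp add: monom_Suc)
  hence "curve_proj f (monom (monom c i) (Suc j)) =
      curve_proj f (monom (monom c i) j) \<otimes>\<^bsub>A\<^esub> curve_proj f [:0, 1:]"
    by (simp only: curve_proj_simps)
  thus ?case using ideal_prod.prod[OF Suc y_in_mm] by simp
qed

text \<open>A monomial \<open>x^i y^j\<close> of degree \<open>s = p i + q j \<le> (p + q) (i + j)\<close> lies in the maximal ideal
  to the power \<open>i + j\<close>, so high degree implies high power.\<close>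

lemma monomial_exists:
  assumes "s \<in> degs"
  shows "\<exists>P. P \<in> poly_homogeneous p q (int s) \<and> par P = fps_X ^ s \<and>
    (\<forall>k. (p + q) * k \<le> s \<longrightarrow> curve_proj f P \<in> mpow k)"
proof -
  obtain i j where s: "s = p * i + q * j" and nz: "\<alpha> ^ i * \<beta> ^ j \<noteq> 0"
    using assms by (auto simp: param_degrees_def)
  define P where "P = monom (monom (inverse (\<alpha> ^ i * \<beta> ^ j)) i) j"
  have "P \<in> poly_homogeneous p q (int s)" by (auto simp: P_def poly_homogeneous_def s)
  moreover have "inverse (\<alpha> ^ i * \<beta> ^ j) * \<alpha> ^ i * \<beta> ^ j = 1"
    using left_inverse[OF nz] by (simp only: mult.assoc)
  hence "par P = fps_X ^ s" unfolding P_def param_monom s by simp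
  moreover have "curve_proj f P \<in> mpow k" if "(p + q) * k \<le> s" for k
  proof -
    have "s \<le> (p + q) * (i + j)" unfolding s by (simp add: algebra_simps)
    hence "(p + q) * k \<le> (p + q) * (i + j)" using that by (rule order_trans[rotated])
    hence "k \<le> i + j" using p_pos by simp
    thus ?thesis using monomial_in_power power_antimono unfolding P_def by blast
  qed
  ultimately show ?thesis by blast
qed

definition mon :: "nat \<Rightarrow> 'k poly poly" where
  "mon s = (SOME P. P \<in> poly_homogeneous p q (int s) \<and> par P = fps_X ^ s \<and>
    (\<forall>k. (p + q) * k \<le> s \<longrightarrow> curve_proj f P \<in> mpow k))"

lemma mon:
  assumes "s \<in> degs"
  shows mon_homogeneous: "mon s \<in> poly_homogeneous p q (int s)"
    and par_mon: "par (mon s) = fps_X ^ s"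
    and mon_in_power: "(p + q) * k \<le> s \<Longrightarrow> curve_proj f (mon s) \<in> mpow k"
  using someI_ex[OF monomial_exists[OF assms]] unfolding mon_def by blast+

definition poly_of :: "(nat \<Rightarrow> 'k) \<Rightarrow> nat set \<Rightarrow> 'k poly poly" where
  "poly_of h I = (\<Sum>n | n \<in> I \<and> h n \<noteq> 0. [:[:h n:]:] * mon n)"

lemma par_poly_of:
  assumes "finite I" "\<And>n. n \<in> I \<Longrightarrow> h n \<noteq> 0 \<Longrightarrow> n \<in> degs"
  shows "fps_nth (par (poly_of h I)) n = (if n \<in> I then h n else 0)"
proof -
  have sum: "par (sum g K) = (\<Sum>k\<in>K. par (g k))" for g :: "nat \<Rightarrow> 'k poly poly" and K
    by (induction K rule: infinite_finite_induct) simp_all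
  have "par (poly_of h I) = (\<Sum>n | n \<in> I \<and> h n \<noteq> 0. fps_const (h n) * fps_X ^ n)"
    unfolding poly_of_def sum using assms(2) by (intro sum.cong) (auto simp: par_mon simp del: mult_pCons_left)
  hence "fps_nth (par (poly_of h I)) n = (\<Sum>m | m \<in> I \<and> h m \<noteq> 0. if n = m then h m else 0)"
    by (simp add: fps_sum_nth fps_X_power_nth if_distrib cong: if_cong)
  also have "\<dots> = (if n \<in> I then h n else 0)"
    using assms(1) by simp
  finally show ?thesis .
qed

lemma proj_poly_of_in_power:
  assumes "finite I" "\<And>n. n \<in> I \<Longrightarrow> h n \<noteq> 0 \<Longrightarrow> n \<in> degs \<and> (p + q) * k \<le> n"
  shows "curve_proj f (poly_of h I) \<in> mpow k"
proof -
  interpret K: ideal "mpow k" A by (rule ideal_power_mm)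
  have "curve_proj f (\<Sum>n\<in>L. [:[:h n:]:] * mon n) \<in> mpow k"
    if "finite L" "\<And>n. n \<in> L \<Longrightarrow> n \<in> degs \<and> (p + q) * k \<le> n" for L
    using that
  proof (induction L rule: finite_induct)
    case empty
    show ?case using K.zero_closed by (simp add: curve_zero)
  next
    case (insert n L)
    have "curve_proj f ([:[:h n:]:] * mon n) \<in> mpow k"
      using K.I_l_closed[OF mon_in_power curve_proj_simps(1)] insert.prems[of n]
      by (simp add: curve_proj_simps(3) del: mult_pCons_left)
    thus ?case
      using insert K.a_closed
      by (simp del: mult_pCons_left flip: curve_proj_simps(2))
  qed
  note * = this
  show ?thesis unfolding poly_of_def by (rule *) (use assms in auto)
qed

lemma finite_expansion:
  assumes "a \<in> carrier A"
  obtains h n0 where "a = curve_proj f (poly_of h {..<n0})"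
    "\<And>n. h n = fps_nth (series a) n" "\<And>n. h n \<noteq> 0 \<Longrightarrow> n \<in> degs"
proof -
  obtain P where P: "a = curve_proj f P" using assms by (rule curve_carrierE)
  obtain n0 where n0: "\<And>n. n \<ge> n0 \<Longrightarrow> fps_nth (par P) n = 0" using param_finite by blast
  define h where "h = fps_nth (par P)"
  have h: "n \<in> degs" if "h n \<noteq> 0" for n
    using that param_supported[of p q \<alpha> \<beta> P] by (auto simp: h_def supported_def)
  have "par (poly_of h {..<n0}) = par P"
    using n0 h by (intro fps_ext) (subst par_poly_of, auto simp: h_def)
  hence "a = curve_proj f (poly_of h {..<n0})"
    using assms by (intro series_inj) (auto simp: P curve_proj_simps)
  thus thesis by (rule that[of h n0]) (use h in \<open>auto simp: h_def P\<close>)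
qed

lemma vanishing_in_power:
  assumes a: "a \<in> carrier A" and van: "\<And>n. n < (p + q) * k \<Longrightarrow> fps_nth (series a) n = 0"
  shows "a \<in> mpow k"
proof -
  obtain h n0 where h: "a = curve_proj f (poly_of h {..<n0})"
    "\<And>n. h n = fps_nth (series a) n" "\<And>n. h n \<noteq> 0 \<Longrightarrow> n \<in> degs"
    using finite_expansion[OF a] by blast
  have "n \<in> degs \<and> (p + q) * k \<le> n" if "h n \<noteq> 0" for n
    using that van[of n] h(2,3) by force
  thus ?thesis unfolding h(1) by (intro proj_poly_of_in_power) auto
qed

text \<open>Conversely, the generators \<open>x\<close> and \<open>y\<close> have positive order in \<open>t\<close>, so the \<open>k\<close>-th power of
  the maximal ideal has order at least \<open>k\<close>.\<close>

lemma power_vanishing: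
  assumes "a \<in> mpow k" "n < k"
  shows "fps_nth (series a) n = 0"
proof -
  have "ideal {a \<in> carrier A. fps_nth (series a) 0 = 0} A"
  proof (rule idealI[OF A.ring_axioms])
    show "subgroup {a \<in> carrier A. fps_nth (series a) 0 = 0} (add_monoid A)"
      by (rule A.add.subgroupI)
        (auto simp: series_add series_minus a_inv_def[symmetric] intro!: exI[of _ "\<zero>\<^bsub>A\<^esub>"])
  qed (auto simp: series_mult)
  hence "mm \<subseteq> {a \<in> carrier A. fps_nth (series a) 0 = 0}"
    unfolding curve_max_ideal_def
    by (rule A.genideal_minimal) (use p_pos q_pos in \<open>auto simp: curve_proj_simps param_pCons weighted_subst_eq\<close>)
  hence mm: "a \<in> carrier A" "fps_nth (series a) 0 = 0" if "a \<in> mm" for a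
    using that by auto
  show ?thesis using assms
  proof (induction k arbitrary: a n)
    case (Suc k)
    note IH = Suc.IH and n = Suc.prems(2)
    have carr: "mpow k \<subseteq> carrier A"
      using ideal.Icarr[OF ideal_power_mm] by blast
    have "a \<in> ideal_prod A (mpow k) mm" using Suc.prems(1) by simp
    hence "a \<in> carrier A \<and> fps_nth (series a) n = 0"
    proof (induction rule: ideal_prod.induct)
      case (prod b c)
      have bc: "b \<in> carrier A" "c \<in> carrier A" using prod carr mm by auto
      have "fps_nth (series b) i * fps_nth (series c) (n - i) = 0" if "i \<le> n" for i
        using IH[OF prod(1), of i] mm(2)[OF prod(2)] n that by (cases "i < k") auto
      thus ?case using bc by (auto simp: series_mult fps_mult_nth intro!: sum.neutral)
    next
      case (sum b c)
      thus ?case by (simp add: series_add)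
    qed
    thus ?case by simp
  qed simp
qed

definition comps :: "nat \<Rightarrow> 'k set" where
  "comps n = (if n \<in> degs then UNIV else {0})"

sublocale ring_limit: coset_coordinates A mpow "\<lambda>a. fps_nth (series a)" comps "\<lambda>k. (p + q) * k"
proof (intro coset_coordinates.intro coset_coordinates_axioms.intro)
  show "abelian_group A" by (rule A.abelian_group_axioms)
  show "subgroup (mpow k) (add_monoid A)" for k
    using ideal.axioms(1)[OF ideal_power_mm] by (rule additive_subgroup.a_subgroup)
  show "mpow (Suc k) \<subseteq> mpow k" for k by (rule power_antimono) simp
  show "fps_nth (series (a \<oplus>\<^bsub>A\<^esub> b)) n = fps_nth (series a) n + fps_nth (series b) n"
    if "a \<in> carrier A" "b \<in> carrier A" for a b n
    using that by (simp add: series_add)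
  show "fps_nth (series a) n \<in> comps n" if "a \<in> carrier A" for a n
    using series_supported[OF that] by (auto simp: comps_def supported_def)
  show "fps_nth (series a) n = 0" if "a \<in> mpow k" "n < k" for a n k
    using that by (rule power_vanishing)
  show "a \<in> mpow k" if "a \<in> carrier A" "\<And>n. n < (p + q) * k \<Longrightarrow> fps_nth (series a) n = 0" for a k
    using that by (rule vanishing_in_power)
  show "\<exists>a\<in>carrier A. \<forall>n<k. fps_nth (series a) n = h n" if "\<And>n. h n \<in> comps n" for h k
  proof (intro bexI allI impI)
    fix n assume "n < k"
    have "h n \<noteq> 0 \<Longrightarrow> n \<in> degs" for n using that[of n] by (auto simp: comps_def split: if_splits)
    thus "fps_nth (series (curve_proj f (poly_of h {..<k}))) n = h n"
      using \<open>n < k\<close> by (simp add: par_poly_of)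
  qed (rule curve_proj_simps)
  show "mono ((*) (p + q))" by (auto intro!: monoI)
  show "k \<le> (p + q) * k" for k using p_pos by simp
qed

abbreviation B :: "(nat \<Rightarrow> 'k poly poly set set) ring" where "B \<equiv> completed_curve_ring f"

definition expansion :: "(nat \<Rightarrow> 'k poly poly set set) \<Rightarrow> 'k fps" where
  "expansion \<phi> = Abs_fps (ring_limit.limit_coords \<phi>)"

lemma carrier_B: "carrier B = coset_limit A mpow"
  by (simp add: completed_curve_ring_def completion_ring_def)

lemma expansion_nth:
  assumes "\<phi> \<in> carrier B" "a \<in> \<phi> k" "n < k"
  shows "fps_nth (expansion \<phi>) n = fps_nth (series a) n"
  using ring_limit.limit_coords_eq[of \<phi> a k n] assms by (simp add: expansion_def carrier_B)

lemma expansion_bij: "bij_betw expansion (carrier B) (supported degs)"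
proof -
  have "bij_betw Abs_fps {h. \<forall>n. h n \<in> comps n} (supported degs)"
    by (rule bij_betw_byWitness[where f' = fps_nth])
      (auto simp: supported_def comps_def fps_eq_iff split: if_splits)
  from bij_betw_trans[OF ring_limit.limit_coords_bij this] show ?thesis
    unfolding carrier_B expansion_def[abs_def] comp_def .
qed

lemma limit_repr: "\<phi> \<in> carrier B \<Longrightarrow> \<exists>a\<in>carrier A. a \<in> \<phi> k"
  unfolding carrier_B using ring_limit.limit_nonempty ring_limit.limit_coset(1) by blast

text \<open>Sums and products of coherent sequences of cosets are coherent again because the
  completion is assumed to be a ring; it remains to compare representatives.\<close>

lemma expansion_add:
  assumes "cring B" "\<phi> \<in> carrier B" "\<psi> \<in> carrier B"
  shows "expansion (\<phi> \<oplus>\<^bsub>B\<^esub> \<psi>) = expansion \<phi> + expansion \<psi>"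
proof (rule fps_ext)
  fix n
  interpret B: cring B by fact
  obtain a where a: "a \<in> carrier A" "a \<in> \<phi> (Suc n)" using limit_repr assms by blast
  obtain b where b: "b \<in> carrier A" "b \<in> \<psi> (Suc n)" using limit_repr assms by blast
  have "a \<oplus>\<^bsub>A\<^esub> b \<in> (\<phi> \<oplus>\<^bsub>B\<^esub> \<psi>) (Suc n)"
    using a b by (auto simp: completed_curve_ring_def completion_ring_def FactRing_def set_add_def'
        simp del: ideal_power_Suc)
  from expansion_nth[OF B.a_closed[OF assms(2,3)] this, of n]
  show "fps_nth (expansion (\<phi> \<oplus>\<^bsub>B\<^esub> \<psi>)) n = fps_nth (expansion \<phi> + expansion \<psi>) n"
    using expansion_nth[OF assms(2) a(2)] expansion_nth[OF assms(3) b(2)] a b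
    by (simp add: series_add)
qed

lemma expansion_mult:
  assumes "cring B" "\<phi> \<in> carrier B" "\<psi> \<in> carrier B"
  shows "expansion (\<phi> \<otimes>\<^bsub>B\<^esub> \<psi>) = expansion \<phi> * expansion \<psi>"
proof (rule fps_ext)
  fix n
  interpret B: cring B by fact
  obtain a where a: "a \<in> carrier A" "a \<in> \<phi> (Suc n)" using limit_repr assms by blast
  obtain b where b: "b \<in> carrier A" "b \<in> \<psi> (Suc n)" using limit_repr assms by blast
  have "a \<otimes>\<^bsub>A\<^esub> b \<in> mpow (Suc n) +>\<^bsub>A\<^esub> (a \<otimes>\<^bsub>A\<^esub> b)"
    using a b by (intro ring_limit.coset_self) auto
  hence "a \<otimes>\<^bsub>A\<^esub> b \<in> (\<phi> \<otimes>\<^bsub>B\<^esub> \<psi>) (Suc n)"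
    using a b by (auto simp: completed_curve_ring_def completion_ring_def FactRing_def rcoset_mult_def
        simp del: ideal_power_Suc)
  from expansion_nth[OF B.m_closed[OF assms(2,3)] this, of n]
  have "fps_nth (expansion (\<phi> \<otimes>\<^bsub>B\<^esub> \<psi>)) n = fps_nth (series a * series b) n"
    using a b by (simp add: series_mult)
  also have "\<dots> = fps_nth (expansion \<phi> * expansion \<psi>) n"
    unfolding fps_mult_nth
    using expansion_nth[OF assms(2) a(2)] expansion_nth[OF assms(3) b(2)]
    by (intro sum.cong) auto
  finally show "fps_nth (expansion (\<phi> \<otimes>\<^bsub>B\<^esub> \<psi>)) n = fps_nth (expansion \<phi> * expansion \<psi>) n" .
qed

lemma scalar_in: "completed_curve_scalar f c \<in> carrier B"
  and expansion_scalar: "expansion (completed_curve_scalar f c) = fps_const c"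
proof -
  let ?a = "curve_proj f [:[:c:]:]"
  have mem: "?a \<in> completed_curve_scalar f c k" for k
    unfolding completed_curve_scalar_def to_completion_def
    by (intro ring_limit.coset_self) (simp add: curve_proj_simps)
  have "completed_curve_scalar f c (Suc k) \<subseteq> completed_curve_scalar f c k" for k
  proof
    fix x assume "x \<in> completed_curve_scalar f c (Suc k)"
    then obtain h where "h \<in> mpow (Suc k)" "x = h \<oplus>\<^bsub>A\<^esub> ?a"
      unfolding completed_curve_scalar_def to_completion_def ring_limit.coset_mem by blast
    moreover from this(1) have "h \<in> mpow k" using power_antimono[of k "Suc k"] by auto
    ultimately show "x \<in> completed_curve_scalar f c k"
      unfolding completed_curve_scalar_def to_completion_def ring_limit.coset_mem by blast
  qed
  thus in_B: "completed_curve_scalar f c \<in> carrier B"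
    by (auto simp: carrier_B coset_limit_def completed_curve_scalar_def to_completion_def
        A_RCOSETS_def' curve_proj_simps simp del: ideal_power_Suc)
  show "expansion (completed_curve_scalar f c) = fps_const c"
  proof (rule fps_ext)
    fix n
    show "fps_nth (expansion (completed_curve_scalar f c)) n = fps_nth (fps_const c) n"
      using expansion_nth[OF in_B mem, of n "Suc n"] by simp
  qed
qed

end


section \<open>Completions of graded torsion free modules\<close>

lemma poly_homogeneous_mult:
  assumes P: "P \<in> poly_homogeneous p q d" and Q: "Q \<in> poly_homogeneous p q e"
  shows "P * Q \<in> poly_homogeneous p q (d + e)"
  unfolding poly_homogeneous_def
proof (intro CollectI allI impI)
  fix i j assume "coeff (coeff (P * Q) j) i \<noteq> 0"
  hence "(\<Sum>b\<le>j. \<Sum>a\<le>i. coeff (coeff P b) a * coeff (coeff Q (j - b)) (i - a)) \<noteq> 0"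
    by (simp add: coeff_mult coeff_sum)
  then obtain b where b: "b \<le> j"
    "(\<Sum>a\<le>i. coeff (coeff P b) a * coeff (coeff Q (j - b)) (i - a)) \<noteq> 0"
    by (rule sum.not_neutral_contains_not_neutral) auto
  from b(2) obtain a where a: "a \<le> i" "coeff (coeff P b) a * coeff (coeff Q (j - b)) (i - a) \<noteq> 0"
    by (rule sum.not_neutral_contains_not_neutral) auto
  have nz: "coeff (coeff P b) a \<noteq> 0" "coeff (coeff Q (j - b)) (i - a) \<noteq> 0" using a(2) by auto
  have "int (p * a + q * b) = d" using P nz(1) unfolding poly_homogeneous_def by blast
  moreover have "int (p * (i - a) + q * (j - b)) = e"
    using Q nz(2) unfolding poly_homogeneous_def by blast
  moreover have "p * i + q * j = (p * a + q * b) + (p * (i - a) + q * (j - b))"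
  proof -
    have "p * i = p * a + p * (i - a)" "q * j = q * b + q * (j - b)"
      using a(1) b(1) by (simp_all flip: distrib_left)
    thus ?thesis by simp
  qed
  ultimately show "int (p * i + q * j) = d + e" by simp
qed

text \<open>In the singular case both parameters are nonzero, and the degrees form the semigroup \<open>S\<close>.\<close>

locale graded_curve_module = parametrized_curve f p q \<alpha> \<beta> + coprime_pair p q
  for f :: "'k::field_char_0 poly poly" and p q \<alpha> \<beta> +
  fixes M :: "('k poly poly set, 'm) module" (structure) and Mgr :: "int \<Rightarrow> 'm set"
  assumes \<alpha>_nz: "\<alpha> \<noteq> 0" and \<beta>_nz: "\<beta> \<noteq> 0"
    and graded: "graded_module (curve_ring f) (curve_grading p q f) M Mgr"
    and fin_gen: "finitely_generated (curve_ring f) M"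
    and tors_free: "torsion_free (curve_ring f) (homogeneous_nonzero_divisors p q f) M"
begin

lemma degs_eq: "degs = S"
  using \<alpha>_nz \<beta>_nz by (auto simp: param_degrees_def two_generated_def)

sublocale M: module A M
  using graded by (simp add: graded_module_def)

subsection \<open>Homogeneous elements of the coordinate ring\<close>

text \<open>The homogeneous element \<open>c t^e\<close> of the coordinate ring, or \<open>0\<close> when \<open>e\<close> is not in the
  semigroup. Integer exponents make differences of degrees in a graded module admissible.\<close>

definition hmon :: "'k \<Rightarrow> int \<Rightarrow> 'k poly poly set" where
  "hmon c e = (if 0 \<le> e \<and> nat e \<in> S then curve_proj f ([:[:c:]:] * mon (nat e)) else \<zero>\<^bsub>A\<^esub>)"

lemma hmon_in [simp]: "hmon c e \<in> carrier A"
  by (simp add: hmon_def curve_proj_simps)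

lemma series_hmon:
  "series (hmon c e) = (if 0 \<le> e \<and> nat e \<in> S then fps_const c * fps_X ^ nat e else 0)"
  by (simp add: hmon_def par_mon degs_eq del: mult_pCons_left)

lemma hmon_grading: "hmon c e \<in> curve_grading p q f e"
proof (cases "0 \<le> e \<and> nat e \<in> S")
  case True
  have "[:[:c:]:] \<in> poly_homogeneous p q 0"
    by (auto simp: poly_homogeneous_def coeff_pCons split: nat.splits if_splits)
  hence "[:[:c:]:] * mon (nat e) \<in> poly_homogeneous p q (0 + int (nat e))"
    using mon_homogeneous[of "nat e"] True degs_eq by (intro poly_homogeneous_mult) auto
  thus ?thesis using True by (simp add: hmon_def curve_grading_def del: mult_pCons_left)
next
  case False
  have "0 \<in> poly_homogeneous p q e" by (simp add: poly_homogeneous_def)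
  thus ?thesis using False by (auto simp: hmon_def curve_grading_def curve_zero)
qed

lemma hmon_add: "hmon (c + c') e = hmon c e \<oplus>\<^bsub>A\<^esub> hmon c' e"
  by (rule series_inj) (auto simp: series_add series_hmon algebra_simps simp flip: fps_const_add)

lemma hmon_zero [simp]: "hmon 0 e = \<zero>\<^bsub>A\<^esub>"
  by (rule series_inj) (auto simp: series_hmon)

lemma hmon_mult:
  assumes "s \<in> S" "0 \<le> e" "nat e \<in> S"
  shows "hmon c (int s) \<otimes>\<^bsub>A\<^esub> hmon c' e = hmon (c * c') (int s + e)"
proof (rule series_inj)
  have "nat (int s + e) = s + nat e" using assms by simp
  thus "series (hmon c (int s) \<otimes>\<^bsub>A\<^esub> hmon c' e) = series (hmon (c * c') (int s + e))"
    using assms two_generated_add[of s p q "nat e"]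
    by (simp add: series_mult series_hmon power_add mult_ac flip: fps_const_mult)
qed auto

lemma hmon_in_mpow:
  assumes "int ((p + q) * k) \<le> e"
  shows "hmon c e \<in> mpow k"
proof (rule vanishing_in_power)
  fix n assume "n < (p + q) * k"
  hence "int n < int ((p + q) * k)" by linarith
  hence "n < nat e" using assms by linarith
  thus "fps_nth (series (hmon c e)) n = 0" by (simp add: series_hmon fps_X_power_nth)
qed simp

lemma A_induct [consumes 1, case_names zero add]:
  assumes "a \<in> carrier A" and zero: "Q \<zero>\<^bsub>A\<^esub>"
    and add: "\<And>c s a. s \<in> S \<Longrightarrow> a \<in> carrier A \<Longrightarrow> Q a \<Longrightarrow> Q (hmon c (int s) \<oplus>\<^bsub>A\<^esub> a)"
  shows "Q a"
proof -
  obtain h n0 where h: "a = curve_proj f (poly_of h {..<n0})" "\<And>n. h n \<noteq> 0 \<Longrightarrow> n \<in> degs"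
    using finite_expansion[OF assms(1)] by blast
  have "Q (curve_proj f (\<Sum>n\<in>L. [:[:h n:]:] * mon n))" if "finite L" "L \<subseteq> S" for L
    using that
  proof (induction L rule: finite_induct)
    case empty
    show ?case using zero by (simp add: curve_zero)
  next
    case (insert n L)
    have "curve_proj f (\<Sum>n\<in>insert n L. [:[:h n:]:] * mon n) =
        hmon (h n) (int n) \<oplus>\<^bsub>A\<^esub> curve_proj f (\<Sum>n\<in>L. [:[:h n:]:] * mon n)"
      using insert by (simp add: hmon_def curve_proj_simps del: mult_pCons_left)
    thus ?case using add insert by (simp add: curve_proj_simps del: mult_pCons_left)
  qed
  note * = this
  show ?thesis unfolding h(1) poly_of_def by (rule *) (use h(2) degs_eq in auto)
qed

text \<open>The monomials \<open>t^s\<close> are homogeneous non-zero-divisors, so they act injectively.\<close>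

lemma monomial_cancel:
  assumes "s \<in> S" "m \<in> carrier M" "hmon 1 (int s) \<odot> m = \<zero>"
  shows "m = \<zero>"
proof (rule torsion_free_cancel[OF M.module_axioms tors_free _ _ _ _ assms(2,3)])
  let ?T = "homogeneous_nonzero_divisors p q f"
  note nzd = nonzero_divisors_closed[OF cring_curve[of f]]
  show "?T \<subseteq> carrier A" using nzd(1) by (auto simp: homogeneous_nonzero_divisors_def)
  have "\<one>\<^bsub>A\<^esub> \<in> curve_grading p q f 0"
    unfolding curve_proj_simps curve_grading_def
    by (rule imageI) (auto simp: poly_homogeneous_def coeff_1 split: if_splits)
  thus "\<one>\<^bsub>A\<^esub> \<in> ?T" using nzd(2) by (auto simp: homogeneous_nonzero_divisors_def)
  show "s \<otimes>\<^bsub>A\<^esub> t \<in> ?T" if st: "s \<in> ?T" "t \<in> ?T" for s t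
  proof -
    obtain d e P Q where "s = curve_proj f P" "t = curve_proj f Q"
      "P \<in> poly_homogeneous p q d" "Q \<in> poly_homogeneous p q e"
      using st by (auto simp: homogeneous_nonzero_divisors_def curve_grading_def)
    hence "s \<otimes>\<^bsub>A\<^esub> t \<in> curve_grading p q f (d + e)"
      using poly_homogeneous_mult[of P p q d Q e] by (simp add: curve_proj_simps curve_grading_def)
    thus ?thesis using st nzd(3)[of s t] by (auto simp: homogeneous_nonzero_divisors_def)
  qed
  have "b = \<zero>\<^bsub>A\<^esub>" if "b \<in> carrier A" "hmon 1 (int s) \<otimes>\<^bsub>A\<^esub> b = \<zero>\<^bsub>A\<^esub>" for b
  proof (rule series_inj)
    have "series (hmon 1 (int s)) * series b = series \<zero>\<^bsub>A\<^esub>"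
      using series_mult[OF hmon_in that(1)] that(2) by metis
    thus "series b = series \<zero>\<^bsub>A\<^esub>" using assms(1) by (simp add: series_hmon)
  qed (use that in auto)
  thus "hmon 1 (int s) \<in> ?T"
    using hmon_grading[of 1 "int s"]
    by (auto simp: homogeneous_nonzero_divisors_def nonzero_divisors_def intro!: exI[of _ "int s"])
qed

subsection \<open>Homogeneous components\<close>

lemma Mgr_subgroup: "subgroup (Mgr d) (add_monoid M)"
  and Mgr_smult: "a \<in> curve_grading p q f d \<Longrightarrow> m \<in> Mgr e \<Longrightarrow> a \<odot> m \<in> Mgr (d + e)"
  using graded by (auto simp: graded_module_def)

lemma Mgr_carrier: "m \<in> Mgr d \<Longrightarrow> m \<in> carrier M"
  using subgroup.mem_carrier[OF Mgr_subgroup] by simp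

lemma Mgr_zero [simp]: "\<zero> \<in> Mgr d"
  using subgroup.one_closed[OF Mgr_subgroup[of d]] by simp

lemma Mgr_add: "m \<in> Mgr d \<Longrightarrow> m' \<in> Mgr d \<Longrightarrow> m \<oplus> m' \<in> Mgr d"
  using subgroup.m_closed[OF Mgr_subgroup[of d]] by simp

definition is_decomp :: "'m \<Rightarrow> (int \<Rightarrow> 'm) \<Rightarrow> bool" where
  "is_decomp m c \<longleftrightarrow> (\<forall>d. c d \<in> Mgr d) \<and> finite {d. c d \<noteq> \<zero>} \<and>
     m = (\<Oplus>d\<in>{d. c d \<noteq> \<zero>}. c d)"

definition component :: "'m \<Rightarrow> int \<Rightarrow> 'm" where
  "component m = (THE c. is_decomp m c)"

lemma decomp_unique: "m \<in> carrier M \<Longrightarrow> \<exists>!c. is_decomp m c"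
  using graded unfolding graded_module_def is_decomp_def by blast

lemma component: "m \<in> carrier M \<Longrightarrow> is_decomp m (component m)"
  unfolding component_def by (rule theI'[OF decomp_unique])

lemma component_in: "m \<in> carrier M \<Longrightarrow> component m d \<in> Mgr d"
  and component_finite: "m \<in> carrier M \<Longrightarrow> finite {d. component m d \<noteq> \<zero>}"
  using component by (auto simp: is_decomp_def)

lemma component_carrier: "m \<in> carrier M \<Longrightarrow> component m d \<in> carrier M"
  using component_in Mgr_carrier by blast

lemma finsum_superset:
  assumes "finite D" "{d. c d \<noteq> \<zero>} \<subseteq> D" "\<And>d. c d \<in> carrier M"
  shows "(\<Oplus>d\<in>D. c d) = (\<Oplus>d\<in>{d. c d \<noteq> \<zero>}. c d)"
  by (rule M.M.add.finprod_mono_neutral_cong_right) (use assms in auto)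

lemma component_sum:
  assumes "m \<in> carrier M" "finite D" "{d. component m d \<noteq> \<zero>} \<subseteq> D"
  shows "m = (\<Oplus>d\<in>D. component m d)"
  using component[OF assms(1)] finsum_superset[OF assms(2,3) component_carrier[OF assms(1)]]
  by (simp add: is_decomp_def)

lemma component_eqI:
  assumes "finite D" "\<And>d. c d \<in> Mgr d" "\<And>d. d \<notin> D \<Longrightarrow> c d = \<zero>" "m = (\<Oplus>d\<in>D. c d)"
  shows "component m = c"
proof -
  have cM: "c d \<in> carrier M" for d using assms(2) Mgr_carrier by blast
  have sub: "{d. c d \<noteq> \<zero>} \<subseteq> D" using assms(3) by blast
  have "is_decomp m c"
    using assms(1,2,4) sub finite_subset[OF sub] finsum_superset[OF assms(1) sub cM]
    by (simp add: is_decomp_def)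
  moreover have "m \<in> carrier M" unfolding assms(4) using cM by (intro M.M.finsum_closed) auto
  ultimately show ?thesis unfolding component_def using decomp_unique by (intro the1_equality)
qed

lemma component_homogeneous:
  assumes "m \<in> Mgr d"
  shows "component m = (\<lambda>e. if e = d then m else \<zero>)"
  using assms Mgr_carrier[OF assms]
  by (intro component_eqI[of "{d}"]) auto

lemma component_add:
  assumes "m \<in> carrier M" "m' \<in> carrier M"
  shows "component (m \<oplus> m') = (\<lambda>d. component m d \<oplus> component m' d)"
proof (rule component_eqI)
  let ?D = "{d. component m d \<noteq> \<zero>} \<union> {d. component m' d \<noteq> \<zero>}"
  show fin: "finite ?D" using component_finite assms by simp
  show "component m d \<oplus> component m' d \<in> Mgr d" for d using component_in assms by (intro Mgr_add)
  show "component m d \<oplus> component m' d = \<zero>" if "d \<notin> ?D" for d using that by simp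
  have "(\<Oplus>d\<in>?D. component m d \<oplus> component m' d) = (\<Oplus>d\<in>?D. component m d) \<oplus> (\<Oplus>d\<in>?D. component m' d)"
    using component_carrier assms by (intro M.M.finsum_addf) auto
  also have "\<dots> = m \<oplus> m'"
    using component_sum[OF assms(1) fin] component_sum[OF assms(2) fin] by auto
  finally show "m \<oplus> m' = (\<Oplus>d\<in>?D. component m d \<oplus> component m' d)" by simp
qed

lemma component_hmon:
  assumes "m \<in> carrier M"
  shows "component (hmon c s \<odot> m) = (\<lambda>d. hmon c s \<odot> component m (d - s))"
proof (rule component_eqI)
  let ?D = "{d. component m d \<noteq> \<zero>}"
  have fin: "finite ?D" using component_finite assms by simp
  thus "finite ((\<lambda>d. d + s) ` ?D)" by simp
  show "hmon c s \<odot> component m (d - s) \<in> Mgr d" for d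
    using Mgr_smult[OF hmon_grading component_in[OF assms], of c s "d - s"] by simp
  show "hmon c s \<odot> component m (d - s) = \<zero>" if "d \<notin> (\<lambda>d. d + s) ` ?D" for d
  proof -
    have "component m (d - s) = \<zero>" using that by (metis (mono_tags) diff_add_cancel imageI mem_Collect_eq)
    thus ?thesis by simp
  qed
  have "hmon c s \<odot> m = hmon c s \<odot> (\<Oplus>d\<in>?D. component m d)"
    using component_sum[OF assms fin] by simp
  also have "\<dots> = (\<Oplus>d\<in>?D. hmon c s \<odot> component m d)"
    using component_carrier assms by (intro M.finsum_smult_ldistr[OF fin]) auto
  also have "\<dots> = (\<Oplus>d\<in>(\<lambda>d. d + s) ` ?D. hmon c s \<odot> component m (d - s))"
    using component_carrier assms by (subst M.M.finsum_reindex) (auto simp: inj_on_def)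
  finally show "hmon c s \<odot> m = (\<Oplus>d\<in>(\<lambda>d. d + s) ` ?D. hmon c s \<odot> component m (d - s))" .
qed

end


context graded_curve_module
begin

subsection \<open>The homogeneous components as subspaces of one vector space\<close>

lemma finsum_in_subgroup:
  assumes "subgroup H (add_monoid M)" "finite I" "\<And>i. i \<in> I \<Longrightarrow> x i \<in> H"
  shows "(\<Oplus>i\<in>I. x i) \<in> H"
  using assms(2,3)
proof (induction I rule: finite_induct)
  case empty
  thus ?case using subgroup.one_closed[OF assms(1)] by simp
next
  case (insert i I)
  have "x j \<in> carrier M" if "j \<in> insert i I" for j
    using subgroup.mem_carrier[OF assms(1) insert(4)[OF that]] by simp
  hence "(\<Oplus>i\<in>insert i I. x i) = x i \<oplus> (\<Oplus>i\<in>I. x i)"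
    using insert by (intro M.M.finsum_insert) auto
  thus ?case using insert subgroup.m_closed[OF assms(1)] by simp
qed

definition gens :: "'m set" where
  "gens = (SOME G. finite G \<and> G \<subseteq> carrier M \<and>
     (\<forall>m\<in>carrier M. \<exists>c\<in>G \<rightarrow> carrier A. m = (\<Oplus>g\<in>G. c g \<odot> g)))"

lemma gens: "finite gens" "gens \<subseteq> carrier M"
  "m \<in> carrier M \<Longrightarrow> \<exists>c\<in>gens \<rightarrow> carrier A. m = (\<Oplus>g\<in>gens. c g \<odot> g)"
  using someI_ex[OF fin_gen[unfolded finitely_generated_def]] unfolding gens_def by blast+

text \<open>The index of a homogeneous generator is a generator together with one of its degrees.\<close>

definition idx :: "('m \<times> int) set" where
  "idx = (SIGMA g:gens. {d. component g d \<noteq> \<zero>})"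

definition el :: "'m \<times> int \<Rightarrow> 'm" where
  "el i = component (fst i) (snd i)"

lemma finite_idx: "finite idx"
  unfolding idx_def using gens component_finite by (intro finite_SigmaI) auto

lemma el_in: "i \<in> idx \<Longrightarrow> el i \<in> Mgr (snd i)"
  using gens component_in by (auto simp: idx_def el_def)

lemma el_carrier: "i \<in> idx \<Longrightarrow> el i \<in> carrier M"
  using el_in Mgr_carrier by blast

text \<open>Coefficient vectors of the homogeneous elements of degree \<open>n\<close>: the generator with index \<open>i\<close>
  contributes multiples of \<open>t^(n - deg i)\<close>, for which \<open>n - deg i\<close> must lie in the semigroup.\<close>

definition cspace :: "int \<Rightarrow> ('m \<times> int \<Rightarrow> 'k) set" where
  "cspace n = {c. \<forall>i. c i \<noteq> 0 \<longrightarrow> i \<in> idx \<and> 0 \<le> n - snd i \<and> nat (n - snd i) \<in> S}"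

lemma cspaceD:
  assumes "c \<in> cspace n" "c i \<noteq> 0"
  shows "i \<in> idx" "0 \<le> n - snd i" "nat (n - snd i) \<in> S"
  using assms unfolding cspace_def by blast+

lemma cspace_shift:
  assumes c: "c \<in> cspace n" and s: "s \<in> S"
  shows "c \<in> cspace (n + int s)"
  unfolding cspace_def
proof (intro CollectI allI impI)
  fix i assume "c i \<noteq> 0"
  note i = cspaceD[OF c this]
  have "nat (n + int s - snd i) = nat (n - snd i) + s" using i(2) by simp
  thus "i \<in> idx \<and> 0 \<le> n + int s - snd i \<and> nat (n + int s - snd i) \<in> S"
    using i two_generated_add[OF i(3) s] by auto
qed

definition combo :: "int \<Rightarrow> ('m \<times> int \<Rightarrow> 'k) \<Rightarrow> 'm" where
  "combo n c = (\<Oplus>i\<in>idx. hmon (c i) (n - snd i) \<odot> el i)"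

definition sc :: "'k \<Rightarrow> ('m \<times> int \<Rightarrow> 'k) \<Rightarrow> 'm \<times> int \<Rightarrow> 'k" where
  "sc a c = (\<lambda>i. a * c i)"

lemma vector_space_sc: "vector_space sc"
  by unfold_locales (auto simp: sc_def fun_eq_iff algebra_simps)

interpretation V: vector_space sc by (rule vector_space_sc)

lemma cspace_subspace: "V.subspace (cspace n)"
  by (rule V.subspaceI) (auto simp: cspace_def sc_def, (metis add.right_neutral)+)

lemma combo_in: "combo n c \<in> Mgr n"
  unfolding combo_def
proof (rule finsum_in_subgroup[OF Mgr_subgroup finite_idx])
  fix i assume "i \<in> idx"
  thus "hmon (c i) (n - snd i) \<odot> el i \<in> Mgr n"
    using Mgr_smult[OF hmon_grading el_in, of i "c i" "n - snd i"] by simp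
qed

lemma combo_carrier: "combo n c \<in> carrier M"
  using combo_in Mgr_carrier by blast

lemma combo_zero: "combo n 0 = \<zero>"
  unfolding combo_def by (rule M.M.add.finprod_one_eqI) (use el_carrier in auto)

lemma combo_add: "combo n (c + c') = combo n c \<oplus> combo n c'"
proof -
  have "combo n (c + c') = (\<Oplus>i\<in>idx. hmon (c i) (n - snd i) \<odot> el i \<oplus> hmon (c' i) (n - snd i) \<odot> el i)"
    unfolding combo_def
    by (rule M.M.finsum_cong') (use el_carrier in \<open>auto simp: hmon_add M.smult_l_distr\<close>)
  also have "\<dots> = combo n c \<oplus> combo n c'"
    unfolding combo_def by (rule M.M.finsum_addf) (use el_carrier in auto)
  finally show ?thesis .
qed

lemma hmon_combo:
  assumes c: "c \<in> cspace n" and s: "s \<in> S"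
  shows "hmon a (int s) \<odot> combo n c = combo (n + int s) (sc a c)"
proof -
  have "hmon a (int s) \<odot> combo n c =
      (\<Oplus>i\<in>idx. hmon a (int s) \<odot> (hmon (c i) (n - snd i) \<odot> el i))"
    unfolding combo_def using el_carrier by (intro M.finsum_smult_ldistr[OF finite_idx]) auto
  also have "\<dots> = combo (n + int s) (sc a c)"
    unfolding combo_def
  proof (rule M.M.finsum_cong')
    fix i assume i: "i \<in> idx"
    show "hmon a (int s) \<odot> (hmon (c i) (n - snd i) \<odot> el i) =
        hmon (sc a c i) (n + int s - snd i) \<odot> el i"
    proof (cases "c i = 0")
      case True
      thus ?thesis using el_carrier[OF i] by (simp add: sc_def)
    next
      case False
      hence "0 \<le> n - snd i" "nat (n - snd i) \<in> S" using cspaceD[OF c] by auto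
      from hmon_mult[OF s this, of a "c i"] show ?thesis
        using el_carrier[OF i] by (simp add: sc_def algebra_simps flip: M.smult_assoc1)
    qed
  qed (use el_carrier in auto)
  finally show ?thesis .
qed

text \<open>Homogeneous components of a product of a ring element and a generator are again combinations
  of generators of the right degree; linearity reduces this to monomials.\<close>

lemma combo_surj:
  assumes "m \<in> carrier M"
  shows "\<exists>c\<in>cspace n. component m n = combo n c"
proof -
  define Q where "Q = (\<lambda>m. \<forall>n. \<exists>c\<in>cspace n. component m n = combo n c)"
  have Q_zero: "Q \<zero>"
    unfolding Q_def using V.subspace_0[OF cspace_subspace] combo_zero component_homogeneous[OF Mgr_zero]
    by (metis (full_types))
  have Q_add: "Q (m \<oplus> m')" if m: "m \<in> carrier M" "m' \<in> carrier M" "Q m" "Q m'" for m m'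
    unfolding Q_def
  proof
    fix n
    obtain c c' where c: "c \<in> cspace n" "component m n = combo n c"
      "c' \<in> cspace n" "component m' n = combo n c'"
      using m unfolding Q_def by blast
    thus "\<exists>c\<in>cspace n. component (m \<oplus> m') n = combo n c"
      using V.subspace_add[OF cspace_subspace c(1,3)]
      by (intro bexI[of _ "c + c'"]) (auto simp: component_add m combo_add)
  qed
  have Q_hmon: "Q (hmon c (int s) \<odot> g)" if g: "g \<in> gens" and s: "s \<in> S" for c s g
    unfolding Q_def
  proof
    fix n
    have gM: "g \<in> carrier M" using g gens by auto
    have cg: "component (hmon c (int s) \<odot> g) n = hmon c (int s) \<odot> component g (n - int s)"
      using component_hmon[OF gM] by simp
    let ?i = "(g, n - int s)"
    show "\<exists>c'\<in>cspace n. component (hmon c (int s) \<odot> g) n = combo n c'"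
    proof (cases "?i \<in> idx")
      case False
      hence "component g (n - int s) = \<zero>" using g by (simp add: idx_def)
      thus ?thesis using V.subspace_0[OF cspace_subspace] combo_zero cg by (intro bexI[of _ 0]) auto
    next
      case True
      define c' where "c' = (\<lambda>i. if i = ?i then c else 0)"
      have "combo n c' = (\<Oplus>i\<in>idx. if ?i = i then hmon c (int s) \<odot> el i else \<zero>)"
        unfolding combo_def by (rule M.M.finsum_cong') (use el_carrier in \<open>auto simp: c'_def\<close>)
      also have "\<dots> = hmon c (int s) \<odot> el ?i"
        by (rule M.M.add.finprod_singleton[OF True finite_idx]) (use el_carrier in auto)
      finally have "component (hmon c (int s) \<odot> g) n = combo n c'" using cg by (simp add: el_def)
      moreover have "c' \<in> cspace n" using True s by (auto simp: cspace_def c'_def)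
      ultimately show ?thesis by blast
    qed
  qed
  have Q_smult: "Q (a \<odot> g)" if a: "a \<in> carrier A" and g: "g \<in> gens" for a g
    using a
  proof (induction rule: A_induct)
    case zero
    thus ?case using Q_zero gens g by auto
  next
    case (add c s a)
    have gM: "g \<in> carrier M" using g gens by auto
    thus ?case using add Q_add[OF _ _ Q_hmon[OF g add(1)] add(3), of c] by (simp add: M.smult_l_distr)
  qed
  obtain c where c: "c \<in> gens \<rightarrow> carrier A" "m = (\<Oplus>g\<in>gens. c g \<odot> g)"
    using gens(3)[OF assms] by blast
  have "Q (\<Oplus>g\<in>G. c g \<odot> g) \<and> (\<Oplus>g\<in>G. c g \<odot> g) \<in> carrier M" if "finite G" "G \<subseteq> gens" for G
    using that
  proof (induction G rule: finite_induct)
    case (insert g G)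
    have cg: "c h \<odot> h \<in> carrier M" if "h \<in> gens" for h using that c(1) gens(2) by auto
    have "(\<Oplus>g\<in>insert g G. c g \<odot> g) = c g \<odot> g \<oplus> (\<Oplus>g\<in>G. c g \<odot> g)"
      using insert cg by (intro M.M.finsum_insert) auto
    moreover have "Q (c g \<odot> g)" using insert c(1) by (intro Q_smult) auto
    ultimately show ?case using insert cg Q_add by auto
  qed (simp add: Q_zero)
  from this[of gens] show ?thesis using gens c by (simp add: Q_def)
qed

text \<open>In degree \<open>topdeg\<close> and above every generator contributes, so linear relations among the
  generators no longer depend on the degree; torsion freeness carries them to all degrees.\<close>

lemma finite_int_bound:
  assumes "finite I"
  shows "\<exists>n::int. \<forall>i\<in>I. g i \<le> n"
  by (rule exI[of _ "Max (insert 0 (g ` I))"]) (use assms in auto)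

definition topdeg :: int where
  "topdeg = (SOME n. \<forall>i\<in>idx. snd i + int F + 1 \<le> n)"

lemma topdeg: "i \<in> idx \<Longrightarrow> snd i + int F + 1 \<le> topdeg"
  using someI_ex[OF finite_int_bound[OF finite_idx, of "\<lambda>i. snd i + int F + 1"]]
  by (auto simp: topdeg_def)

lemma cspace_topdeg:
  assumes "c \<in> cspace n" "topdeg \<le> N"
  shows "c \<in> cspace N"
  unfolding cspace_def
proof (intro CollectI allI impI)
  fix i assume "c i \<noteq> 0"
  hence i: "i \<in> idx" by (rule cspaceD[OF assms(1)])
  have "F < nat (N - snd i)" using topdeg[OF i] assms(2) by linarith
  thus "i \<in> idx \<and> 0 \<le> N - snd i \<and> nat (N - snd i) \<in> S" using i above_F_in_S by auto
qed

lemma combo_zero_shift: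
  assumes "c \<in> cspace n" "s \<in> S"
  shows "combo (n + int s) c = \<zero> \<longleftrightarrow> combo n c = \<zero>"
proof -
  have "sc 1 c = c" by (simp add: sc_def)
  hence "hmon 1 (int s) \<odot> combo n c = combo (n + int s) c" using hmon_combo[OF assms, of 1] by simp
  thus ?thesis using monomial_cancel[OF assms(2) combo_carrier, of n c] by auto
qed

lemma combo_zero_iff:
  assumes "c \<in> cspace n"
  shows "combo n c = \<zero> \<longleftrightarrow> combo topdeg c = \<zero>"
proof -
  define N where "N = max n topdeg + int F + 1"
  have "F < nat (N - n)" "F < nat (N - topdeg)" by (auto simp: N_def)
  hence "nat (N - n) \<in> S" "nat (N - topdeg) \<in> S" by (auto intro: above_F_in_S)
  moreover have "N = n + int (nat (N - n))" "N = topdeg + int (nat (N - topdeg))" by (auto simp: N_def)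
  ultimately show ?thesis
    using combo_zero_shift[OF assms, of "nat (N - n)"]
      combo_zero_shift[OF cspace_topdeg[OF assms order_refl], of "nat (N - topdeg)"] by simp
qed

definition relations :: "('m \<times> int \<Rightarrow> 'k) set" where
  "relations = {c \<in> cspace topdeg. combo topdeg c = \<zero>}"

lemma relations_subspace: "V.subspace relations"
proof (rule V.subspaceI)
  show "0 \<in> relations"
    using V.subspace_0[OF cspace_subspace] combo_zero by (simp add: relations_def)
  show "c + c' \<in> relations" if "c \<in> relations" "c' \<in> relations" for c c'
    using that V.subspace_add[OF cspace_subspace] by (auto simp: relations_def combo_add)
  show "sc a c \<in> relations" if "c \<in> relations" for a c
    using that V.subspace_scale[OF cspace_subspace] hmon_combo[of c topdeg 0 a]
    by (auto simp: relations_def)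
qed

text \<open>All relations are divided out at once: \<open>red\<close> chooses representatives of coefficient vectors
  modulo \<open>relations\<close>, so that every homogeneous component of the module embeds into one fixed vector
  space in such a way that multiplication by \<open>t^s\<close> becomes an inclusion.\<close>

definition red :: "('m \<times> int \<Rightarrow> 'k) \<Rightarrow> ('m \<times> int \<Rightarrow> 'k)" where
  "red = (SOME r. Vector_Spaces.linear sc sc r \<and> (\<forall>c. r c = 0 \<longleftrightarrow> c \<in> relations))"

lemma red: "Vector_Spaces.linear sc sc red" "red c = 0 \<longleftrightarrow> c \<in> relations"
proof -
  obtain r where r: "Vector_Spaces.linear sc sc r" "\<And>c. c \<in> relations \<Longrightarrow> r c = 0"
    "\<And>c. c - r c \<in> relations"
    by (rule V.projection_along[OF relations_subspace V.subspace_UNIV]) auto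
  have "r c = 0 \<longleftrightarrow> c \<in> relations" for c using r(2)[of c] r(3)[of c] by auto
  hence "\<exists>r. Vector_Spaces.linear sc sc r \<and> (\<forall>c. r c = 0 \<longleftrightarrow> c \<in> relations)" using r(1) by blast
  from someI_ex[OF this] show "Vector_Spaces.linear sc sc red" "red c = 0 \<longleftrightarrow> c \<in> relations"
    by (auto simp: red_def)
qed

interpretation red: Vector_Spaces.linear sc sc red by (rule red)

lemma red_eq:
  assumes "c \<in> cspace n" "c' \<in> cspace n" "combo n c = combo n c'"
  shows "red c = red c'"
proof -
  have d: "c - c' \<in> cspace n" using V.subspace_diff[OF cspace_subspace assms(1,2)] .
  have "combo n (c - c') \<oplus> combo n c' = combo n c" using combo_add[of n "c - c'" c'] by simp
  hence "combo n (c - c') = \<zero>"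
    unfolding assms(3) using combo_carrier by (metis M.M.add.r_cancel_one')
  hence "c - c' \<in> relations"
    using combo_zero_iff[OF d] cspace_topdeg[OF d order_refl] by (simp add: relations_def)
  thus ?thesis using red(2)[of "c - c'"] by (simp add: red.diff)
qed

lemma red_zero_imp:
  assumes "c \<in> cspace n" "red c = 0"
  shows "combo n c = \<zero>"
  using assms combo_zero_iff[OF assms(1)] red(2) by (simp add: relations_def)

text \<open>The shift by \<open>low\<close> makes all degrees of generators nonnegative, so that homogeneous
  components can be indexed by natural numbers.\<close>

definition low :: int where
  "low = (SOME l. \<forall>i\<in>idx. - snd i \<le> l)"

definition width :: nat where
  "width = nat (SOME w. \<forall>i\<in>idx. snd i + low \<le> w)"

lemma low: "i \<in> idx \<Longrightarrow> 0 \<le> snd i + low"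
  using someI_ex[OF finite_int_bound[OF finite_idx, of "\<lambda>i. - snd i"]]
  by (force simp: low_def)

lemma width: "i \<in> idx \<Longrightarrow> snd i + low \<le> int width"
  using someI_ex[OF finite_int_bound[OF finite_idx, of "\<lambda>i. snd i + low"]]
  by (force simp: width_def)

definition piece :: "nat \<Rightarrow> ('m \<times> int \<Rightarrow> 'k) set" where
  "piece k = red ` cspace (int k - low)"

lemma component_low:
  assumes "m \<in> carrier M" "d + low < 0"
  shows "component m d = \<zero>"
proof -
  obtain c where c: "c \<in> cspace d" "component m d = combo d c" using combo_surj assms by blast
  have "c i = 0" for i
  proof (rule ccontr)
    assume "c i \<noteq> 0"
    thus False using cspaceD[OF c(1), of i] low[of i] assms(2) by linarith
  qed
  hence "c = 0" by auto
  thus ?thesis using c combo_zero by simp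
qed

text \<open>The homogeneous component of degree \<open>k - low\<close>, seen in the common vector space.\<close>

definition coordm :: "'m \<Rightarrow> nat \<Rightarrow> 'm \<times> int \<Rightarrow> 'k" where
  "coordm m k = red (SOME c. c \<in> cspace (int k - low) \<and> component m (int k - low) = combo (int k - low) c)"

lemma coordm_ex:
  assumes "m \<in> carrier M"
  obtains c where "c \<in> cspace (int k - low)" "component m (int k - low) = combo (int k - low) c"
    "coordm m k = red c"
  using someI_ex[OF combo_surj[OF assms, of "int k - low", unfolded Bex_def]]
  unfolding coordm_def by blast

lemma coordm_eq:
  assumes "m \<in> carrier M" "c \<in> cspace (int k - low)" "component m (int k - low) = combo (int k - low) c"
  shows "coordm m k = red c"
proof -
  obtain c' where "c' \<in> cspace (int k - low)" "component m (int k - low) = combo (int k - low) c'"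
    "coordm m k = red c'" using assms(1) by (rule coordm_ex)
  thus ?thesis using red_eq[OF assms(2), of c'] assms(3) by simp
qed

lemma coordm_add:
  assumes "m \<in> carrier M" "m' \<in> carrier M"
  shows "coordm (m \<oplus> m') k = coordm m k + coordm m' k"
proof -
  obtain c where c: "c \<in> cspace (int k - low)" "component m (int k - low) = combo (int k - low) c"
    "coordm m k = red c" using assms(1) by (rule coordm_ex)
  obtain c' where c': "c' \<in> cspace (int k - low)" "component m' (int k - low) = combo (int k - low) c'"
    "coordm m' k = red c'" using assms(2) by (rule coordm_ex)
  have "coordm (m \<oplus> m') k = red (c + c')"
    using assms c c' V.subspace_add[OF cspace_subspace c(1) c'(1)]
    by (intro coordm_eq) (auto simp: component_add combo_add)
  thus ?thesis using c(3) c'(3) by (simp add: red.add)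
qed

lemma coordm_zero: "coordm \<zero> k = 0"
  using coordm_add[of "\<zero>" "\<zero>" k] by simp

sublocale filt: semigroup_filtration p q sc piece
proof (intro semigroup_filtration.intro semigroup_filtration_axioms.intro)
  show "coprime_pair p q" by (rule coprime_pair_axioms)
  show "vector_space sc" by (rule vector_space_sc)
  show "V.subspace (piece n)" for n
    unfolding piece_def by (rule red.subspace_image[OF cspace_subspace])
  show "piece n \<subseteq> piece (n + s)" if s: "s \<in> S" for s n
  proof -
    have "int (n + s) - low = int n - low + int s" by simp
    hence "cspace (int n - low) \<subseteq> cspace (int (n + s) - low)"
      using cspace_shift[OF _ s] by (simp only: subsetI)
    thus ?thesis by (auto simp: piece_def)
  qed
qed

lemma coordm_smult:
  assumes "a \<in> carrier A" "m \<in> carrier M"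
  shows "coordm (a \<odot> m) = filt.conv (series a) (coordm m)"
  using assms(1)
proof (induction rule: A_induct)
  case zero
  show ?case by (rule ext) (use assms(2) in \<open>simp add: coordm_zero filt.conv_def\<close>)
next
  case (add c s a)
  have "coordm (hmon c (int s) \<odot> m) = filt.conv (series (hmon c (int s))) (coordm m)"
  proof
    fix k
    have R: "filt.conv (series (hmon c (int s))) (coordm m) k =
        (if s \<le> k then sc c (coordm m (k - s)) else 0)"
    proof -
      have "filt.conv (series (hmon c (int s))) (coordm m) k =
          (\<Sum>i=0..k. if i = s then sc c (coordm m (k - s)) else 0)"
        unfolding filt.conv_def
        by (rule sum.cong) (auto simp: series_hmon add(1) fps_X_power_nth sc_def fun_eq_iff)
      thus ?thesis by simp
    qed
    have comp: "component (hmon c (int s) \<odot> m) (int k - low) =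
        hmon c (int s) \<odot> component m (int k - low - int s)"
      using component_hmon[OF assms(2)] by simp
    show "coordm (hmon c (int s) \<odot> m) k = filt.conv (series (hmon c (int s))) (coordm m) k"
    proof (cases "s \<le> k")
      case True
      have idx: "int (k - s) - low = int k - low - int s" using True by simp
      obtain c' where c': "c' \<in> cspace (int (k - s) - low)"
        "component m (int (k - s) - low) = combo (int (k - s) - low) c'" "coordm m (k - s) = red c'"
        using assms(2) by (rule coordm_ex)
      have "int (k - s) - low + int s = int k - low" using True by simp
      hence "hmon c (int s) \<odot> combo (int (k - s) - low) c' = combo (int k - low) (sc c c')"
        using hmon_combo[OF c'(1) add(1), of c] by metis
      hence "component (hmon c (int s) \<odot> m) (int k - low) = combo (int k - low) (sc c c')"
        unfolding comp idx[symmetric] c'(2) .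
      moreover have "sc c c' \<in> cspace (int k - low)"
        using cspace_shift[OF V.subspace_scale[OF cspace_subspace c'(1)] add(1), of c]
          \<open>int (k - s) - low + int s = int k - low\<close> by metis
      ultimately have "coordm (hmon c (int s) \<odot> m) k = red (sc c c')"
        using assms(2) by (intro coordm_eq) auto
      thus ?thesis using R True c'(3) by (simp add: red.scale)
    next
      case False
      hence "component (hmon c (int s) \<odot> m) (int k - low) = \<zero>"
        unfolding comp using component_low[OF assms(2)] by simp
      hence "coordm (hmon c (int s) \<odot> m) k = red 0"
        using assms(2) combo_zero V.subspace_0[OF cspace_subspace] by (intro coordm_eq) auto
      thus ?thesis using R False by simp
    qed
  qed
  thus ?case
    using add assms(2)
    by (simp add: M.smult_l_distr coordm_add series_add filt.conv_add_left fun_eq_iff)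
qed

end


context graded_curve_module
begin

subsection \<open>The completed module\<close>

lemma mpow_carrier: "a \<in> mpow k \<Longrightarrow> a \<in> carrier A"
  using ideal.Icarr[OF ideal_power_mm] .

abbreviation submod :: "nat \<Rightarrow> 'm set" where
  "submod k \<equiv> ideal_smult (mpow k) M"

lemma submod_subgroup: "subgroup (submod k) (add_monoid M)"
  unfolding ideal_smult_def by (rule M.M.add.generate_is_subgroup) (auto dest: mpow_carrier)

lemma submod_zero: "\<zero> \<in> submod k"
  using subgroup.one_closed[OF submod_subgroup] by simp

lemma smult_in_submod: "a \<in> mpow k \<Longrightarrow> m \<in> carrier M \<Longrightarrow> a \<odot> m \<in> submod k"
  unfolding ideal_smult_def by (rule generate.incl) blast

lemma coordm_minus:
  assumes "m \<in> carrier M"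
  shows "coordm (\<ominus> m) k = - coordm m k"
proof -
  have "coordm (\<ominus> m \<oplus> m) k = coordm (\<ominus> m) k + coordm m k"
    using assms by (intro coordm_add) auto
  thus ?thesis using assms by (simp add: M.M.l_neg coordm_zero eq_neg_iff_add_eq_0)
qed

lemma submod_vanishing:
  assumes "m \<in> submod k" "n < k"
  shows "coordm m n = 0"
proof -
  have gen: "coordm (a \<odot> m) n = 0" if "a \<in> mpow k" "m \<in> carrier M" for a m
  proof -
    have "fps_nth (series a) i = 0" if "i \<le> n" for i
      using power_vanishing[OF \<open>a \<in> mpow k\<close>, of i] that assms(2) by simp
    thus ?thesis using that mpow_carrier[OF that(1)]
      by (auto simp: coordm_smult filt.conv_def intro!: sum.neutral)
  qed
  let ?G = "{a \<odot> m |a m. a \<in> mpow k \<and> m \<in> carrier M}"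
  have "m \<in> carrier M \<and> coordm m n = 0" if "m \<in> generate (add_monoid M) ?G" for m
    using that
  proof (induction rule: generate.induct)
    case (incl h)
    thus ?case using gen mpow_carrier by auto
  next
    case (inv h)
    hence h: "h \<in> carrier M" "coordm h n = 0" using gen mpow_carrier by auto
    thus ?case using coordm_minus[OF h(1)] by (simp flip: a_inv_def)
  qed (auto simp: coordm_zero coordm_add)
  thus ?thesis using assms(1) by (simp add: ideal_smult_def)
qed

text \<open>A component of large degree is a combination of the generators with monomial coefficients of
  large degree, hence with coefficients in a high power of the maximal ideal; \<open>width\<close> accounts
  for the degrees of the generators.\<close>

lemma vanishing_in_submod:
  assumes m: "m \<in> carrier M" and van: "\<And>n. n < (p + q) * k + width \<Longrightarrow> coordm m n = 0"
  shows "m \<in> submod k"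
proof -
  have "component m d \<in> submod k" for d
  proof (cases "d + low < int ((p + q) * k + width)")
    case True
    have "component m d = \<zero>"
    proof (cases "d + low < 0")
      case False
      define n where "n = nat (d + low)"
      have n: "int n - low = d" "n < (p + q) * k + width" using True False by (simp_all only: n_def nat_less_iff not_less int_nat_eq) simp
      obtain c where c: "c \<in> cspace (int n - low)" "component m (int n - low) = combo (int n - low) c"
        "coordm m n = red c" using m by (rule coordm_ex)
      hence "combo (int n - low) c = \<zero>" using red_zero_imp[OF c(1)] van[OF n(2)] by simp
      thus ?thesis using c(2) n(1) by simp
    qed (use component_low[OF m] in auto)
    thus ?thesis by (simp add: submod_zero)
  next
    case False
    obtain c where c: "component m d = combo d c" using combo_surj[OF m] by blast
    have "hmon (c i) (d - snd i) \<in> mpow k" if "i \<in> idx" for i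
      using width[OF that] False by (intro hmon_in_mpow) linarith
    thus ?thesis
      unfolding c combo_def
      by (intro finsum_in_subgroup submod_subgroup finite_idx smult_in_submod) (auto intro: el_carrier)
  qed
  hence "(\<Oplus>d\<in>{d. component m d \<noteq> \<zero>}. component m d) \<in> submod k"
    using component_finite[OF m] by (intro finsum_in_subgroup submod_subgroup) auto
  thus ?thesis using component_sum[OF m component_finite[OF m]] by simp
qed

lemma coordm_surj:
  assumes "\<And>n. h n \<in> piece n"
  shows "\<exists>m\<in>carrier M. \<forall>n. coordm m n = (if n < k then h n else 0)"
proof (induction k)
  case 0
  show ?case by (intro bexI[of _ "\<zero>"]) (simp_all add: coordm_zero)
next
  case (Suc k)
  then obtain m where m: "m \<in> carrier M" "\<And>n. coordm m n = (if n < k then h n else 0)" by blast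
  obtain c where c: "c \<in> cspace (int k - low)" "h k = red c" using assms[of k] by (auto simp: piece_def)
  define m' where "m' = combo (int k - low) c"
  have m': "m' \<in> Mgr (int k - low)" unfolding m'_def by (rule combo_in)
  have m'M: "m' \<in> carrier M" using m' by (rule Mgr_carrier)
  have "coordm m' n = (if n = k then h k else 0)" for n
  proof (cases "n = k")
    case True
    have "coordm m' k = red c"
      using c(1) by (intro coordm_eq m'M) (auto simp: component_homogeneous[OF m'], simp add: m'_def)
    thus ?thesis using True c(2) by simp
  next
    case False
    have "0 \<in> cspace (int n - low)" by (simp add: cspace_def)
    hence "coordm m' n = red 0"
      using False by (intro coordm_eq m'M) (auto simp: component_homogeneous[OF m'] combo_zero)
    moreover have "0 \<in> relations" by (simp add: relations_def cspace_def combo_zero)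
    hence "red 0 = 0" using red(2) by blast
    ultimately show ?thesis using False by simp
  qed
  hence "coordm (m \<oplus> m') n = (if n < Suc k then h n else 0)" for n
    using m m'M by (simp add: coordm_add)
  thus ?case using m(1) m'M by (intro bexI[of _ "m \<oplus> m'"]) auto
qed

sublocale module_limit: coset_coordinates M submod coordm piece "\<lambda>k. (p + q) * k + width"
proof (intro coset_coordinates.intro coset_coordinates_axioms.intro)
  show "abelian_group M" by (rule M.M.abelian_group_axioms)
  show "subgroup (submod k) (add_monoid M)" for k by (rule submod_subgroup)
  show "submod (Suc k) \<subseteq> submod k" for k
    unfolding ideal_smult_def
    by (rule M.M.add.mono_generate) (use power_antimono[of k "Suc k"] in auto)
  show "coordm (m \<oplus> m') n = coordm m n + coordm m' n"
    if "m \<in> carrier M" "m' \<in> carrier M" for m m' n using that by (rule coordm_add)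
  show "coordm m n \<in> piece n" if "m \<in> carrier M" for m n
    using coordm_ex[OF that, of n] by (auto simp: piece_def)
  show "coordm m n = 0" if "m \<in> submod k" "n < k" for m n k using that by (rule submod_vanishing)
  show "m \<in> submod k" if "m \<in> carrier M" "\<And>n. n < (p + q) * k + width \<Longrightarrow> coordm m n = 0" for m k
    using that by (rule vanishing_in_submod)
  show "\<exists>m\<in>carrier M. \<forall>n<k. coordm m n = h n" if h: "\<And>n. h n \<in> piece n" for h k
  proof -
    obtain m where m: "m \<in> carrier M" "\<forall>n. coordm m n = (if n < k then h n else 0)"
      using coordm_surj[OF h] by blast
    thus ?thesis by (intro bexI[of _ m]) simp_all
  qed
  show "mono (\<lambda>k. (p + q) * k + width)" by (auto intro!: monoI)
  have "1 * k \<le> (p + q) * k" for k using p_pos by (intro mult_le_mono) auto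
  thus "k \<le> (p + q) * k + width" for k by (simp add: trans_le_add1)
qed

lemma families_eq: "filt.families = {h. \<forall>n. h n \<in> piece n}"
  by (simp add: filt.families_def)

text \<open>The completion of the module consists of all families of homogeneous components, on which the
  connection has been constructed.\<close>

theorem integrable_connection_of_completion:
  fixes N :: "(nat \<Rightarrow> 'k poly poly set set, 'n, 'y) module_scheme"
  assumes modl: "module B N" and iso: "module_isomorphic B N (completion_module A mm M)"
  shows "\<exists>nabla. is_connection (completed_curve_scalar f) B N nabla \<and>
                 is_integrable (completed_curve_scalar f) B N nabla"
proof -
  interpret N: module B N by (rule modl)
  let ?L = "completion_module A mm M"
  obtain \<phi> where \<phi>_bij: "bij_betw \<phi> (carrier N) (carrier ?L)"
    and \<phi>_add: "\<And>m n. m \<in> carrier N \<Longrightarrow> n \<in> carrier N \<Longrightarrow> \<phi> (m \<oplus>\<^bsub>N\<^esub> n) = \<phi> m \<oplus>\<^bsub>?L\<^esub> \<phi> n"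
    and \<phi>_smult: "\<And>b n. b \<in> carrier B \<Longrightarrow> n \<in> carrier N \<Longrightarrow> \<phi> (b \<odot>\<^bsub>N\<^esub> n) = b \<odot>\<^bsub>?L\<^esub> \<phi> n"
    using iso unfolding module_isomorphic_def by blast
  have L: "carrier ?L = coset_limit M submod"
    "\<mu> \<oplus>\<^bsub>?L\<^esub> \<nu> = (\<lambda>n. \<mu> n <+>\<^bsub>M\<^esub> \<nu> n)"
    "b \<odot>\<^bsub>?L\<^esub> \<mu> = (\<lambda>n. \<Union>a\<in>b n. \<Union>m\<in>\<mu> n. submod n +> (a \<odot> m))" for \<mu> \<nu> b
    by (simp_all add: completion_module_def Let_def)
  have \<phi>_in: "\<phi> n \<in> coset_limit M submod" if "n \<in> carrier N" for n
    using \<phi>_bij that L(1) by (auto simp: bij_betw_def)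
  define h where "h = (\<lambda>n. module_limit.limit_coords (\<phi> n))"
  have h_eq: "h n k = coordm m k" if "n \<in> carrier N" "m \<in> \<phi> n l" "k < l" for n m k l
    unfolding h_def using module_limit.limit_coords_eq[OF \<phi>_in[OF that(1)] that(2,3)] .
  have repr: "\<exists>m\<in>carrier M. m \<in> \<phi> n l" if "n \<in> carrier N" for n l
    using module_limit.limit_nonempty[OF \<phi>_in[OF that]] module_limit.limit_coset(1)[OF \<phi>_in[OF that]]
    by blast
  show ?thesis
  proof (rule filt.integrable_connection_transport[OF modl])
    show "bij_betw expansion (carrier B) (supported S)" using expansion_bij degs_eq by simp
    show "expansion (a \<oplus>\<^bsub>B\<^esub> b) = expansion a + expansion b"
      "expansion (a \<otimes>\<^bsub>B\<^esub> b) = expansion a * expansion b" if "a \<in> carrier B" "b \<in> carrier B" for a b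
      using that expansion_add expansion_mult N.R.is_cring by auto
    show "completed_curve_scalar f c \<in> carrier B" "expansion (completed_curve_scalar f c) = fps_const c" for c
      by (rule scalar_in expansion_scalar)+
    show "bij_betw h (carrier N) filt.families"
      using bij_betw_trans[OF \<phi>_bij[unfolded L(1)] module_limit.limit_coords_bij]
      unfolding families_eq h_def comp_def .
    show "h (m \<oplus>\<^bsub>N\<^esub> n) = (\<lambda>i. h m i + h n i)" if mn: "m \<in> carrier N" "n \<in> carrier N" for m n
    proof
      fix k
      obtain a where a: "a \<in> carrier M" "a \<in> \<phi> m (Suc k)" using repr mn(1) by blast
      obtain b where b: "b \<in> carrier M" "b \<in> \<phi> n (Suc k)" using repr mn(2) by blast
      have "a \<oplus> b \<in> \<phi> (m \<oplus>\<^bsub>N\<^esub> n) (Suc k)"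
        unfolding \<phi>_add[OF mn] L(2) using a b by (auto simp: set_add_def')
      from h_eq[OF N.M.a_closed[OF mn] this, of k] show "h (m \<oplus>\<^bsub>N\<^esub> n) k = h m k + h n k"
        using h_eq[OF mn(1) a(2)] h_eq[OF mn(2) b(2)] coordm_add[OF a(1) b(1)] by simp
    qed
    show "h (b \<odot>\<^bsub>N\<^esub> n) = filt.conv (expansion b) (h n)" if bn: "b \<in> carrier B" "n \<in> carrier N" for b n
    proof
      fix k
      obtain a where a: "a \<in> carrier A" "a \<in> b (Suc k)" using limit_repr bn(1) by blast
      obtain m where m: "m \<in> carrier M" "m \<in> \<phi> n (Suc k)" using repr bn(2) by blast
      have "a \<odot> m \<in> submod (Suc k) +> (a \<odot> m)"
        using a m by (intro module_limit.coset_self) auto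
      hence "a \<odot> m \<in> \<phi> (b \<odot>\<^bsub>N\<^esub> n) (Suc k)"
        unfolding \<phi>_smult[OF bn] L(3) using a m by blast
      from h_eq[OF N.smult_closed[OF bn] this, of k]
      have "h (b \<odot>\<^bsub>N\<^esub> n) k = filt.conv (series a) (coordm m) k"
        using coordm_smult[OF a(1) m(1)] by simp
      also have "\<dots> = filt.conv (expansion b) (h n) k"
        unfolding filt.conv_def
        using expansion_nth[OF bn(1) a(2)] h_eq[OF bn(2) m(2)] by (intro sum.cong) auto
      finally show "h (b \<odot>\<^bsub>N\<^esub> n) k = filt.conv (expansion b) (h n) k" .
    qed
  qed
qed

end


section \<open>Parametrization of irreducible quasi-homogeneous curves\<close>

lemma param_y_axis: "fps_nth (param 1 1 0 1 P) n = coeff (coeff P n) 0"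
proof (induction P arbitrary: n)
  case (pCons c P)
  have "weighted_subst 1 0 c = fps_const (coeff c 0)"
    by (induction c) (simp_all add: weighted_subst_def pcompose_pCons fps_of_poly_const)
  thus ?case using pCons.IH by (cases n) (simp_all add: param_pCons)
qed simp

lemma parametrized_y_axis:
  assumes "\<And>P. [:[:0, 1:]:] dvd P \<longleftrightarrow> f dvd P"
  shows "parametrized_curve f 1 1 0 (1 :: 'k::field)"
proof
  fix P :: "'k poly poly"
  have "param 1 1 0 1 P = 0 \<longleftrightarrow> (\<forall>n. coeff (coeff P n) 0 = 0)"
    by (simp add: fps_eq_iff param_y_axis del: One_nat_def)
  also have "\<dots> \<longleftrightarrow> (\<forall>n. [:0, 1:] dvd coeff P n)"
    using poly_eq_0_iff_dvd[of _ "0 :: 'k"] by (simp add: poly_0_coeff_0)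
  also have "\<dots> \<longleftrightarrow> f dvd P" using assms[of P] by (simp add: const_poly_dvd_iff)
  finally show "param 1 1 0 1 P = 0 \<longleftrightarrow> f dvd P" .
qed auto

lemma parametrized_x_axis:
  assumes "\<And>P. [:0, 1:] dvd P \<longleftrightarrow> f dvd P"
  shows "parametrized_curve f 1 1 (1 :: 'k::field) 0"
proof
  fix P :: "'k poly poly"
  have w: "weighted_subst 1 1 c = 0 \<longleftrightarrow> c = 0" for c :: "'k poly"
    by (simp add: weighted_subst_def monom_altdef pcompose_idR)
  have "param 1 1 1 0 P = weighted_subst 1 1 (coeff P 0)"
    by (cases P) (simp add: param_pCons)
  hence "param 1 1 1 0 P = 0 \<longleftrightarrow> poly P 0 = 0" by (simp add: w poly_0_coeff_0 del: One_nat_def)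
  also have "\<dots> \<longleftrightarrow> f dvd P" using assms[of P] poly_eq_0_iff_dvd[of P 0] by simp
  finally show "param 1 1 1 0 P = 0 \<longleftrightarrow> f dvd P" .
qed auto

definition binomial_curve :: "nat \<Rightarrow> nat \<Rightarrow> 'k::field \<Rightarrow> 'k poly poly" where
  "binomial_curve p q \<beta> = monom 1 p - [:monom (\<beta> ^ p) q:]"

text \<open>Modulo the binomial \<open>y^p - \<beta>^p x^q\<close>, which is monic in \<open>y\<close>, every polynomial has a
  representative of degree less than \<open>p\<close> in \<open>y\<close>. Since \<open>p\<close> and \<open>q\<close> are coprime, distinct monomials
  of such a representative have distinct degrees \<open>p i + q j\<close>, and the parametrization is
  injective on them.\<close>

lemma binomial_remainder:
  assumes "0 < p"
  shows "\<exists>R. (\<forall>j\<ge>p. coeff R j = 0) \<and> binomial_curve p q \<beta> dvd P - R"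
proof (induction P)
  case 0
  show ?case by (rule exI[of _ 0]) simp
next
  case (pCons c P)
  let ?g = "binomial_curve p q \<beta>"
  obtain R where R: "\<And>j. j \<ge> p \<Longrightarrow> coeff R j = 0" "?g dvd P - R" using pCons.IH by blast
  define a where "a = coeff R (p - 1)"
  define R' where "R' = pCons c R - smult a ?g"
  have g: "coeff ?g p = 1" "\<And>j. j > p \<Longrightarrow> coeff ?g j = 0"
    using assms by (auto simp: binomial_curve_def coeff_pCons split: nat.splits)
  have "coeff R' j = 0" if "j \<ge> p" for j
  proof (cases "j = p")
    case True
    thus ?thesis using assms g by (simp add: R'_def a_def coeff_pCons split: nat.splits)
  next
    case False
    hence "p < j" using that by simp
    moreover from this have "coeff R (j - 1) = 0" by (intro R(1)) simp
    ultimately show ?thesis using g by (cases j) (simp_all add: R'_def)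
  qed
  moreover have "pCons c P - R' = [:0, 1:] * (P - R) + smult a ?g"
    by (simp add: R'_def)
  hence "?g dvd pCons c P - R'" using R(2) by (simp only: dvd_add dvd_mult dvd_smult dvd_refl)
  ultimately show ?case by blast
qed

lemma param_binomial_curve:
  assumes "0 < p"
  shows "param p q 1 \<beta> (binomial_curve p q \<beta>) = 0"
proof -
  have "param p q 1 \<beta> (monom (monom 1 0) p) = param p q 1 \<beta> (monom (monom (\<beta> ^ p) q) 0)"
    unfolding param_monom by (simp add: mult.commute)
  thus ?thesis by (simp add: binomial_curve_def monom_0 one_pCons)
qed

lemma param_binomial_zero_iff:
  assumes "coprime p q" "0 < p" "0 < q" "\<beta> \<noteq> 0"
  shows "param p q 1 \<beta> P = 0 \<longleftrightarrow> binomial_curve p q \<beta> dvd P"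
proof
  assume "binomial_curve p q \<beta> dvd P"
  thus "param p q 1 \<beta> P = 0" using param_binomial_curve[OF assms(2), of q \<beta>] by (auto elim!: dvdE)
next
  assume P: "param p q 1 \<beta> P = 0"
  obtain R where R: "\<And>j. j \<ge> p \<Longrightarrow> coeff R j = 0" "binomial_curve p q \<beta> dvd P - R"
    using binomial_remainder[OF assms(2)] by blast
  obtain k where k: "P - R = binomial_curve p q \<beta> * k" using R(2) by (rule dvdE)
  have "param p q 1 \<beta> (P - R) = 0"
    unfolding k param_mult param_binomial_curve[OF assms(2)] by simp
  hence parR: "param p q 1 \<beta> R = 0" using P by simp
  have "coeff (coeff R j) i = 0" for i j
  proof (rule ccontr)
    assume nz: "coeff (coeff R j) i \<noteq> 0"
    hence "j < p" using R(1)[of j] by (cases "j < p") auto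
    define T where "T = (\<lambda>j' i'. if p * i + q * j = p * i' + q * j'
        then coeff (coeff R j') i' * 1 ^ i' * \<beta> ^ j' else 0)"
    have only: "j' = j \<and> i' = i" if "T j' i' \<noteq> 0" for i' j'
    proof -
      have eq: "p * i + q * j = p * i' + q * j'" and "coeff (coeff R j') i' \<noteq> 0"
        using that by (auto simp: T_def split: if_splits)
      hence "j' < p" using R(1)[of j'] by (cases "j' < p") auto
      have "int p * (int i - int i') = int q * (int j' - int j)"
        using arg_cong[OF eq, of int] by (simp add: algebra_simps)
      hence "int p dvd int q * (int j' - int j)" by (metis dvd_triv_left)
      hence "int p dvd int j' - int j"
        using assms(1) by (simp add: coprime_dvd_mult_right_iff)
      hence "int j' - int j = 0"
        using \<open>j < p\<close> \<open>j' < p\<close> dvd_imp_le_int[of "int j' - int j" "int p"] by linarith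
      thus ?thesis using eq assms(2) by simp
    qed
    have "fps_nth (param p q 1 \<beta> R) (p * i + q * j) =
        (\<Sum>j'\<le>degree R. \<Sum>i'\<le>degree (coeff R j'). T j' i')"
      unfolding param_nth T_def ..
    also have "\<dots> = (\<Sum>j'\<in>{j}. \<Sum>i'\<le>degree (coeff R j'). T j' i')"
    proof (rule sum.mono_neutral_right)
      have "coeff R j \<noteq> 0" using nz by auto
      thus "{j} \<subseteq> {..degree R}" by (simp add: le_degree)
      show "\<forall>j'\<in>{..degree R} - {j}. (\<Sum>i'\<le>degree (coeff R j'). T j' i') = 0"
        using only by (auto intro!: sum.neutral)
    qed auto
    also have "\<dots> = (\<Sum>i'\<in>{i}. T j i')"
    proof -
      have "(\<Sum>i'\<le>degree (coeff R j). T j i') = (\<Sum>i'\<in>{i}. T j i')"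
        by (rule sum.mono_neutral_right) (use nz only in \<open>auto simp: le_degree\<close>)
      thus ?thesis by simp
    qed
    finally have "T j i = 0" using parR by simp
    thus False using nz assms(4) by (simp add: T_def)
  qed
  hence "R = 0" by (simp add: poly_eq_iff)
  thus "binomial_curve p q \<beta> dvd P" using R(2) by simp
qed

lemma irreducible_dvd_cong:
  fixes f g :: "'a::algebraic_semidom"
  assumes "irreducible f" "g dvd f" "\<not> is_unit g"
  shows "g dvd P \<longleftrightarrow> f dvd P"
proof -
  obtain u where u: "f = g * u" using assms(2) by (rule dvdE)
  hence "is_unit u" using irreducibleD[OF assms(1) u] assms(3) by blast
  thus ?thesis unfolding u by (simp add: mult_unit_dvd_iff)
qed

text \<open>A point \<open>(1, \<beta>)\<close> with \<open>\<beta> \<noteq> 0\<close> on the curve: the dehomogenization \<open>f(1, y)\<close> has the same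
  coefficients as \<open>f\<close>, hence a nonzero constant term when \<open>y\<close> does not divide \<open>f\<close>, and it is
  not constant when \<open>x\<close> does not divide \<open>f\<close>.\<close>

lemma point_exists:
  fixes f :: "'k::alg_closed_field poly poly"
  assumes p: "0 < p" and d: "0 < d" and f: "f \<in> poly_homogeneous p q d"
    and x: "\<not> [:[:0, 1:]:] dvd f" and y: "\<not> [:0, 1:] dvd f"
  obtains \<beta> where "\<beta> \<noteq> 0" "param p q 1 \<beta> f = 0"
proof -
  define h where "h = map_poly (\<lambda>c. poly c 1) f"
  have coeff_h: "coeff h j = poly (coeff f j) 1" for j by (simp add: h_def coeff_map_poly)
  have single: "\<exists>c i. coeff f j = monom c i" for j
  proof (cases "coeff f j = 0")
    case True
    thus ?thesis by (metis monom_eq_0)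
  next
    case False
    define i where "i = degree (coeff f j)"
    have i: "coeff (coeff f j) i \<noteq> 0" using False by (simp add: i_def)
    have "coeff (coeff f j) i' = 0" if "i' \<noteq> i" for i'
    proof (rule ccontr)
      assume "coeff (coeff f j) i' \<noteq> 0"
      hence "int (p * i' + q * j) = d" using f unfolding poly_homogeneous_def by blast
      moreover have "int (p * i + q * j) = d" using f i unfolding poly_homogeneous_def by blast
      ultimately have "p * i' + q * j = p * i + q * j" by linarith
      thus False using that p by simp
    qed
    hence "coeff f j = monom (coeff (coeff f j) i) i" by (intro poly_eqI) simp
    thus ?thesis by blast
  qed
  have h_zero_iff: "coeff h j = 0 \<longleftrightarrow> coeff f j = 0" for j
    using single[of j] by (auto simp: coeff_h poly_monom)
  have h0: "coeff h 0 \<noteq> 0"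
    using y poly_eq_0_iff_dvd[of f 0] by (simp add: h_zero_iff poly_0_coeff_0)
  have "degree h \<noteq> 0"
  proof
    assume "degree h = 0"
    hence "coeff f j = 0" if "j > 0" for j using that h_zero_iff[of j] by (simp add: coeff_eq_0)
    moreover obtain c i where ci: "coeff f 0 = monom c i" using single by blast
    ultimately have f_eq: "f = [:monom c i:]"
      by (intro poly_eqI) (auto simp: coeff_pCons split: nat.splits)
    have "c \<noteq> 0" using h0 ci h_zero_iff by auto
    hence "int (p * i + q * 0) = d"
    proof -
      have "coeff (coeff f 0) i \<noteq> 0" using ci \<open>c \<noteq> 0\<close> by simp
      thus ?thesis using f unfolding poly_homogeneous_def by blast
    qed
    hence "i \<noteq> 0" using d by (cases i) auto
    then obtain i' where "i = Suc i'" using not0_implies_Suc by blast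
    hence "f = [:[:0, 1:]:] * [:monom c i':]" using f_eq by (simp add: monom_Suc)
    hence "[:[:0, 1:]:] dvd f" by (rule dvdI)
    thus False using x by blast
  qed
  then obtain \<beta> where \<beta>: "poly h \<beta> = 0"
    using alg_closed_imp_poly_has_root[of h] by auto
  have "\<beta> \<noteq> 0" using \<beta> h0 by (auto simp: poly_0_coeff_0)
  moreover have "param p q 1 \<beta> f = 0"
  proof (rule fps_ext)
    fix n
    show "fps_nth (param p q 1 \<beta> f) n = fps_nth 0 n"
    proof (cases "int n = d")
      case False
      thus ?thesis using param_homogeneous[OF f] by simp
    next
      case True
      have "fps_nth (param p q 1 \<beta> f) n =
          (\<Sum>j\<le>degree f. \<Sum>i\<le>degree (coeff f j). coeff (coeff f j) i * 1 ^ i * \<beta> ^ j)"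
        unfolding param_nth
      proof (intro sum.cong refl)
        fix i j
        have "n = p * i + q * j" if "coeff (coeff f j) i \<noteq> 0"
        proof -
          have "int (p * i + q * j) = int n"
            using f that unfolding True poly_homogeneous_def by blast
          thus ?thesis by linarith
        qed
        thus "(if n = p * i + q * j then coeff (coeff f j) i * 1 ^ i * \<beta> ^ j else 0) =
            coeff (coeff f j) i * 1 ^ i * \<beta> ^ j" by auto
      qed
      also have "\<dots> = (\<Sum>j\<le>degree f. coeff h j * \<beta> ^ j)"
        by (simp add: coeff_h poly_altdef sum_distrib_right)
      also have "\<dots> = (\<Sum>j\<le>degree h. coeff h j * \<beta> ^ j)"
      proof (rule sum.mono_neutral_right)
        show "{..degree h} \<subseteq> {..degree f}"
          unfolding h_def by (auto intro: order_trans[OF _ map_poly_degree_leq])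
        show "\<forall>j\<in>{..degree f} - {..degree h}. coeff h j * \<beta> ^ j = 0"
          by (auto simp: coeff_eq_0)
      qed auto
      also have "\<dots> = 0" using \<beta> by (simp add: poly_altdef)
      finally show ?thesis by simp
    qed
  qed
  ultimately show thesis by (rule that)
qed

text \<open>An irreducible \<open>f\<close> is, up to a unit, \<open>x\<close>, \<open>y\<close> or a binomial, since each of these divides
  \<open>f\<close> as soon as \<open>f\<close> vanishes along the corresponding parametrized curve.\<close>

lemma quasi_homogeneous_parametrization:
  fixes f :: "'k::alg_closed_field poly poly"
  assumes "0 < p" "0 < q" "coprime p q" "0 < d" "f \<in> poly_homogeneous p q d" "irreducible f"
  obtains (smooth) p' q' \<alpha> \<beta> where "parametrized_curve f p' q' \<alpha> \<beta>" "param_degrees p' q' \<alpha> \<beta> = UNIV"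
    | (singular) \<beta> where "2 \<le> p" "2 \<le> q" "\<beta> \<noteq> 0" "parametrized_curve f p q 1 \<beta>"
proof -
  consider (x) "[:[:0, 1:]:] dvd f" | (y) "[:0, 1:] dvd f"
    | (none) "\<not> [:[:0, 1:]:] dvd f" "\<not> [:0, 1:] dvd f" by blast
  thus thesis
  proof cases
    case x
    have "\<not> is_unit ([:[:0, 1:]:] :: 'k poly poly)" by (simp add: is_unit_const_poly_iff is_unit_pCons_iff)
    hence "parametrized_curve f 1 1 0 1"
      using irreducible_dvd_cong[OF assms(6) x] by (intro parametrized_y_axis)
    moreover have "n \<in> param_degrees 1 1 0 (1 :: 'k)" for n
      unfolding param_degrees_def by (rule CollectI, rule exI[of _ 0], rule exI[of _ n]) simp
    ultimately show thesis using smooth[of 1 1 0 1] by blast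
  next
    case y
    have "\<not> is_unit ([:0, 1:] :: 'k poly poly)" by (simp add: is_unit_poly_iff)
    hence "parametrized_curve f 1 1 1 0"
      using irreducible_dvd_cong[OF assms(6) y] by (intro parametrized_x_axis)
    moreover have "n \<in> param_degrees 1 1 (1 :: 'k) 0" for n
      unfolding param_degrees_def by (rule CollectI, rule exI[of _ n], rule exI[of _ 0]) simp
    ultimately show thesis using smooth[of 1 1 1 0] by blast
  next
    case none
    obtain \<beta> where \<beta>: "\<beta> \<noteq> 0" "param p q 1 \<beta> f = 0"
      using point_exists[OF assms(1,4,5) none] .
    note iff = param_binomial_zero_iff[OF assms(3,1,2) \<beta>(1)]
    have "\<not> is_unit (binomial_curve p q \<beta>)"
    proof
      assume "is_unit (binomial_curve p q \<beta>)"
      hence "param p q 1 \<beta> [:[:1:]:] = 0" using iff by (metis unit_imp_dvd)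
      thus False by (simp only: param_const) simp
    qed
    moreover have "binomial_curve p q \<beta> dvd f" using iff \<beta>(2) by blast
    ultimately have "binomial_curve p q \<beta> dvd P \<longleftrightarrow> f dvd P" for P
      using irreducible_dvd_cong[OF assms(6)] by blast
    hence curve: "parametrized_curve f p q 1 \<beta>"
      using assms(1,2) iff by unfold_locales auto
    show thesis
    proof (cases "2 \<le> p \<and> 2 \<le> q")
      case True
      thus thesis using singular \<beta>(1) curve by blast
    next
      case False
      hence "p = 1 \<or> q = 1" using assms(1,2) by linarith
      moreover have "n \<in> param_degrees p q 1 \<beta>" if "p = 1" for n
        unfolding param_degrees_def by (rule CollectI, rule exI[of _ n], rule exI[of _ 0]) (simp add: that)
      moreover have "n \<in> param_degrees p q 1 \<beta>" if "q = 1" for n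
        unfolding param_degrees_def using \<beta>(1)
        by (intro CollectI exI[of _ 0] exI[of _ n]) (simp add: that)
      ultimately have "param_degrees p q 1 \<beta> = UNIV" by blast
      thus thesis using smooth curve by blast
    qed
  qed
qed


section \<open>Integrable connections on gradable modules\<close>

theorem corollary3:
  fixes f :: "'k::{alg_closed_field, field_char_0} poly poly"
    and wx wy :: nat and d :: int
    and N :: "(nat \<Rightarrow> 'k poly poly set set, 'n) module"
  assumes "wx > 0" and "wy > 0" and "coprime wx wy"
    and "d > 0" and "f \<in> poly_homogeneous wx wy d"
    and "irreducible f"
    and "module (completed_curve_ring f) N"
    and "finitely_generated (completed_curve_ring f) N"
    and "torsion_free (completed_curve_ring f) (nonzero_divisors (completed_curve_ring f)) N"
    and "gradable TYPE('m) wx wy f N"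
  shows "\<exists>nabla. is_connection (completed_curve_scalar f) (completed_curve_ring f) N nabla \<and>
                 is_integrable (completed_curve_scalar f) (completed_curve_ring f) N nabla"
  using assms(1-6)
proof (cases rule: quasi_homogeneous_parametrization)
  case (smooth p q \<alpha> \<beta>)
  interpret parametrized_curve f p q \<alpha> \<beta> by (rule smooth)
  interpret N: module B N by (rule assms)
  have "(supported degs :: 'k fps set) = UNIV" unfolding smooth(2) by (auto simp: supported_def)
  thus ?thesis
    using expansion_bij scalar_in expansion_add[OF N.R.is_cring] expansion_mult[OF N.R.is_cring]
    by (intro integrable_connection_over_power_series[OF assms(7-9), of expansion]) auto
next
  case (singular \<beta>)
  obtain M :: "('k poly poly set, 'm) module" and Mgr where M:
    "graded_module (curve_ring f) (curve_grading wx wy f) M Mgr"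
    "finitely_generated (curve_ring f) M"
    "torsion_free (curve_ring f) (homogeneous_nonzero_divisors wx wy f) M"
    "module_isomorphic (completed_curve_ring f) N (completion_module (curve_ring f) (curve_max_ideal f) M)"
    using assms(10) unfolding gradable_def by blast
  interpret graded_curve_module f wx wy 1 \<beta> M Mgr
    using singular assms(3) M
    by (intro graded_curve_module.intro coprime_pair.intro graded_curve_module_axioms.intro) auto
  show ?thesis using assms(7) M(4) by (rule integrable_connection_of_completion)
qed


end
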